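(* Let $R$ be a commutative ring and let $X$ be the disjoint union of two directed spaces $X_1$ and $X_2$. Let $R[X_1]\oplus R[X_2]$ denote the coproduct of $R[X_1]$ and $R[X_2]$ as simplicial (non-unital associative) $R$-algebras, and let $h:R[X_1]\oplus R[X_2]\to R[X]$ be the map of simplicial algebras induced by the inclusions $X_1\to X$ and $X_2\to X$ and the universal property of the coproduct. Then $$0\to \mathrm{Ker}\,h\to R[X_1]\oplus R[X_2]\xrightarrow{\,h\,}R[X]\to 0$$ is a short exact sequence of simplicial algebras, and there is a long exact sequence of homology algebras $$\cdots\to HA_{q+1}(X)\xrightarrow{d_*}HA_q(\mathrm{Ker}\,h)\to HA_q(R[X_1]\oplus R[X_2])\to HA_q(X)\xrightarrow{d_*}HA_{q-1}(\mathrm{Ker}\,h)\to\cdots$$ for $q\ge 1$ (all terms of index less than $1$ being the $0$ algebra), in which the unnamed maps are induced by the inclusion of $\mathrm{Ker}\,h$ and by $h$.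
   Context: A directed space (d-space) is a topological space $X$ with a set $dX$ of continuous paths $[0,1]\to X$ (the d-paths) containing all constant paths, closed under precomposition with continuous non-decreasing maps $[0,1]\to[0,1]$, and closed under concatenation. The disjoint union of $X_1$ and $X_2$ has the disjoint union topology, and its d-paths are the d-paths of $X_1$ and those of $X_2$. $\Delta_n=\{(t_0,\dots,t_n): t_j\ge 0,\ \sum_j t_j=1\}$ is the standard simplex, with face inclusions $\delta_k:\Delta_{n-1}\to\Delta_n$ (insert $0$ at position $k$) and degeneracies $\sigma_k:\Delta_n\to\Delta_{n-1}$, $0\le k<n$, $(t_0,\dots,t_n)\mapsto(t_0,\dots,t_k+t_{k+1},\dots,t_n)$. For $i\ge 1$, an $i$-path in $X$ is a continuous map $p:[0,1]\times\Delta_{i-1}\to X$ such that $p(\cdot,t)$ is a d-path for every $t\in\Delta_{i-1}$. For $a,b\in X$, an $i$-trace from $a$ to $b$ is a class of $i$-paths $p$ with $p(0,t)=a$ and $p(1,t)=b$ for all $t$, modulo reparametrization in the first coordinate (the equivalence relation generated by $p\sim p\circ(\varphi\times \mathrm{Id})$ with $\varphi:[0,1]\to[0,1]$ continuous, non-decreasing and surjective). The maps $d_j(p)=p\circ(\mathrm{Id}\times\delta_j)$ (from $(i+1)$-paths to $i$-paths, $0\le j\le i$) and $s_k(p)=p\circ(\mathrm{Id}\times\sigma_k)$ (from $i$-paths to $(i+1)$-paths, $0\le k\le i-1$) induce maps on traces preserving start and end points. $R_i[X]$, $i\ge1$, is the free $R$-module on all $i$-traces of $X$, with bilinear product determined on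 basis elements by $p\times q=p*q$ (concatenation in the first coordinate) if the end point of $p$ is the start point of $q$, and $p\times q=0$ otherwise. Extending $d_j,s_k$ linearly, $R[X]=(R_{i+1}[X])_{i\ge0}$ (with $R_{i+1}[X]$ in degree $i$) is a simplicial object in the category $Alg$ of non-unital associative $R$-algebras. An injective d-map $f:X\to Y$ induces a map of simplicial algebras $R[X]\to R[Y]$ by $p\mapsto f\circ p$ on traces. The coproduct of simplicial algebras is computed degreewise in $Alg$ (the non-unital free product of algebras). Kernels are also taken degreewise: $\mathrm{Ker}\,h$ is the simplicial algebra of elements mapped to $0$. Exactness means that the image of each map is the kernel of the next. For a simplicial algebra $S$ with faces $d^n_j:S_n\to S_{n-1}$, its Moore normalization $NS$ is $(NS)_n=\bigcap_{j=0}^{n-1}\ker d^n_j$ with differential $\partial^n=(-1)^n d^n_n:(NS)_n\to(NS)_{n-1}$ (zero for $n=0$). The image of $\partial^{n+1}$ is a two-sided ideal, and $H_n(NS)=\ker\partial^n/\mathrm{Im}\,\partial^{n+1}$ is an algebra. For a simplicial algebra $S$ write $HA_q(S)=H_{q-1}(NS)$, $q\ge 1$; for a directed space $X$, $HA_q(X)=HA_q(R[X])$. *)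

theory Defs
  imports "HOL-Homology.Simplices" "HOL-Algebra.QuotRing" "HOL-Algebra.Module"
begin

section \<open>Directed spaces\<close>

text \<open>A path is a function on the reals that is extensional on the unit interval (it takes the
  value \<^const>\<open>undefined\<close> outside of it), so that equality of paths is equality on the unit
  interval.\<close>

record 'a dspace =
  dtop :: "'a topology"
  dpaths :: "(real \<Rightarrow> 'a) set"

definition path_concat :: "(real \<Rightarrow> 'a) \<Rightarrow> (real \<Rightarrow> 'a) \<Rightarrow> real \<Rightarrow> 'a" where
  "path_concat p q = (\<lambda>s\<in>{0..1}. if s \<le> 1/2 then p (2 * s) else q (2 * s - 1))"

definition is_dspace :: "'a dspace \<Rightarrow> bool" where
  "is_dspace X \<longleftrightarrow>
    (\<forall>p\<in>dpaths X. p \<in> extensional {0..1} \<and> continuous_map (top_of_set {0..1}) (dtop X) p) \<and>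
    (\<forall>a\<in>topspace (dtop X). (\<lambda>s\<in>{0..1}. a) \<in> dpaths X) \<and>
    (\<forall>p\<in>dpaths X. \<forall>\<phi>. continuous_on {0..1} \<phi> \<longrightarrow> mono_on {0..1} \<phi> \<longrightarrow> \<phi> ` {0..1} \<subseteq> {0..1} \<longrightarrow>
        (\<lambda>s\<in>{0..1}. p (\<phi> s)) \<in> dpaths X) \<and>
    (\<forall>p\<in>dpaths X. \<forall>q\<in>dpaths X. p 1 = q 0 \<longrightarrow> path_concat p q \<in> dpaths X)"

definition disjoint_union :: "'a dspace \<Rightarrow> 'b dspace \<Rightarrow> ('a + 'b) dspace" where
  "disjoint_union X Y =
    \<lparr> dtop = topology (\<lambda>U. openin (dtop X) (Inl -` U) \<and> openin (dtop Y) (Inr -` U)),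
      dpaths = (\<lambda>p. \<lambda>s\<in>{0..1}. Inl (p s)) ` dpaths X \<union> (\<lambda>p. \<lambda>s\<in>{0..1}. Inr (p s)) ` dpaths Y \<rparr>"

lemma openin_disjoint_union:
  "openin (dtop (disjoint_union X Y)) U \<longleftrightarrow>
    openin (dtop X) (Inl -` U) \<and> openin (dtop Y) (Inr -` U)"
proof -
  have "istopology (\<lambda>U. openin (dtop X) (Inl -` U) \<and> openin (dtop Y) (Inr -` U))"
    unfolding istopology_def by (auto simp: vimage_Union)
  then show ?thesis
    by (simp add: disjoint_union_def topology_inverse')
qed

lemma topspace_disjoint_union:
  "topspace (dtop (disjoint_union X Y)) = topspace (dtop X) <+> topspace (dtop Y)"
proof
  show "topspace (dtop (disjoint_union X Y)) \<subseteq> topspace (dtop X) <+> topspace (dtop Y)"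
  proof
    fix x assume "x \<in> topspace (dtop (disjoint_union X Y))"
    then obtain U where "openin (dtop (disjoint_union X Y)) U" "x \<in> U"
      by (auto simp: topspace_def)
    then show "x \<in> topspace (dtop X) <+> topspace (dtop Y)"
      by (cases x) (auto simp: openin_disjoint_union dest!: openin_subset)
  qed
  have "Inl -` (topspace (dtop X) <+> topspace (dtop Y)) = topspace (dtop X)"
       "Inr -` (topspace (dtop X) <+> topspace (dtop Y)) = topspace (dtop Y)"
    by auto
  then have "openin (dtop (disjoint_union X Y)) (topspace (dtop X) <+> topspace (dtop Y))"
    by (simp add: openin_disjoint_union)
  then show "topspace (dtop X) <+> topspace (dtop Y) \<subseteq> topspace (dtop (disjoint_union X Y))"
    by (rule openin_subset)
qed


section \<open>Paths parametrized by simplices and their traces\<close>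

definition cylinder :: "nat \<Rightarrow> (real \<times> (nat \<Rightarrow> real)) set" where
  "cylinder i = {0..1} \<times> standard_simplex (i - 1)"

definition ipaths :: "nat \<Rightarrow> 'a dspace \<Rightarrow> (real \<times> (nat \<Rightarrow> real) \<Rightarrow> 'a) set" where
  "ipaths i X = {p \<in> extensional (cylinder i).
     continuous_map
       (prod_topology (top_of_set {0..1}) (subtopology (powertop_real UNIV) (standard_simplex (i - 1))))
       (dtop X) p \<and>
     (\<forall>t\<in>standard_simplex (i - 1). (\<lambda>s\<in>{0..1}. p (s, t)) \<in> dpaths X)}"

definition ipaths_between :: "nat \<Rightarrow> 'a dspace \<Rightarrow> 'a \<Rightarrow> 'a \<Rightarrow> (real \<times> (nat \<Rightarrow> real) \<Rightarrow> 'a) set" where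
  "ipaths_between i X a b =
    {p \<in> ipaths i X. \<forall>t\<in>standard_simplex (i - 1). p (0, t) = a \<and> p (1, t) = b}"

definition reparam :: "nat \<Rightarrow> 'a dspace \<Rightarrow> (real \<times> (nat \<Rightarrow> real) \<Rightarrow> 'a) rel" where
  "reparam i X = {(p, \<lambda>(s, t)\<in>cylinder i. p (\<phi> s, t)) | p \<phi>.
     p \<in> ipaths i X \<and> continuous_on {0..1} \<phi> \<and> mono_on {0..1} \<phi> \<and> \<phi> ` {0..1} = {0..1}}"

definition trace_of :: "nat \<Rightarrow> 'a dspace \<Rightarrow> (real \<times> (nat \<Rightarrow> real) \<Rightarrow> 'a) \<Rightarrow> (real \<times> (nat \<Rightarrow> real) \<Rightarrow> 'a) set" where
  "trace_of i X p = (reparam i X \<union> (reparam i X)\<inverse>)\<^sup>* `` {p}"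

definition traces_between :: "nat \<Rightarrow> 'a dspace \<Rightarrow> 'a \<Rightarrow> 'a \<Rightarrow> (real \<times> (nat \<Rightarrow> real) \<Rightarrow> 'a) set set" where
  "traces_between i X a b = trace_of i X ` ipaths_between i X a b"

definition traces :: "nat \<Rightarrow> 'a dspace \<Rightarrow> (real \<times> (nat \<Rightarrow> real) \<Rightarrow> 'a) set set" where
  "traces i X = (\<Union>a\<in>topspace (dtop X). \<Union>b\<in>topspace (dtop X). traces_between i X a b)"

definition composable :: "nat \<Rightarrow> 'a dspace \<Rightarrow> (real \<times> (nat \<Rightarrow> real) \<Rightarrow> 'a) set \<Rightarrow> (real \<times> (nat \<Rightarrow> real) \<Rightarrow> 'a) set \<Rightarrow> bool" where
  "composable i X P Q \<longleftrightarrow> (\<exists>a b c. P \<in> traces_between i X a b \<and> Q \<in> traces_between i X b c)"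

definition ipath_concat :: "nat \<Rightarrow> (real \<times> (nat \<Rightarrow> real) \<Rightarrow> 'a) \<Rightarrow> (real \<times> (nat \<Rightarrow> real) \<Rightarrow> 'a) \<Rightarrow> real \<times> (nat \<Rightarrow> real) \<Rightarrow> 'a" where
  "ipath_concat i p q =
    (\<lambda>(s, t)\<in>cylinder i. if s \<le> 1/2 then p (2 * s, t) else q (2 * s - 1, t))"

text \<open>Operations on paths that respect reparametrization are carried over to traces as the union
  of the (equal) classes of the results on all representatives.\<close>

definition trace_concat :: "nat \<Rightarrow> 'a dspace \<Rightarrow> (real \<times> (nat \<Rightarrow> real) \<Rightarrow> 'a) set \<Rightarrow> (real \<times> (nat \<Rightarrow> real) \<Rightarrow> 'a) set \<Rightarrow> (real \<times> (nat \<Rightarrow> real) \<Rightarrow> 'a) set" where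
  "trace_concat i X P Q = (\<Union>p\<in>P. \<Union>q\<in>Q. trace_of i X (ipath_concat i p q))"

definition simplex_degen :: "nat \<Rightarrow> (nat \<Rightarrow> real) \<Rightarrow> nat \<Rightarrow> real" where
  "simplex_degen k t = (\<lambda>j. if j < k then t j else if j = k then t k + t (k + 1) else t (j + 1))"

definition trace_face :: "nat \<Rightarrow> nat \<Rightarrow> 'a dspace \<Rightarrow> (real \<times> (nat \<Rightarrow> real) \<Rightarrow> 'a) set \<Rightarrow> (real \<times> (nat \<Rightarrow> real) \<Rightarrow> 'a) set" where \<comment> \<open>from \<open>(i+1)\<close>-traces to \<open>i\<close>-traces\<close>
  "trace_face i j X P = (\<Union>p\<in>P. trace_of i X (\<lambda>(s, t)\<in>cylinder i. p (s, simplical_face j t)))"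

definition trace_degen :: "nat \<Rightarrow> nat \<Rightarrow> 'a dspace \<Rightarrow> (real \<times> (nat \<Rightarrow> real) \<Rightarrow> 'a) set \<Rightarrow> (real \<times> (nat \<Rightarrow> real) \<Rightarrow> 'a) set" where \<comment> \<open>from \<open>i\<close>-traces to \<open>(i+1)\<close>-traces\<close>
  "trace_degen i k X P =
    (\<Union>p\<in>P. trace_of (i + 1) X (\<lambda>(s, t)\<in>cylinder (i + 1). p (s, simplex_degen k t)))"

definition trace_map :: "nat \<Rightarrow> 'b dspace \<Rightarrow> ('a \<Rightarrow> 'b) \<Rightarrow> (real \<times> (nat \<Rightarrow> real) \<Rightarrow> 'a) set \<Rightarrow> (real \<times> (nat \<Rightarrow> real) \<Rightarrow> 'b) set" where
  "trace_map i Y f P = (\<Union>p\<in>P. trace_of i Y (\<lambda>x\<in>cylinder i. f (p x)))"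


section \<open>Non-unital associative algebras\<close>

text \<open>The field \<^const>\<open>one\<close> of the record is never constrained and has no meaning here.\<close>

locale nonunital_algebra = module R A for R (structure) and A (structure) +
  assumes nu_mult_closed: "\<lbrakk>x \<in> carrier A; y \<in> carrier A\<rbrakk> \<Longrightarrow> x \<otimes>\<^bsub>A\<^esub> y \<in> carrier A"
    and nu_mult_assoc: "\<lbrakk>x \<in> carrier A; y \<in> carrier A; z \<in> carrier A\<rbrakk> \<Longrightarrow>
      (x \<otimes>\<^bsub>A\<^esub> y) \<otimes>\<^bsub>A\<^esub> z = x \<otimes>\<^bsub>A\<^esub> (y \<otimes>\<^bsub>A\<^esub> z)"
    and nu_l_distr: "\<lbrakk>x \<in> carrier A; y \<in> carrier A; z \<in> carrier A\<rbrakk> \<Longrightarrow>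
      (x \<oplus>\<^bsub>A\<^esub> y) \<otimes>\<^bsub>A\<^esub> z = x \<otimes>\<^bsub>A\<^esub> z \<oplus>\<^bsub>A\<^esub> y \<otimes>\<^bsub>A\<^esub> z"
    and nu_r_distr: "\<lbrakk>x \<in> carrier A; y \<in> carrier A; z \<in> carrier A\<rbrakk> \<Longrightarrow>
      z \<otimes>\<^bsub>A\<^esub> (x \<oplus>\<^bsub>A\<^esub> y) = z \<otimes>\<^bsub>A\<^esub> x \<oplus>\<^bsub>A\<^esub> z \<otimes>\<^bsub>A\<^esub> y"
    and nu_smult_l: "\<lbrakk>r \<in> carrier R; x \<in> carrier A; y \<in> carrier A\<rbrakk> \<Longrightarrow>
      (r \<odot>\<^bsub>A\<^esub> x) \<otimes>\<^bsub>A\<^esub> y = r \<odot>\<^bsub>A\<^esub> (x \<otimes>\<^bsub>A\<^esub> y)"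
    and nu_smult_r: "\<lbrakk>r \<in> carrier R; x \<in> carrier A; y \<in> carrier A\<rbrakk> \<Longrightarrow>
      x \<otimes>\<^bsub>A\<^esub> (r \<odot>\<^bsub>A\<^esub> y) = r \<odot>\<^bsub>A\<^esub> (x \<otimes>\<^bsub>A\<^esub> y)"

definition alg_hom :: "('r, 'm) ring_scheme \<Rightarrow> ('r, 'a) module \<Rightarrow> ('r, 'b) module \<Rightarrow> ('a \<Rightarrow> 'b) set" where
  "alg_hom R A B = {f. f \<in> hom A B \<and> f \<in> hom (add_monoid A) (add_monoid B) \<and>
     (\<forall>r\<in>carrier R. \<forall>x\<in>carrier A. f (r \<odot>\<^bsub>A\<^esub> x) = r \<odot>\<^bsub>B\<^esub> f x)}"

definition zero_algebra :: "('r, 'a) module" where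
  "zero_algebra = \<lparr> carrier = {undefined}, mult = (\<lambda>_ _. undefined), one = undefined,
     zero = undefined, add = (\<lambda>_ _. undefined), smult = (\<lambda>_ _. undefined) \<rparr>"

definition exact_at :: "('r, 'm) ring_scheme \<Rightarrow> ('r, 'a) module \<Rightarrow> ('a \<Rightarrow> 'b) \<Rightarrow> ('r, 'b) module \<Rightarrow> ('b \<Rightarrow> 'c) \<Rightarrow> ('r, 'c) module \<Rightarrow> bool" where
  "exact_at R A f B g C \<longleftrightarrow>
    nonunital_algebra R A \<and> nonunital_algebra R B \<and> nonunital_algebra R C \<and>
    f \<in> alg_hom R A B \<and> g \<in> alg_hom R B C \<and> f ` carrier A = a_kernel B C g"

text \<open>The free module on \<open>T\<close>, as finitely supported functions, with the bilinear product for which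
  \<open>x \<times> y\<close> is \<open>m x y\<close> if \<open>P x y\<close> holds and \<open>0\<close> otherwise, for basis elements \<open>x\<close> and \<open>y\<close>.\<close>

definition free_on :: "('r, 'm) ring_scheme \<Rightarrow> 'x set \<Rightarrow> ('x \<Rightarrow> 'x \<Rightarrow> bool) \<Rightarrow> ('x \<Rightarrow> 'x \<Rightarrow> 'x) \<Rightarrow> ('r, 'x \<Rightarrow> 'r) module" where
  "free_on R T P m =
    \<lparr> carrier = {u. (\<forall>x. u x \<in> carrier R) \<and> (\<forall>x. x \<notin> T \<longrightarrow> u x = \<zero>\<^bsub>R\<^esub>) \<and> finite {x. u x \<noteq> \<zero>\<^bsub>R\<^esub>}},
      mult = (\<lambda>u v z. finsum R (\<lambda>(x, y). u x \<otimes>\<^bsub>R\<^esub> v y)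
        {(x, y). u x \<noteq> \<zero>\<^bsub>R\<^esub> \<and> v y \<noteq> \<zero>\<^bsub>R\<^esub> \<and> P x y \<and> m x y = z}),
      one = (\<lambda>_. \<zero>\<^bsub>R\<^esub>),
      zero = (\<lambda>_. \<zero>\<^bsub>R\<^esub>),
      add = (\<lambda>u v x. u x \<oplus>\<^bsub>R\<^esub> v x),
      smult = (\<lambda>r u x. r \<otimes>\<^bsub>R\<^esub> u x) \<rparr>"

definition basis :: "('r, 'm) ring_scheme \<Rightarrow> 'x \<Rightarrow> 'x \<Rightarrow> 'r" where
  "basis R x = (\<lambda>y. if y = x then \<one>\<^bsub>R\<^esub> else \<zero>\<^bsub>R\<^esub>)"

text \<open>The linear extension of a map \<open>g\<close> between bases.\<close>

definition lin_ext :: "('r, 'm) ring_scheme \<Rightarrow> ('x \<Rightarrow> 'y) \<Rightarrow> ('x \<Rightarrow> 'r) \<Rightarrow> 'y \<Rightarrow> 'r" where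
  "lin_ext R g u = (\<lambda>y. \<Oplus>\<^bsub>R\<^esub>x\<in>{x. u x \<noteq> \<zero>\<^bsub>R\<^esub> \<and> g x = y}. u x)"

definition alg_ideal :: "('r, 'm) ring_scheme \<Rightarrow> ('r, 'a) module \<Rightarrow> 'a set \<Rightarrow> bool" where
  "alg_ideal R A I \<longleftrightarrow> submodule I R A \<and>
    (\<forall>x\<in>I. \<forall>a\<in>carrier A. a \<otimes>\<^bsub>A\<^esub> x \<in> I \<and> x \<otimes>\<^bsub>A\<^esub> a \<in> I)"

definition gen_alg_ideal :: "('r, 'm) ring_scheme \<Rightarrow> ('r, 'a) module \<Rightarrow> 'a set \<Rightarrow> 'a set" where
  "gen_alg_ideal R A S = \<Inter>{I. alg_ideal R A I \<and> S \<subseteq> I}"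

text \<open>The quotient by an ideal: the library's quotient ring, with scalar multiplication added.\<close>

definition quot_alg :: "('r, 'a) module \<Rightarrow> 'a set \<Rightarrow> ('r, 'a set) module" where
  "quot_alg A I = ring.extend (A Quot I) (module.fields (\<lambda>r K. \<Union>x\<in>K. I +>\<^bsub>A\<^esub> (r \<odot>\<^bsub>A\<^esub> x)))"


subsection \<open>Coproducts\<close>

text \<open>The coproduct (free product) of \<open>A\<close> and \<open>B\<close> by generators and relations: the free
  non-unital algebra on the set \<open>A + B\<close> (the free module on non-empty words), modulo the
  ideal which makes the maps from \<open>A\<close> and from \<open>B\<close> algebra homomorphisms.\<close>

definition free_nonunital :: "('r, 'm) ring_scheme \<Rightarrow> 'x set \<Rightarrow> ('r, 'x list \<Rightarrow> 'r) module" where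
  "free_nonunital R S = free_on R {w. w \<noteq> [] \<and> set w \<subseteq> S} (\<lambda>_ _. True) (@)"

definition hom_relations :: "('r, 'm) ring_scheme \<Rightarrow> ('r, 'a) module \<Rightarrow> ('a \<Rightarrow> 'x) \<Rightarrow> ('r, 'x list \<Rightarrow> 'r) module \<Rightarrow> ('x list \<Rightarrow> 'r) set" where
  "hom_relations R A e F =
     {basis R [e (x \<oplus>\<^bsub>A\<^esub> y)] \<ominus>\<^bsub>F\<^esub> (basis R [e x] \<oplus>\<^bsub>F\<^esub> basis R [e y]) | x y. x \<in> carrier A \<and> y \<in> carrier A} \<union>
     {basis R [e (r \<odot>\<^bsub>A\<^esub> x)] \<ominus>\<^bsub>F\<^esub> (r \<odot>\<^bsub>F\<^esub> basis R [e x]) | r x. r \<in> carrier R \<and> x \<in> carrier A} \<union>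
     {basis R [e (x \<otimes>\<^bsub>A\<^esub> y)] \<ominus>\<^bsub>F\<^esub> (basis R [e x] \<otimes>\<^bsub>F\<^esub> basis R [e y]) | x y. x \<in> carrier A \<and> y \<in> carrier A}"

definition coprod_ideal :: "('r, 'm) ring_scheme \<Rightarrow> ('r, 'a) module \<Rightarrow> ('r, 'b) module \<Rightarrow> (('a + 'b) list \<Rightarrow> 'r) set" where
  "coprod_ideal R A B = (let F = free_nonunital R (carrier A <+> carrier B) in
     gen_alg_ideal R F (hom_relations R A Inl F \<union> hom_relations R B Inr F))"

definition coprod :: "('r, 'm) ring_scheme \<Rightarrow> ('r, 'a) module \<Rightarrow> ('r, 'b) module \<Rightarrow> ('r, (('a + 'b) list \<Rightarrow> 'r) set) module" where
  "coprod R A B = quot_alg (free_nonunital R (carrier A <+> carrier B)) (coprod_ideal R A B)"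

definition coprod_inl :: "('r, 'm) ring_scheme \<Rightarrow> ('r, 'a) module \<Rightarrow> ('r, 'b) module \<Rightarrow> 'a \<Rightarrow> (('a + 'b) list \<Rightarrow> 'r) set" where
  "coprod_inl R A B a =
    coprod_ideal R A B +>\<^bsub>free_nonunital R (carrier A <+> carrier B)\<^esub> basis R [Inl a]"

definition coprod_inr :: "('r, 'm) ring_scheme \<Rightarrow> ('r, 'a) module \<Rightarrow> ('r, 'b) module \<Rightarrow> 'b \<Rightarrow> (('a + 'b) list \<Rightarrow> 'r) set" where
  "coprod_inr R A B b =
    coprod_ideal R A B +>\<^bsub>free_nonunital R (carrier A <+> carrier B)\<^esub> basis R [Inr b]"

text \<open>The map out of the coproduct given by its universal property.\<close>

definition copair :: "('r, 'm) ring_scheme \<Rightarrow> ('r, 'a) module \<Rightarrow> ('r, 'b) module \<Rightarrow> ('r, 'c) module \<Rightarrow> ('a \<Rightarrow> 'c) \<Rightarrow> ('b \<Rightarrow> 'c) \<Rightarrow> (('a + 'b) list \<Rightarrow> 'r) set \<Rightarrow> 'c" where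
  "copair R A B C f g = (THE u. u \<in> alg_hom R (coprod R A B) C \<and> u \<in> extensional (carrier (coprod R A B)) \<and>
     (\<forall>a\<in>carrier A. u (coprod_inl R A B a) = f a) \<and> (\<forall>b\<in>carrier B. u (coprod_inr R A B b) = g b))"


section \<open>Simplicial algebras\<close>

text \<open>\<open>face S n j\<close> maps degree \<open>n\<close> to degree \<open>n - 1\<close> (for \<open>n \<ge> 1\<close> and \<open>j \<le> n\<close>), and
  \<open>degen S n k\<close> maps degree \<open>n\<close> to degree \<open>n + 1\<close> (for \<open>k \<le> n\<close>). Maps of simplicial algebras are
  families of functions indexed by the degree.\<close>

record ('r, 'a) simp_alg =
  level :: "nat \<Rightarrow> ('r, 'a) module"
  face :: "nat \<Rightarrow> nat \<Rightarrow> 'a \<Rightarrow> 'a"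
  degen :: "nat \<Rightarrow> nat \<Rightarrow> 'a \<Rightarrow> 'a"

definition simplicial_algebra :: "('r, 'm) ring_scheme \<Rightarrow> ('r, 'a) simp_alg \<Rightarrow> bool" where
  "simplicial_algebra R S \<longleftrightarrow>
    (\<forall>n. nonunital_algebra R (level S n)) \<and>
    (\<forall>n\<ge>1. \<forall>j\<le>n. face S n j \<in> alg_hom R (level S n) (level S (n - 1))) \<and>
    (\<forall>n. \<forall>k\<le>n. degen S n k \<in> alg_hom R (level S n) (level S (n + 1))) \<and>
    (\<forall>n\<ge>2. \<forall>i j. i < j \<longrightarrow> j \<le> n \<longrightarrow> (\<forall>x\<in>carrier (level S n).
       face S (n - 1) i (face S n j x) = face S (n - 1) (j - 1) (face S n i x))) \<and>
    (\<forall>n i j. i < j \<longrightarrow> j \<le> n \<longrightarrow> (\<forall>x\<in>carrier (level S n).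
       face S (n + 1) i (degen S n j x) = degen S (n - 1) (j - 1) (face S n i x))) \<and>
    (\<forall>n. \<forall>j\<le>n. \<forall>x\<in>carrier (level S n).
       face S (n + 1) j (degen S n j x) = x \<and> face S (n + 1) (j + 1) (degen S n j x) = x) \<and>
    (\<forall>n i j. j + 1 < i \<longrightarrow> i \<le> n + 1 \<longrightarrow> (\<forall>x\<in>carrier (level S n).
       face S (n + 1) i (degen S n j x) = degen S (n - 1) j (face S n (i - 1) x))) \<and>
    (\<forall>n i j. i \<le> j \<longrightarrow> j \<le> n \<longrightarrow> (\<forall>x\<in>carrier (level S n).
       degen S (n + 1) i (degen S n j x) = degen S (n + 1) (j + 1) (degen S n i x)))"

definition simplicial_map :: "('r, 'm) ring_scheme \<Rightarrow> ('r, 'a) simp_alg \<Rightarrow> ('r, 'b) simp_alg \<Rightarrow> (nat \<Rightarrow> 'a \<Rightarrow> 'b) \<Rightarrow> bool" where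
  "simplicial_map R S T f \<longleftrightarrow>
    (\<forall>n. f n \<in> alg_hom R (level S n) (level T n)) \<and>
    (\<forall>n\<ge>1. \<forall>j\<le>n. \<forall>x\<in>carrier (level S n). f (n - 1) (face S n j x) = face T n j (f n x)) \<and>
    (\<forall>n. \<forall>k\<le>n. \<forall>x\<in>carrier (level S n). f (n + 1) (degen S n k x) = degen T n k (f n x))"

definition simp_coprod :: "('r, 'm) ring_scheme \<Rightarrow> ('r, 'a) simp_alg \<Rightarrow> ('r, 'b) simp_alg \<Rightarrow> ('r, (('a + 'b) list \<Rightarrow> 'r) set) simp_alg" where
  "simp_coprod R S T =
    \<lparr> level = (\<lambda>n. coprod R (level S n) (level T n)),
      face = (\<lambda>n j. copair R (level S n) (level T n) (coprod R (level S (n - 1)) (level T (n - 1)))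
        (\<lambda>x. coprod_inl R (level S (n - 1)) (level T (n - 1)) (face S n j x))
        (\<lambda>y. coprod_inr R (level S (n - 1)) (level T (n - 1)) (face T n j y))),
      degen = (\<lambda>n k. copair R (level S n) (level T n) (coprod R (level S (n + 1)) (level T (n + 1)))
        (\<lambda>x. coprod_inl R (level S (n + 1)) (level T (n + 1)) (degen S n k x))
        (\<lambda>y. coprod_inr R (level S (n + 1)) (level T (n + 1)) (degen T n k y))) \<rparr>"

definition simp_copair :: "('r, 'm) ring_scheme \<Rightarrow> ('r, 'a) simp_alg \<Rightarrow> ('r, 'b) simp_alg \<Rightarrow> ('r, 'c) simp_alg \<Rightarrow> (nat \<Rightarrow> 'a \<Rightarrow> 'c) \<Rightarrow> (nat \<Rightarrow> 'b \<Rightarrow> 'c) \<Rightarrow> nat \<Rightarrow> (('a + 'b) list \<Rightarrow> 'r) set \<Rightarrow> 'c" where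
  "simp_copair R S T U f g = (\<lambda>n. copair R (level S n) (level T n) (level U n) (f n) (g n))"

definition simp_kernel :: "('r, 'a) simp_alg \<Rightarrow> ('r, 'b) simp_alg \<Rightarrow> (nat \<Rightarrow> 'a \<Rightarrow> 'b) \<Rightarrow> ('r, 'a) simp_alg" where
  "simp_kernel S T h =
    S\<lparr> level := (\<lambda>n. (level S n)\<lparr> carrier := a_kernel (level S n) (level T n) (h n) \<rparr>) \<rparr>"

definition short_exact :: "('r, 'm) ring_scheme \<Rightarrow> ('r, 'a) simp_alg \<Rightarrow> (nat \<Rightarrow> 'a \<Rightarrow> 'b) \<Rightarrow> ('r, 'b) simp_alg \<Rightarrow> (nat \<Rightarrow> 'b \<Rightarrow> 'c) \<Rightarrow> ('r, 'c) simp_alg \<Rightarrow> bool" where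
  "short_exact R S f T g U \<longleftrightarrow>
    simplicial_algebra R S \<and> simplicial_algebra R T \<and> simplicial_algebra R U \<and>
    simplicial_map R S T f \<and> simplicial_map R T U g \<and>
    (\<forall>n. exact_at R (zero_algebra :: ('r, unit) module) (\<lambda>_. \<zero>\<^bsub>level S n\<^esub>) (level S n) (f n) (level T n) \<and>
         exact_at R (level S n) (f n) (level T n) (g n) (level U n) \<and>
         exact_at R (level T n) (g n) (level U n) (\<lambda>_. ()) (zero_algebra :: ('r, unit) module))"


subsection \<open>Moore normalization and homology\<close>

definition moore :: "('r, 'a) simp_alg \<Rightarrow> nat \<Rightarrow> ('r, 'a) module" where
  "moore S n = (level S n)\<lparr> carrier :=
     {x \<in> carrier (level S n). \<forall>j<n. face S n j x = \<zero>\<^bsub>level S (n - 1)\<^esub>} \<rparr>"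

definition moore_diff :: "('r, 'm) ring_scheme \<Rightarrow> ('r, 'a) simp_alg \<Rightarrow> nat \<Rightarrow> 'a \<Rightarrow> 'a" where
  "moore_diff R S n x = (if n = 0 then \<zero>\<^bsub>level S 0\<^esub>
     else ((\<ominus>\<^bsub>R\<^esub> \<one>\<^bsub>R\<^esub>) [^]\<^bsub>R\<^esub> n) \<odot>\<^bsub>level S (n - 1)\<^esub> face S n n x)"

definition cycles :: "('r, 'm) ring_scheme \<Rightarrow> ('r, 'a) simp_alg \<Rightarrow> nat \<Rightarrow> ('r, 'a) module" where
  "cycles R S n = (moore S n)\<lparr> carrier :=
     {x \<in> carrier (moore S n). moore_diff R S n x = \<zero>\<^bsub>level S (n - 1)\<^esub>} \<rparr>"

definition boundaries :: "('r, 'm) ring_scheme \<Rightarrow> ('r, 'a) simp_alg \<Rightarrow> nat \<Rightarrow> 'a set" where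
  "boundaries R S n = moore_diff R S (n + 1) ` carrier (moore S (n + 1))"

definition homology :: "('r, 'm) ring_scheme \<Rightarrow> ('r, 'a) simp_alg \<Rightarrow> nat \<Rightarrow> ('r, 'a set) module" where
  "homology R S n = quot_alg (cycles R S n) (boundaries R S n)"

definition homology_class :: "('r, 'm) ring_scheme \<Rightarrow> ('r, 'a) simp_alg \<Rightarrow> nat \<Rightarrow> 'a \<Rightarrow> 'a set" where
  "homology_class R S n x = boundaries R S n +>\<^bsub>cycles R S n\<^esub> x"

definition HA :: "('r, 'm) ring_scheme \<Rightarrow> ('r, 'a) simp_alg \<Rightarrow> nat \<Rightarrow> ('r, 'a set) module" where
  "HA R S q = (if q = 0 then zero_algebra else homology R S (q - 1))"

text \<open>The map \<open>HA\<^sub>q(S) \<rightarrow> HA\<^sub>q(T)\<close>, \<open>q \<ge> 1\<close>, induced by a map \<open>f\<close> of simplicial algebras: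
  the class of \<open>x\<close> goes to the class of \<open>f x\<close>.\<close>

definition HA_map :: "('r, 'm) ring_scheme \<Rightarrow> ('r, 'b) simp_alg \<Rightarrow> (nat \<Rightarrow> 'a \<Rightarrow> 'b) \<Rightarrow> nat \<Rightarrow> 'a set \<Rightarrow> 'b set" where
  "HA_map R T f q K = (\<Union>x\<in>K. homology_class R T (q - 1) (f (q - 1) x))"

text \<open>The family \<open>d\<close> consists of the connecting maps \<open>HA\<^sub>q\<^sub>+\<^sub>1(U) \<rightarrow> HA\<^sub>q(S)\<close>, \<open>q \<ge> 1\<close>: the class of
  \<open>g z\<close> goes to the class of \<open>y\<close> whenever \<open>f y\<close> is the Moore differential of \<open>z\<close>.\<close>

definition is_connecting :: "('r, 'm) ring_scheme \<Rightarrow> ('r, 'a) simp_alg \<Rightarrow> (nat \<Rightarrow> 'a \<Rightarrow> 'b) \<Rightarrow> ('r, 'b) simp_alg \<Rightarrow> (nat \<Rightarrow> 'b \<Rightarrow> 'c) \<Rightarrow> ('r, 'c) simp_alg \<Rightarrow> (nat \<Rightarrow> 'c set \<Rightarrow> 'a set) \<Rightarrow> bool" where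
  "is_connecting R S f T g U d \<longleftrightarrow>
    (\<forall>q\<ge>1. \<forall>z\<in>carrier (moore T q). \<forall>y\<in>carrier (cycles R S (q - 1)).
       g q z \<in> carrier (cycles R U q) \<longrightarrow> f (q - 1) y = moore_diff R T q z \<longrightarrow>
       d (q + 1) (homology_class R U q (g q z)) = homology_class R S (q - 1) y)"

text \<open>Since all terms of index \<open>0\<close> vanish, exactness at the terms of index \<open>q \<ge> 1\<close> is exactness
  everywhere.\<close>

definition long_exact_HA :: "('r, 'm) ring_scheme \<Rightarrow> ('r, 'a) simp_alg \<Rightarrow> (nat \<Rightarrow> 'a \<Rightarrow> 'b) \<Rightarrow> ('r, 'b) simp_alg \<Rightarrow> (nat \<Rightarrow> 'b \<Rightarrow> 'c) \<Rightarrow> ('r, 'c) simp_alg \<Rightarrow> (nat \<Rightarrow> 'c set \<Rightarrow> 'a set) \<Rightarrow> bool" where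
  "long_exact_HA R S f T g U d \<longleftrightarrow> (\<forall>q\<ge>1.
     exact_at R (HA R U (q + 1)) (d (q + 1)) (HA R S q) (HA_map R T f q) (HA R T q) \<and>
     exact_at R (HA R S q) (HA_map R T f q) (HA R T q) (HA_map R U g q) (HA R U q) \<and>
     exact_at R (HA R T q) (HA_map R U g q) (HA R U q) (d q) (HA R S (q - 1)))"


section \<open>The simplicial algebra of a directed space\<close>

type_synonym ('r, 'a) trace_comb = "(real \<times> (nat \<Rightarrow> real) \<Rightarrow> 'a) set \<Rightarrow> 'r"

definition trace_algebra :: "('r, 'm) ring_scheme \<Rightarrow> 'a dspace \<Rightarrow> nat \<Rightarrow> ('r, ('r, 'a) trace_comb) module" where
  "trace_algebra R X i = free_on R (traces i X) (composable i X) (trace_concat i X)"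

definition simp_trace_algebra :: "('r, 'm) ring_scheme \<Rightarrow> 'a dspace \<Rightarrow> ('r, ('r, 'a) trace_comb) simp_alg" where
  "simp_trace_algebra R X =
    \<lparr> level = (\<lambda>n. trace_algebra R X (n + 1)),
      face = (\<lambda>n j. lin_ext R (trace_face n j X)),
      degen = (\<lambda>n k. lin_ext R (trace_degen (n + 1) k X)) \<rparr>"

definition simp_trace_map :: "('r, 'm) ring_scheme \<Rightarrow> 'b dspace \<Rightarrow> ('a \<Rightarrow> 'b) \<Rightarrow> nat \<Rightarrow> ('r, 'a) trace_comb \<Rightarrow> ('r, 'b) trace_comb" where
  "simp_trace_map R Y f n = lin_ext R (trace_map (n + 1) Y f)"

end

theory Submission
  imports Defs
begin

text \<open>A path in a disjoint union starts in one of the two summands and stays there, and all paths of a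
  trace have the same start point. So every trace of \<open>X\<close> comes from \<open>X\<^sub>1\<close> or \<open>X\<^sub>2\<close>, and \<open>h\<close> is onto in each
  degree. The rest holds for any map of simplicial algebras that is onto in each degree. Moore
  normalization preserves surjectivity, and the snake lemma yields the long exact sequence of modules.
  All maps are multiplicative: those induced by the inclusion and \<open>h\<close> trivially, and the connecting
  map because products of homology classes of positive degree vanish, as do products of classes in
  its image.\<close>

section \<open>Non-unital algebras\<close>

text \<open>The map \<open>h\<close> is in general not injective: the product of a trace of X1 and a
  trace of X2 is 0 in R[X], as their end points never match, but such mixed products survive in the
  free product. The free product, a quotient of an algebra of words, is handled through its
  universal property: homomorphisms out of it are compared on the images of the two factors, and the
  simplicial identities carry over in this way. Multiplicativity of the connecting map cannot be
  read off from lifts. A product of lifts is a lift of the product, but the sign in the differential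
  makes the differential of \<open>z z'\<close> the negative of the product of the differentials in
  odd degree. Therefore both sides are shown to vanish. On the topological side, operations on
  traces are unions over representatives. Each of them needs invariance under one elementary
  reparametrization only, and identities between traces then follow from identities between single
  paths, up to an explicit change of time.\<close>

lemma (in module) submoduleI_linear:
  assumes "H \<subseteq> carrier M" and "\<zero>\<^bsub>M\<^esub> \<in> H"
    and "\<And>a b. \<lbrakk>a \<in> H; b \<in> H\<rbrakk> \<Longrightarrow> a \<oplus>\<^bsub>M\<^esub> b \<in> H"
    and "\<And>r a. \<lbrakk>r \<in> carrier R; a \<in> H\<rbrakk> \<Longrightarrow> r \<odot>\<^bsub>M\<^esub> a \<in> H"
  shows "submodule H R M"
proof (rule submoduleI)
  fix a assume a: "a \<in> H"
  then have "(\<ominus> \<one>) \<odot>\<^bsub>M\<^esub> a \<in> H"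
    by (intro assms) auto
  then show "\<ominus>\<^bsub>M\<^esub> a \<in> H"
    using a assms(1) by (simp add: smult_l_minus subsetD)
qed (use assms in auto)

context nonunital_algebra
begin

text \<open>Zero and sign rules for products come from the scalars: 0 and -1 of \<open>R\<close>
  pass through the product by bilinearity.\<close>

lemma nu_zero_l [simp]: "x \<in> carrier A \<Longrightarrow> \<zero>\<^bsub>A\<^esub> \<otimes>\<^bsub>A\<^esub> x = \<zero>\<^bsub>A\<^esub>"
  using nu_smult_l[of "\<zero>" "\<zero>\<^bsub>A\<^esub>" x] by (simp add: nu_mult_closed)

lemma nu_zero_r [simp]: "x \<in> carrier A \<Longrightarrow> x \<otimes>\<^bsub>A\<^esub> \<zero>\<^bsub>A\<^esub> = \<zero>\<^bsub>A\<^esub>"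
  using nu_smult_r[of "\<zero>" x "\<zero>\<^bsub>A\<^esub>"] by (simp add: nu_mult_closed)

lemma nu_minus_l:
  "\<lbrakk>x \<in> carrier A; y \<in> carrier A\<rbrakk> \<Longrightarrow> (\<ominus>\<^bsub>A\<^esub> x) \<otimes>\<^bsub>A\<^esub> y = \<ominus>\<^bsub>A\<^esub> (x \<otimes>\<^bsub>A\<^esub> y)"
  using nu_smult_l[of "\<ominus> \<one>" x y] by (simp add: nu_mult_closed smult_l_minus)

lemma nu_minus_r:
  "\<lbrakk>x \<in> carrier A; y \<in> carrier A\<rbrakk> \<Longrightarrow> x \<otimes>\<^bsub>A\<^esub> (\<ominus>\<^bsub>A\<^esub> y) = \<ominus>\<^bsub>A\<^esub> (x \<otimes>\<^bsub>A\<^esub> y)"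
  using nu_smult_r[of "\<ominus> \<one>" x y] by (simp add: nu_mult_closed smult_l_minus)

lemma smult_minus_one: "x \<in> carrier A \<Longrightarrow> (\<ominus> \<one>) \<odot>\<^bsub>A\<^esub> x = \<ominus>\<^bsub>A\<^esub> x"
  by (simp add: smult_l_minus)

lemma minus_eq_zero_iff:
  "\<lbrakk>x \<in> carrier A; y \<in> carrier A\<rbrakk> \<Longrightarrow> x \<ominus>\<^bsub>A\<^esub> y = \<zero>\<^bsub>A\<^esub> \<longleftrightarrow> x = y"
  by (metis M.add.inv_closed M.add.inv_inv M.minus_equality M.minus_eq M.r_neg)

lemma minus_zero: "x \<in> carrier A \<Longrightarrow> x \<ominus>\<^bsub>A\<^esub> \<zero>\<^bsub>A\<^esub> = x"
  by (simp add: M.minus_eq M.add.inv_one)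

text \<open>Shrinking the carrier keeps all operations, so closure is the only thing to check. It
  serves the algebras of cycles and the levels of the kernel.\<close>

lemma subalgebra:
  assumes "submodule S R A" and "\<And>x y. \<lbrakk>x \<in> S; y \<in> S\<rbrakk> \<Longrightarrow> x \<otimes>\<^bsub>A\<^esub> y \<in> S"
  shows "nonunital_algebra R (A\<lparr>carrier := S\<rparr>)"
proof -
  have S: "S \<subseteq> carrier A"
    using submoduleE(1)[OF assms(1)] .
  show ?thesis
    by (intro nonunital_algebra.intro submodule.submodule_is_module[OF assms(1)] module_axioms
        nonunital_algebra_axioms.intro)
      (use S in \<open>auto simp: assms(2) nu_mult_assoc nu_l_distr nu_r_distr nu_smult_l nu_smult_r subset_iff\<close>)
qed

lemma submodule_minus:
  assumes "submodule S R A" "x \<in> S" "y \<in> S"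
  shows "x \<ominus>\<^bsub>A\<^esub> y \<in> S"
  using assms submoduleE[OF assms(1)] by (simp add: M.minus_eq)

end

lemma nonunital_zero_algebra: "cring R \<Longrightarrow> nonunital_algebra R zero_algebra"
  unfolding zero_algebra_def
  by (intro nonunital_algebra.intro moduleI abelian_groupI nonunital_algebra_axioms.intro) auto


section \<open>Homomorphisms\<close>

lemma alg_homI:
  assumes "\<And>x. x \<in> carrier A \<Longrightarrow> f x \<in> carrier B"
    and "\<And>x y. \<lbrakk>x \<in> carrier A; y \<in> carrier A\<rbrakk> \<Longrightarrow> f (x \<oplus>\<^bsub>A\<^esub> y) = f x \<oplus>\<^bsub>B\<^esub> f y"
    and "\<And>x y. \<lbrakk>x \<in> carrier A; y \<in> carrier A\<rbrakk> \<Longrightarrow> f (x \<otimes>\<^bsub>A\<^esub> y) = f x \<otimes>\<^bsub>B\<^esub> f y"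
    and "\<And>r x. \<lbrakk>r \<in> carrier R; x \<in> carrier A\<rbrakk> \<Longrightarrow> f (r \<odot>\<^bsub>A\<^esub> x) = r \<odot>\<^bsub>B\<^esub> f x"
  shows "f \<in> alg_hom R A B"
  using assms by (auto simp: alg_hom_def hom_def)

lemma
  assumes "f \<in> alg_hom R A B"
  shows alg_hom_closed: "x \<in> carrier A \<Longrightarrow> f x \<in> carrier B"
    and alg_hom_add: "\<lbrakk>x \<in> carrier A; y \<in> carrier A\<rbrakk> \<Longrightarrow> f (x \<oplus>\<^bsub>A\<^esub> y) = f x \<oplus>\<^bsub>B\<^esub> f y"
    and alg_hom_mult: "\<lbrakk>x \<in> carrier A; y \<in> carrier A\<rbrakk> \<Longrightarrow> f (x \<otimes>\<^bsub>A\<^esub> y) = f x \<otimes>\<^bsub>B\<^esub> f y"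
    and alg_hom_smult: "\<lbrakk>r \<in> carrier R; x \<in> carrier A\<rbrakk> \<Longrightarrow> f (r \<odot>\<^bsub>A\<^esub> x) = r \<odot>\<^bsub>B\<^esub> f x"
  using assms by (auto simp: alg_hom_def hom_def)

lemma alg_hom_comp: "\<lbrakk>f \<in> alg_hom R A B; g \<in> alg_hom R B C\<rbrakk> \<Longrightarrow> (\<lambda>x. g (f x)) \<in> alg_hom R A C"
  by (rule alg_homI) (auto simp: alg_hom_closed alg_hom_add alg_hom_mult alg_hom_smult)

lemma alg_hom_id: "(\<lambda>x. x) \<in> alg_hom R A A"
  by (rule alg_homI) auto

text \<open>Membership in \<open>alg_hom\<close> depends on the values on the carrier only. This
  allows a homomorphism to be made extensional, as \<open>copair\<close> demands.\<close>

lemma alg_hom_cong: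
  assumes "f \<in> alg_hom R A B" "nonunital_algebra R A" "\<And>x. x \<in> carrier A \<Longrightarrow> g x = f x"
  shows "g \<in> alg_hom R A B"
proof -
  interpret A: nonunital_algebra R A by fact
  show ?thesis
    by (rule alg_homI)
      (auto simp: assms(3) A.nu_mult_closed alg_hom_closed[OF assms(1)] alg_hom_add[OF assms(1)]
        alg_hom_mult[OF assms(1)] alg_hom_smult[OF assms(1)])
qed

locale algebra_hom = A: nonunital_algebra R A + B: nonunital_algebra R B
  for R (structure) and A (structure) and B (structure) +
  fixes f
  assumes f: "f \<in> alg_hom R A B"
begin

lemmas closed [simp] = alg_hom_closed[OF f]
lemmas add = alg_hom_add[OF f]
lemmas mult = alg_hom_mult[OF f]
lemmas smult = alg_hom_smult[OF f]

lemma zero [simp]: "f \<zero>\<^bsub>A\<^esub> = \<zero>\<^bsub>B\<^esub>"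
  using smult[of "\<zero>" "\<zero>\<^bsub>A\<^esub>"] by simp

lemma minus: "x \<in> carrier A \<Longrightarrow> f (\<ominus>\<^bsub>A\<^esub> x) = \<ominus>\<^bsub>B\<^esub> f x"
  using smult[of "\<ominus> \<one>" x] by (simp add: A.smult_minus_one B.smult_minus_one)

lemma diff: "\<lbrakk>x \<in> carrier A; y \<in> carrier A\<rbrakk> \<Longrightarrow> f (x \<ominus>\<^bsub>A\<^esub> y) = f x \<ominus>\<^bsub>B\<^esub> f y"
  by (simp add: A.M.minus_eq B.M.minus_eq add minus)

lemma kernel_ideal: "alg_ideal R A (a_kernel A B f)"
  unfolding alg_ideal_def
proof
  show "submodule (a_kernel A B f) R A"
    by (rule A.submoduleI_linear) (auto simp: a_kernel_def' add smult)
qed (auto simp: a_kernel_def' mult A.nu_mult_closed)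

lemma image_submodule: "submodule (f ` carrier A) R B"
proof (rule B.submoduleI_linear)
  show "\<zero>\<^bsub>B\<^esub> \<in> f ` carrier A"
    by (metis A.M.zero_closed imageI zero)
  show "a \<oplus>\<^bsub>B\<^esub> b \<in> f ` carrier A" if "a \<in> f ` carrier A" "b \<in> f ` carrier A" for a b
    using that by (auto simp: add[symmetric])
  show "r \<odot>\<^bsub>B\<^esub> a \<in> f ` carrier A" if "r \<in> carrier R" "a \<in> f ` carrier A" for r a
    using that by (auto simp: smult[symmetric])
qed auto

end


section \<open>Quotients by ideals\<close>

locale algebra_ideal = nonunital_algebra R A
  for R :: "('r, 'm) ring_scheme" and A :: "('r, 'a) module" (structure) +
  fixes I
  assumes ideal: "alg_ideal R A I"
begin

lemma submodule_I: "submodule I R A"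
  using ideal by (simp add: alg_ideal_def)

sublocale abelian_subgroup I A
  using submodule_I M.abelian_group_axioms
  by (intro abelian_subgroupI3 additive_subgroupI) (auto simp: submodule_def)

lemma coset_eq_iff:
  "\<lbrakk>x \<in> carrier A; y \<in> carrier A\<rbrakk> \<Longrightarrow> I +> x = I +> y \<longleftrightarrow> x \<ominus> y \<in> I"
  using a_rcos_module[of y x] a_repr_independence'[of x y] a_rcos_self[of x] by (auto simp: M.minus_eq)

lemma mem_cosetD: "\<lbrakk>x \<in> carrier A; y \<in> I +> x\<rbrakk> \<Longrightarrow> y \<in> carrier A \<and> I +> y = I +> x"
  using a_elemrcos_carrier[of x y] a_repr_independence'[of y x] by simp

text \<open>Products, scalar multiples and induced maps on a quotient are encoded as unions over a
  coset. Such a union collapses because its members agree and a coset is never empty.\<close>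

lemma coset_Union_const:
  assumes "x \<in> carrier A" "\<And>y. y \<in> carrier A \<Longrightarrow> I +> y = I +> x \<Longrightarrow> F y = F x"
  shows "(\<Union>y\<in>I +> x. F y) = F x"
proof -
  have "F y = F x" if "y \<in> I +> x" for y
    using that assms mem_cosetD by blast
  moreover have "x \<in> I +> x"
    using assms(1) a_rcos_self by blast
  ultimately show ?thesis by blast
qed

lemma quot_carrier: "carrier (quot_alg A I) = (\<lambda>x. I +> x) ` carrier A"
  by (auto simp: quot_alg_def ring.defs module.defs FactRing_def A_RCOSETS_def')

lemma quot_closed: "x \<in> carrier A \<Longrightarrow> I +> x \<in> carrier (quot_alg A I)"
  by (simp add: quot_carrier)

lemma quot_zero: "\<zero>\<^bsub>quot_alg A I\<^esub> = I"
  by (simp add: quot_alg_def ring.defs module.defs FactRing_def)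

lemma quot_zero_coset: "\<zero>\<^bsub>quot_alg A I\<^esub> = I +> \<zero>"
  using a_coset_join2[OF M.zero_closed] quot_zero by (simp add: a_subgroup)

lemma quot_add:
  "\<lbrakk>x \<in> carrier A; y \<in> carrier A\<rbrakk> \<Longrightarrow>
    (I +> x) \<oplus>\<^bsub>quot_alg A I\<^esub> (I +> y) = I +> (x \<oplus> y)"
  by (simp add: quot_alg_def ring.defs module.defs FactRing_def a_rcos_sum)

lemma quot_mult:
  assumes "x \<in> carrier A" "y \<in> carrier A"
  shows "(I +> x) \<otimes>\<^bsub>quot_alg A I\<^esub> (I +> y) = I +> (x \<otimes> y)"
proof -
  have eq: "I +> (x' \<otimes> y') = I +> (x \<otimes> y)"
    if "x' \<in> carrier A" "y' \<in> carrier A" "I +> x' = I +> x" "I +> y' = I +> y" for x' y'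
  proof -
    have "x' \<ominus> x \<in> I" "y' \<ominus> y \<in> I"
      using that assms coset_eq_iff by auto
    \<comment> \<open>Each summand has one factor in the two-sided ideal, and the sum telescopes to
      the difference of the two products.\<close>
    then have "(x' \<ominus> x) \<otimes> y' \<oplus> x \<otimes> (y' \<ominus> y) \<in> I"
      using ideal that assms by (auto simp: alg_ideal_def)
    moreover have "(x' \<ominus> x) \<otimes> y' \<oplus> x \<otimes> (y' \<ominus> y) = x' \<otimes> y' \<ominus> x \<otimes> y"
      using that assms
      by (simp add: M.minus_eq nu_l_distr nu_r_distr nu_mult_closed nu_minus_l nu_minus_r
          M.a_assoc M.r_neg2 M.r_neg1)
    ultimately show ?thesis
      using that assms by (simp add: coset_eq_iff nu_mult_closed)
  qed
  have "(\<Union>b\<in>I +> y. I +> (a \<otimes> b)) = I +> (x \<otimes> y)"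
    if "a \<in> carrier A" "I +> a = I +> x" for a
    using coset_Union_const[of y "\<lambda>b. I +> (a \<otimes> b)"] eq[OF that(1) _ that(2)] assms by simp
  then have "(\<Union>a\<in>I +> x. \<Union>b\<in>I +> y. I +> (a \<otimes> b)) = I +> (x \<otimes> y)"
    using coset_Union_const[of x "\<lambda>a. \<Union>b\<in>I +> y. I +> (a \<otimes> b)"] assms by simp
  then show ?thesis
    by (simp add: quot_alg_def ring.defs module.defs FactRing_def rcoset_mult_def)
qed

lemma quot_smult:
  assumes "r \<in> carrier R" "x \<in> carrier A"
  shows "r \<odot>\<^bsub>quot_alg A I\<^esub> (I +> x) = I +> (r \<odot> x)"
proof -
  have "I +> (r \<odot> y) = I +> (r \<odot> x)"
    if "y \<in> carrier A" "I +> y = I +> x" for y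
  proof -
    have "y \<ominus> x \<in> I"
      using that assms coset_eq_iff by auto
    then have "r \<odot> (y \<ominus> x) \<in> I"
      using submodule.smult_closed[OF submodule_I] assms by blast
    then show ?thesis
      using that assms by (simp add: coset_eq_iff M.minus_eq smult_r_distr smult_r_minus)
  qed
  with assms(2) have "(\<Union>y\<in>I +> x. I +> (r \<odot> y)) = I +> (r \<odot> x)"
    by (rule coset_Union_const)
  then show ?thesis
    by (simp add: quot_alg_def ring.defs module.defs FactRing_def)
qed

lemma quot_carrierE:
  assumes "K \<in> carrier (quot_alg A I)"
  obtains x where "x \<in> carrier A" "K = I +> x"
  using assms unfolding quot_carrier by blast

lemma quot_nonunital: "nonunital_algebra R (quot_alg A I)"
proof -
  have inv: "\<exists>y\<in>carrier (quot_alg A I). y \<oplus>\<^bsub>quot_alg A I\<^esub> K = \<zero>\<^bsub>quot_alg A I\<^esub>"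
    if K: "K \<in> carrier (quot_alg A I)" for K
  proof -
    obtain x where x: "x \<in> carrier A" "K = I +> x"
      using K by (rule quot_carrierE)
    then have "(I +> (\<ominus> x)) \<oplus>\<^bsub>quot_alg A I\<^esub> K = \<zero>\<^bsub>quot_alg A I\<^esub>"
      by (simp add: quot_add quot_zero_coset M.l_neg)
    then show ?thesis
      using x by (auto simp: quot_carrier)
  qed
  show ?thesis
  proof (intro nonunital_algebra.intro moduleI abelian_groupI nonunital_algebra_axioms.intro R.is_cring inv)
    show "P \<oplus>\<^bsub>quot_alg A I\<^esub> Q = Q \<oplus>\<^bsub>quot_alg A I\<^esub> P"
      if "P \<in> carrier (quot_alg A I)" "Q \<in> carrier (quot_alg A I)" for P Q
      using that by (elim quot_carrierE) (simp add: quot_add M.a_comm)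
  qed ((elim quot_carrierE)?; simp add: quot_zero_coset quot_closed quot_add quot_mult quot_smult
      nu_mult_closed nu_mult_assoc nu_l_distr nu_r_distr nu_smult_l nu_smult_r M.a_assoc
      smult_l_distr smult_r_distr smult_assoc1)+
qed

lemma quot_proj: "(\<lambda>x. I +> x) \<in> alg_hom R A (quot_alg A I)"
  by (rule alg_homI) (auto simp: quot_add quot_mult quot_smult quot_carrier)

lemma quot_lift:
  assumes B: "nonunital_algebra R B" and f: "f \<in> alg_hom R A B" and I: "\<And>x. x \<in> I \<Longrightarrow> f x = \<zero>\<^bsub>B\<^esub>"
  obtains g where "g \<in> alg_hom R (quot_alg A I) B" "\<And>x. x \<in> carrier A \<Longrightarrow> g (I +> x) = f x"
proof -
  interpret f: algebra_hom R A B f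
    using B f by (simp add: algebra_hom_def algebra_hom_axioms_def nonunital_algebra_axioms)
  have eq: "f x = f y" if "x \<in> carrier A" "y \<in> carrier A" "I +> x = I +> y" for x y
    using that I[of "x \<ominus> y"] by (simp add: coset_eq_iff f.diff f.B.minus_eq_zero_iff)
  \<comment> \<open>The value is read off at a chosen representative; \<open>eq\<close> makes the
    choice irrelevant.\<close>
  define g where "g K = f (SOME x. x \<in> carrier A \<and> K = I +> x)" for K
  have g: "g (I +> x) = f x" if "x \<in> carrier A" for x
    unfolding g_def by (rule someI2[of _ x]) (use that eq in blast)+
  have "g \<in> alg_hom R (quot_alg A I) B"
    by (rule alg_homI)
      (auto elim!: quot_carrierE simp: g quot_add quot_mult quot_smult nu_mult_closed f.add f.mult f.smult)
  with g show thesis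
    using that by blast
qed

end

lemma gen_alg_ideal:
  assumes "nonunital_algebra R A" "S \<subseteq> carrier A"
  shows "alg_ideal R A (gen_alg_ideal R A S)" "S \<subseteq> gen_alg_ideal R A S"
proof -
  interpret nonunital_algebra R A by fact
  \<comment> \<open>The whole algebra belongs to the family that is intersected, which keeps the
    intersection inside the carrier.\<close>
  have top: "alg_ideal R A (carrier A)"
    using carrier_is_submodule by (auto simp: alg_ideal_def nu_mult_closed)
  have "submodule (gen_alg_ideal R A S) R A"
  proof (rule submoduleI_linear)
    show "gen_alg_ideal R A S \<subseteq> carrier A"
      using top assms(2) unfolding gen_alg_ideal_def by blast
    have sub: "submodule I R A" if "alg_ideal R A I" for I
      using that by (simp add: alg_ideal_def)
    show "\<zero>\<^bsub>A\<^esub> \<in> gen_alg_ideal R A S"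
      using subgroup.one_closed[OF submodule.axioms(1)[OF sub]] by (auto simp: gen_alg_ideal_def)
    show "a \<oplus>\<^bsub>A\<^esub> b \<in> gen_alg_ideal R A S"
      if "a \<in> gen_alg_ideal R A S" "b \<in> gen_alg_ideal R A S" for a b
      using that submoduleE(5)[OF sub] by (auto simp: gen_alg_ideal_def)
    show "r \<odot>\<^bsub>A\<^esub> a \<in> gen_alg_ideal R A S"
      if "r \<in> carrier R" "a \<in> gen_alg_ideal R A S" for a r
      using that submoduleE(4)[OF sub] by (auto simp: gen_alg_ideal_def)
  qed
  then show "alg_ideal R A (gen_alg_ideal R A S)"
    by (auto simp: alg_ideal_def gen_alg_ideal_def)
  show "S \<subseteq> gen_alg_ideal R A S"
    by (auto simp: gen_alg_ideal_def)
qed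

text \<open>The kernel is itself an ideal containing \<open>S\<close>, hence one of those whose
  intersection is the generated ideal.\<close>

lemma (in algebra_hom) vanish_gen_alg_ideal:
  assumes "S \<subseteq> carrier A" "\<And>x. x \<in> S \<Longrightarrow> f x = \<zero>\<^bsub>B\<^esub>" "x \<in> gen_alg_ideal R A S"
  shows "f x = \<zero>\<^bsub>B\<^esub>"
proof -
  have "S \<subseteq> a_kernel A B f"
    using assms by (auto simp: a_kernel_def')
  then show ?thesis
    using assms(3) kernel_ideal by (auto simp: gen_alg_ideal_def a_kernel_def')
qed


section \<open>Free modules with a partial multiplication of the basis\<close>

context cring
begin

definition free_support :: "('x \<Rightarrow> 'a) \<Rightarrow> 'x set" where
  "free_support u = {x. u x \<noteq> \<zero>}"

lemma free_carrier_iff: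
  "u \<in> carrier (free_on R T P m) \<longleftrightarrow>
    (\<forall>x. u x \<in> carrier R) \<and> free_support u \<subseteq> T \<and> finite (free_support u)"
  by (auto simp: free_on_def free_support_def)

lemma free_simps [simp]:
  "\<zero>\<^bsub>free_on R T P m\<^esub> = (\<lambda>_. \<zero>)"
  "u \<oplus>\<^bsub>free_on R T P m\<^esub> v = (\<lambda>x. u x \<oplus> v x)"
  "r \<odot>\<^bsub>free_on R T P m\<^esub> u = (\<lambda>x. r \<otimes> u x)"
  by (auto simp: free_on_def)

lemma free_valued: "u \<in> carrier (free_on R T P m) \<Longrightarrow> u x \<in> carrier R"
  by (simp add: free_carrier_iff)

lemma free_carrierI:
  assumes "\<And>x. u x \<in> carrier R" "finite S" "S \<subseteq> T" "\<And>x. x \<notin> S \<Longrightarrow> u x = \<zero>"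
  shows "u \<in> carrier (free_on R T P m)"
proof -
  have "free_support u \<subseteq> S"
    using assms(4) by (auto simp: free_support_def)
  then show ?thesis
    using assms by (auto simp: free_carrier_iff dest: finite_subset)
qed

lemma free_zero_closed: "(\<lambda>_. \<zero>) \<in> carrier (free_on R T P m)"
  by (rule free_carrierI[of _ "{}"]) auto

lemma free_add_closed:
  assumes "u \<in> carrier (free_on R T P m)" "v \<in> carrier (free_on R T P m)"
  shows "(\<lambda>x. u x \<oplus> v x) \<in> carrier (free_on R T P m)"
  by (rule free_carrierI[of _ "free_support u \<union> free_support v"])
    (use assms in \<open>auto simp: free_carrier_iff free_support_def\<close>)

lemma free_smult_closed:
  assumes "r \<in> carrier R" "u \<in> carrier (free_on R T P m)"
  shows "(\<lambda>x. r \<otimes> u x) \<in> carrier (free_on R T P m)"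
  by (rule free_carrierI[of _ "free_support u"]) (use assms in \<open>auto simp: free_carrier_iff free_support_def\<close>)

lemma free_basis_closed: "x \<in> T \<Longrightarrow> basis R x \<in> carrier (free_on R T P m)"
  by (rule free_carrierI[of _ "{x}"]) (auto simp: basis_def)

lemma free_module: "module R (free_on R T P m)"
proof -
  have inv: "\<exists>v\<in>carrier (free_on R T P m). v \<oplus>\<^bsub>free_on R T P m\<^esub> u = \<zero>\<^bsub>free_on R T P m\<^esub>"
    if "u \<in> carrier (free_on R T P m)" for u
  proof (rule bexI)
    show "(\<lambda>x. (\<ominus> \<one>) \<otimes> u x) \<oplus>\<^bsub>free_on R T P m\<^esub> u = \<zero>\<^bsub>free_on R T P m\<^esub>"
      using free_valued[OF that] by (auto simp: l_minus l_neg)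
  qed (use that free_smult_closed[of "\<ominus> \<one>" u T P m] in auto)
  show ?thesis
    by (intro moduleI abelian_groupI inv is_cring)
      (auto simp: free_zero_closed free_add_closed free_smult_closed free_valued a_ac
        l_distr r_distr m_assoc)
qed

lemma free_induct [consumes 1, case_names zero add]:
  assumes u: "u \<in> carrier (free_on R T P m)"
    and zero: "Q (\<lambda>_. \<zero>)"
    and add: "\<And>r x u. \<lbrakk>r \<in> carrier R; x \<in> T; u \<in> carrier (free_on R T P m); Q u\<rbrakk> \<Longrightarrow>
      Q (\<lambda>y. r \<otimes> basis R x y \<oplus> u y)"
  shows "Q u"
proof -
  \<comment> \<open>Induction over a finite superset of the support, since a point of the superset
    may carry the coefficient zero; in that case it is simply dropped.\<close>
  have "finite S \<Longrightarrow> u \<in> carrier (free_on R T P m) \<Longrightarrow> free_support u \<subseteq> S \<Longrightarrow> Q u" for S u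
  proof (induction S arbitrary: u rule: finite_induct)
    case empty
    then have "u = (\<lambda>_. \<zero>)" by (auto simp: free_support_def)
    then show ?case using zero by simp
  next
    case (insert x S)
    note c = free_valued[OF insert.prems(1)]
    show ?case
    proof (cases "x \<in> free_support u")
      case True
      have v: "u(x := \<zero>) \<in> carrier (free_on R T P m)"
        by (rule free_carrierI[of _ "free_support u"]) (use insert.prems in \<open>auto simp: free_carrier_iff free_support_def\<close>)
      have "free_support (u(x := \<zero>)) \<subseteq> S"
        using insert.prems(2) by (auto simp: free_support_def)
      with v have "Q (u(x := \<zero>))"
        using insert.IH by blast
      moreover have "x \<in> T"
        using True insert.prems by (auto simp: free_carrier_iff)
      moreover have "u = (\<lambda>y. u x \<otimes> basis R x y \<oplus> (u(x := \<zero>)) y)"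
        using c by (auto simp: basis_def)
      ultimately show ?thesis
        using add[OF c _ v] by metis
    next
      case False
      then have "free_support u \<subseteq> S"
        using insert.prems(2) by blast
      then show ?thesis
        using insert by blast
    qed
  qed
  then show ?thesis
    using u by (auto simp: free_carrier_iff)
qed

text \<open>Linearity without multiplicativity: multiplication by a fixed element is linear but no
  algebra homomorphism, and bilinear identities are extended from the basis through such
  maps.\<close>

definition linear_map :: "('a, 'y) module \<Rightarrow> ('a, 'z) module \<Rightarrow> ('y \<Rightarrow> 'z) \<Rightarrow> bool" where
  "linear_map A B f \<longleftrightarrow> (\<forall>x\<in>carrier A. f x \<in> carrier B) \<and>
     (\<forall>x\<in>carrier A. \<forall>y\<in>carrier A. f (x \<oplus>\<^bsub>A\<^esub> y) = f x \<oplus>\<^bsub>B\<^esub> f y) \<and>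
     (\<forall>r\<in>carrier R. \<forall>x\<in>carrier A. f (r \<odot>\<^bsub>A\<^esub> x) = r \<odot>\<^bsub>B\<^esub> f x)"

lemma linear_mapI:
  assumes "\<And>x. x \<in> carrier A \<Longrightarrow> f x \<in> carrier B"
    "\<And>x y. x \<in> carrier A \<Longrightarrow> y \<in> carrier A \<Longrightarrow> f (x \<oplus>\<^bsub>A\<^esub> y) = f x \<oplus>\<^bsub>B\<^esub> f y"
    "\<And>r x. r \<in> carrier R \<Longrightarrow> x \<in> carrier A \<Longrightarrow> f (r \<odot>\<^bsub>A\<^esub> x) = r \<odot>\<^bsub>B\<^esub> f x"
  shows "linear_map A B f"
  using assms by (auto simp: linear_map_def)

lemma alg_hom_linear: "f \<in> alg_hom R A B \<Longrightarrow> linear_map A B f"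
  by (rule linear_mapI) (auto simp: alg_hom_closed alg_hom_add alg_hom_smult)

lemma linear_map_free_combine:
  assumes "linear_map (free_on R T P m) B f" "r \<in> carrier R" "x \<in> T" "u \<in> carrier (free_on R T P m)"
  shows "f (\<lambda>y. r \<otimes> basis R x y \<oplus> u y) = r \<odot>\<^bsub>B\<^esub> f (basis R x) \<oplus>\<^bsub>B\<^esub> f u"
proof -
  note b = free_basis_closed[OF assms(3), where P = P and m = m]
  have "f (\<lambda>y. (\<lambda>y. r \<otimes> basis R x y) y \<oplus> u y) = f (\<lambda>y. r \<otimes> basis R x y) \<oplus>\<^bsub>B\<^esub> f u"
    using assms free_smult_closed[OF assms(2) b] by (auto simp: linear_map_def)
  also have "f (\<lambda>y. r \<otimes> basis R x y) = r \<odot>\<^bsub>B\<^esub> f (basis R x)"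
    using assms(1,2) b by (simp add: linear_map_def)
  finally show ?thesis by simp
qed

lemma linear_map_zero:
  assumes "linear_map A B f" "module R A" "module R B"
  shows "f \<zero>\<^bsub>A\<^esub> = \<zero>\<^bsub>B\<^esub>"
proof -
  interpret A: module R A by fact
  interpret B: module R B by fact
  have "f (\<zero> \<odot>\<^bsub>A\<^esub> \<zero>\<^bsub>A\<^esub>) = \<zero> \<odot>\<^bsub>B\<^esub> f \<zero>\<^bsub>A\<^esub>"
    using assms(1) A.M.zero_closed zero_closed unfolding linear_map_def by blast
  moreover have "f \<zero>\<^bsub>A\<^esub> \<in> carrier B"
    using assms(1) by (simp add: linear_map_def)
  ultimately show ?thesis by simp
qed

lemma linear_map_free_zero:
  "\<lbrakk>linear_map (free_on R T P m) B f; module R B\<rbrakk> \<Longrightarrow> f (\<lambda>_. \<zero>) = \<zero>\<^bsub>B\<^esub>"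
  using linear_map_zero[OF _ free_module] by fastforce

lemma linear_map_free_eqI:
  assumes "linear_map (free_on R T P m) B f" "linear_map (free_on R T P m) B g" "module R B"
    and "\<And>x. x \<in> T \<Longrightarrow> f (basis R x) = g (basis R x)"
    and "u \<in> carrier (free_on R T P m)"
  shows "f u = g u"
  using assms(5)
proof (induction rule: free_induct)
  case zero
  show ?case
    using assms(1-3) by (simp add: linear_map_free_zero)
next
  case (add r x u)
  then show ?case
    using assms by (simp add: linear_map_free_combine)
qed

lemma linear_map_cong:
  assumes "linear_map A B f" "module R A" "\<And>x. x \<in> carrier A \<Longrightarrow> g x = f x"
  shows "linear_map A B g"
proof -
  interpret A: module R A by fact
  show ?thesis
    using assms(1) by (simp add: linear_map_def assms(3))
qed

lemma linear_map_comp: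
  "\<lbrakk>linear_map A B f; linear_map B C g\<rbrakk> \<Longrightarrow> linear_map A C (\<lambda>x. g (f x))"
  by (simp add: linear_map_def)

text \<open>The defining sum ranges over the exact supports, which change under addition and
  scaling. Padding with zero terms gives a common index set on which sums can be compared.\<close>

lemma free_mult_eq:
  assumes "u \<in> carrier (free_on R T P m)" "v \<in> carrier (free_on R T P m)"
    and "finite S" "free_support u \<subseteq> S" "finite S'" "free_support v \<subseteq> S'"
  shows "(u \<otimes>\<^bsub>free_on R T P m\<^esub> v) z =
    (finsum R (\<lambda>(x, y). u x \<otimes> v y) {(x, y). x \<in> S \<and> y \<in> S' \<and> P x y \<and> m x y = z})"
proof -
  have "(u \<otimes>\<^bsub>free_on R T P m\<^esub> v) z =
    (finsum R (\<lambda>(x, y). u x \<otimes> v y) {(x, y). u x \<noteq> \<zero> \<and> v y \<noteq> \<zero> \<and> P x y \<and> m x y = z})"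
    by (simp add: free_on_def)
  also have "\<dots> = (finsum R (\<lambda>(x, y). u x \<otimes> v y) {(x, y). x \<in> S \<and> y \<in> S' \<and> P x y \<and> m x y = z})"
  proof (rule add.finprod_mono_neutral_cong_left)
    show "finite {(x, y). x \<in> S \<and> y \<in> S' \<and> P x y \<and> m x y = z}"
      by (rule finite_subset[of _ "S \<times> S'"]) (use assms in auto)
    show "{(x, y). u x \<noteq> \<zero> \<and> v y \<noteq> \<zero> \<and> P x y \<and> m x y = z} \<subseteq>
        {(x, y). x \<in> S \<and> y \<in> S' \<and> P x y \<and> m x y = z}"
      using assms(4,6) by (auto simp: free_support_def)
  qed (use assms free_valued[OF assms(1)] free_valued[OF assms(2)] in \<open>auto simp: free_support_def\<close>)
  finally show ?thesis .
qed

lemma free_mult_valued: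
  assumes "u \<in> carrier (free_on R T P m)" "v \<in> carrier (free_on R T P m)"
  shows "(u \<otimes>\<^bsub>free_on R T P m\<^esub> v) z \<in> carrier R"
  using assms free_valued[OF assms(1)] free_valued[OF assms(2)]
  by (auto simp: free_on_def intro!: add.finprod_closed)

lemma free_mult_basis:
  assumes "x \<in> T" "y \<in> T"
  shows "basis R x \<otimes>\<^bsub>free_on R T P m\<^esub> basis R y = (if P x y then basis R (m x y) else (\<lambda>_. \<zero>))"
proof
  fix z
  have sup: "free_support (basis R x) \<subseteq> {x}" "free_support (basis R y) \<subseteq> {y}"
    by (auto simp: free_support_def basis_def)
  have "{(x', y'). x' \<in> {x} \<and> y' \<in> {y} \<and> P x' y' \<and> m x' y' = z} =
      (if P x y \<and> m x y = z then {(x, y)} else {})"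
    by auto
  then show "(basis R x \<otimes>\<^bsub>free_on R T P m\<^esub> basis R y) z =
      (if P x y then basis R (m x y) else (\<lambda>_. \<zero>)) z"
    using free_mult_eq[OF free_basis_closed[OF assms(1)] free_basis_closed[OF assms(2)] _ sup(1) _ sup(2)]
    by (auto simp: basis_def)
qed

lemma free_mult_ladd:
  assumes "u \<in> carrier (free_on R T P m)" "u' \<in> carrier (free_on R T P m)" "v \<in> carrier (free_on R T P m)"
  shows "(\<lambda>x. u x \<oplus> u' x) \<otimes>\<^bsub>free_on R T P m\<^esub> v =
    (\<lambda>z. (u \<otimes>\<^bsub>free_on R T P m\<^esub> v) z \<oplus> (u' \<otimes>\<^bsub>free_on R T P m\<^esub> v) z)"
proof
  fix z
  let ?S = "free_support u \<union> free_support u'" and ?S' = "free_support v"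
  let ?K = "{(x, y). x \<in> ?S \<and> y \<in> ?S' \<and> P x y \<and> m x y = z}"
  have fin: "finite ?S" "finite ?S'"
    using assms by (auto simp: free_carrier_iff)
  note c = free_valued[OF assms(1)] free_valued[OF assms(2)] free_valued[OF assms(3)]
  have sup: "free_support (\<lambda>x. u x \<oplus> u' x) \<subseteq> ?S"
    using c by (auto simp: free_support_def)
  have "((\<lambda>x. u x \<oplus> u' x) \<otimes>\<^bsub>free_on R T P m\<^esub> v) z = (finsum R (\<lambda>(x, y). (u x \<oplus> u' x) \<otimes> v y) ?K)"
    by (rule free_mult_eq) (use assms fin sup free_add_closed in auto)
  also have "\<dots> = (\<Oplus>i\<in>?K. (case i of (x, y) \<Rightarrow> u x \<otimes> v y) \<oplus> (case i of (x, y) \<Rightarrow> u' x \<otimes> v y))"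
    by (rule add.finprod_cong') (use c in \<open>auto simp: l_distr\<close>)
  also have "\<dots> = (finsum R (\<lambda>(x, y). u x \<otimes> v y) ?K) \<oplus> (finsum R (\<lambda>(x, y). u' x \<otimes> v y) ?K)"
    by (rule add.finprod_multf) (use c in auto)
  also have "(finsum R (\<lambda>(x, y). u x \<otimes> v y) ?K) = (u \<otimes>\<^bsub>free_on R T P m\<^esub> v) z"
    by (rule free_mult_eq[symmetric]) (use assms fin in auto)
  also have "(finsum R (\<lambda>(x, y). u' x \<otimes> v y) ?K) = (u' \<otimes>\<^bsub>free_on R T P m\<^esub> v) z"
    by (rule free_mult_eq[symmetric]) (use assms fin in auto)
  finally show "((\<lambda>x. u x \<oplus> u' x) \<otimes>\<^bsub>free_on R T P m\<^esub> v) z =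
    (u \<otimes>\<^bsub>free_on R T P m\<^esub> v) z \<oplus> (u' \<otimes>\<^bsub>free_on R T P m\<^esub> v) z" .
qed

lemma free_mult_lsmult:
  assumes "r \<in> carrier R" "u \<in> carrier (free_on R T P m)" "v \<in> carrier (free_on R T P m)"
  shows "(\<lambda>x. r \<otimes> u x) \<otimes>\<^bsub>free_on R T P m\<^esub> v = (\<lambda>z. r \<otimes> (u \<otimes>\<^bsub>free_on R T P m\<^esub> v) z)"
proof
  fix z
  let ?S = "free_support u" and ?S' = "free_support v"
  let ?K = "{(x, y). x \<in> ?S \<and> y \<in> ?S' \<and> P x y \<and> m x y = z}"
  have fin: "finite ?S" "finite ?S'"
    using assms by (auto simp: free_carrier_iff)
  have finK: "finite ?K"
    by (rule finite_subset[of _ "?S \<times> ?S'"]) (use fin in auto)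
  note c = free_valued[OF assms(2)] free_valued[OF assms(3)] assms(1)
  have sup: "free_support (\<lambda>x. r \<otimes> u x) \<subseteq> ?S"
    using c by (auto simp: free_support_def)
  have "((\<lambda>x. r \<otimes> u x) \<otimes>\<^bsub>free_on R T P m\<^esub> v) z = (finsum R (\<lambda>(x, y). (r \<otimes> u x) \<otimes> v y) ?K)"
    by (rule free_mult_eq) (use assms fin sup free_smult_closed in auto)
  also have "\<dots> = (\<Oplus>i\<in>?K. r \<otimes> (case i of (x, y) \<Rightarrow> u x \<otimes> v y))"
    by (rule add.finprod_cong') (use c in \<open>auto simp: m_assoc\<close>)
  also have "\<dots> = r \<otimes> (finsum R (\<lambda>(x, y). u x \<otimes> v y) ?K)"
    by (rule finsum_rdistr[symmetric]) (use c finK in auto)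
  also have "(finsum R (\<lambda>(x, y). u x \<otimes> v y) ?K) = (u \<otimes>\<^bsub>free_on R T P m\<^esub> v) z"
    by (rule free_mult_eq[symmetric]) (use assms fin in auto)
  finally show "((\<lambda>x. r \<otimes> u x) \<otimes>\<^bsub>free_on R T P m\<^esub> v) z = r \<otimes> (u \<otimes>\<^bsub>free_on R T P m\<^esub> v) z" .
qed

text \<open>Linearity in the second argument is linearity in the first for the opposite multiplication.\<close>

lemma free_mult_flip:
  assumes "u \<in> carrier (free_on R T P m)" "v \<in> carrier (free_on R T P m)"
  shows "u \<otimes>\<^bsub>free_on R T P m\<^esub> v = v \<otimes>\<^bsub>free_on R T (\<lambda>x y. P y x) (\<lambda>x y. m y x)\<^esub> u"
proof
  fix z
  note c = free_valued[OF assms(1)] free_valued[OF assms(2)]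
  let ?K = "{(x, y). u x \<noteq> \<zero> \<and> v y \<noteq> \<zero> \<and> P x y \<and> m x y = z}"
  let ?K' = "{(x, y). v x \<noteq> \<zero> \<and> u y \<noteq> \<zero> \<and> P y x \<and> m y x = z}"
  have "finsum R (\<lambda>(x, y). v x \<otimes> u y) (prod.swap ` ?K) = finsum R (\<lambda>i. case prod.swap i of (x, y) \<Rightarrow> v x \<otimes> u y) ?K"
    by (rule finsum_reindex) (use c in auto)
  also have "\<dots> = finsum R (\<lambda>(x, y). u x \<otimes> v y) ?K"
    by (rule add.finprod_cong') (use c in \<open>auto simp: m_comm\<close>)
  also have "prod.swap ` ?K = ?K'"
    by force
  finally show "(u \<otimes>\<^bsub>free_on R T P m\<^esub> v) z = (v \<otimes>\<^bsub>free_on R T (\<lambda>x y. P y x) (\<lambda>x y. m y x)\<^esub> u) z"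
    by (simp add: free_on_def)
qed

lemma free_carrier_indep: "carrier (free_on R T P m) = carrier (free_on R T P' m')"
  by (simp add: free_on_def)

lemma free_mult_radd:
  assumes "u \<in> carrier (free_on R T P m)" "v \<in> carrier (free_on R T P m)" "v' \<in> carrier (free_on R T P m)"
  shows "u \<otimes>\<^bsub>free_on R T P m\<^esub> (\<lambda>x. v x \<oplus> v' x) =
    (\<lambda>z. (u \<otimes>\<^bsub>free_on R T P m\<^esub> v) z \<oplus> (u \<otimes>\<^bsub>free_on R T P m\<^esub> v') z)"
  using free_mult_ladd[of v T "\<lambda>x y. P y x" "\<lambda>x y. m y x" v' u] assms
  by (simp add: free_mult_flip[of u T P m] free_add_closed free_carrier_indep[of T P m "\<lambda>x y. P y x" "\<lambda>x y. m y x"])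

lemma free_mult_rsmult:
  assumes "r \<in> carrier R" "u \<in> carrier (free_on R T P m)" "v \<in> carrier (free_on R T P m)"
  shows "u \<otimes>\<^bsub>free_on R T P m\<^esub> (\<lambda>x. r \<otimes> v x) = (\<lambda>z. r \<otimes> (u \<otimes>\<^bsub>free_on R T P m\<^esub> v) z)"
  using free_mult_lsmult[of r v T "\<lambda>x y. P y x" "\<lambda>x y. m y x" u] assms
  by (simp add: free_mult_flip[of u T P m] free_smult_closed free_carrier_indep[of T P m "\<lambda>x y. P y x" "\<lambda>x y. m y x"])

end

text \<open>Setting undefined products to 0 turns the basis into a semigroup with zero. Its
  associativity asks that both bracketings of a triple be defined together and then agree. Words,
  where every product is defined, and traces are the two instances.\<close>

locale partial_semigroup = cring R for R (structure) +
  fixes T :: "'x set" and P :: "'x \<Rightarrow> 'x \<Rightarrow> bool" and m :: "'x \<Rightarrow> 'x \<Rightarrow> 'x"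
  assumes prod_closed: "\<lbrakk>x \<in> T; y \<in> T; P x y\<rbrakk> \<Longrightarrow> m x y \<in> T"
    and prod_defined: "\<lbrakk>x \<in> T; y \<in> T; z \<in> T\<rbrakk> \<Longrightarrow> P x y \<and> P (m x y) z \<longleftrightarrow> P y z \<and> P x (m y z)"
    and prod_assoc: "\<lbrakk>x \<in> T; y \<in> T; z \<in> T; P x y; P (m x y) z\<rbrakk> \<Longrightarrow> m (m x y) z = m x (m y z)"
begin

abbreviation F where "F \<equiv> free_on R T P m"

lemma free_mult_closed:
  assumes "u \<in> carrier F" "v \<in> carrier F"
  shows "u \<otimes>\<^bsub>F\<^esub> v \<in> carrier F"
proof -
  let ?S = "free_support u" and ?S' = "free_support v"
  let ?K = "{(x, y). x \<in> ?S \<and> y \<in> ?S' \<and> P x y}"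
  have fin: "finite ?S" "finite ?S'"
    using assms by (auto simp: free_carrier_iff)
  show ?thesis
  proof (rule free_carrierI)
    show "(u \<otimes>\<^bsub>F\<^esub> v) x \<in> carrier R" for x
      using free_mult_valued[OF assms] .
    show "finite ((\<lambda>(x, y). m x y) ` ?K)"
      by (rule finite_imageI, rule finite_subset[of _ "?S \<times> ?S'"]) (use fin in auto)
    show "(\<lambda>(x, y). m x y) ` ?K \<subseteq> T"
      using assms by (auto simp: free_carrier_iff intro!: prod_closed)
    show "(u \<otimes>\<^bsub>F\<^esub> v) z = \<zero>" if "z \<notin> (\<lambda>(x, y). m x y) ` ?K" for z
    proof -
      have "{(x, y). x \<in> ?S \<and> y \<in> ?S' \<and> P x y \<and> m x y = z} = {}"
        using that by auto
      then show ?thesis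
        by (simp only: free_mult_eq[OF assms fin(1) subset_refl fin(2) subset_refl] finsum_empty)
    qed
  qed
qed

lemma free_mult_linear_l: "v \<in> carrier F \<Longrightarrow> linear_map F F (\<lambda>u. u \<otimes>\<^bsub>F\<^esub> v)"
  by (rule linear_mapI) (auto simp: free_mult_closed free_mult_ladd free_mult_lsmult)

lemma free_mult_linear_r: "u \<in> carrier F \<Longrightarrow> linear_map F F (\<lambda>v. u \<otimes>\<^bsub>F\<^esub> v)"
  by (rule linear_mapI) (auto simp: free_mult_closed free_mult_radd free_mult_rsmult)

lemma zero_mult_basis: "y \<in> T \<Longrightarrow> (\<lambda>_. \<zero>) \<otimes>\<^bsub>F\<^esub> basis R y = (\<lambda>_. \<zero>)"
  using linear_map_free_zero[OF free_mult_linear_l[OF free_basis_closed] free_module] by simp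

lemma basis_mult_zero: "y \<in> T \<Longrightarrow> basis R y \<otimes>\<^bsub>F\<^esub> (\<lambda>_. \<zero>) = (\<lambda>_. \<zero>)"
  using linear_map_free_zero[OF free_mult_linear_r[OF free_basis_closed] free_module] by simp

lemma free_mult_assoc_basis:
  assumes "x \<in> T" "y \<in> T" "z \<in> T"
  shows "(basis R x \<otimes>\<^bsub>F\<^esub> basis R y) \<otimes>\<^bsub>F\<^esub> basis R z = basis R x \<otimes>\<^bsub>F\<^esub> (basis R y \<otimes>\<^bsub>F\<^esub> basis R z)"
  using prod_defined[OF assms] prod_assoc[OF assms] assms
  by (auto simp: free_mult_basis prod_closed zero_mult_basis basis_mult_zero)

text \<open>Both sides are linear in each argument, so the identity spreads from the basis to
  \<open>w\<close>, then to \<open>v\<close>, then to \<open>u\<close>.\<close>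

lemma free_mult_assoc:
  assumes "u \<in> carrier F" "v \<in> carrier F" "w \<in> carrier F"
  shows "(u \<otimes>\<^bsub>F\<^esub> v) \<otimes>\<^bsub>F\<^esub> w = u \<otimes>\<^bsub>F\<^esub> (v \<otimes>\<^bsub>F\<^esub> w)"
proof -
  note l = free_mult_linear_l and r = free_mult_linear_r and c = linear_map_comp
  note b = free_basis_closed[where T = T and P = P and m = m]
  have 1: "(basis R x \<otimes>\<^bsub>F\<^esub> basis R y) \<otimes>\<^bsub>F\<^esub> w = basis R x \<otimes>\<^bsub>F\<^esub> (basis R y \<otimes>\<^bsub>F\<^esub> w)"
    if "x \<in> T" "y \<in> T" for x y
    using r[OF free_mult_closed[OF b[OF that(1)] b[OF that(2)]]]
      c[OF r[OF b[OF that(2)]] r[OF b[OF that(1)]]] free_module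
      free_mult_assoc_basis[OF that] assms(3)
    by (rule linear_map_free_eqI)
  have 2: "(basis R x \<otimes>\<^bsub>F\<^esub> v) \<otimes>\<^bsub>F\<^esub> w = basis R x \<otimes>\<^bsub>F\<^esub> (v \<otimes>\<^bsub>F\<^esub> w)" if "x \<in> T" for x
    using c[OF r[OF b[OF that]] l[OF assms(3)]] c[OF l[OF assms(3)] r[OF b[OF that]]] free_module
      1[OF that] assms(2)
    by (rule linear_map_free_eqI)
  show ?thesis
    using c[OF l[OF assms(2)] l[OF assms(3)]] l[OF free_mult_closed[OF assms(2,3)]] free_module
      2 assms(1)
    by (rule linear_map_free_eqI)
qed

lemma free_nonunital_algebra: "nonunital_algebra R F"
  by (intro nonunital_algebra.intro nonunital_algebra_axioms.intro free_module)
    (simp_all add: free_mult_closed free_mult_assoc free_mult_ladd free_mult_radd free_mult_lsmult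
      free_mult_rsmult)

text \<open>The product of the images and the image of the product are both bilinear, so pairs of
  basis elements suffice. The zero branch covers pairs that do not compose.\<close>

lemma linear_map_alg_homI:
  assumes f: "linear_map F B f" and B: "nonunital_algebra R B"
    and basis: "\<And>x y. \<lbrakk>x \<in> T; y \<in> T\<rbrakk> \<Longrightarrow>
      f (basis R x) \<otimes>\<^bsub>B\<^esub> f (basis R y) = (if P x y then f (basis R (m x y)) else \<zero>\<^bsub>B\<^esub>)"
  shows "f \<in> alg_hom R F B"
proof -
  interpret B: nonunital_algebra R B by fact
  note b = free_basis_closed[where T = T and P = P and m = m]
  have fc: "f u \<in> carrier B" if "u \<in> carrier F" for u
    using f that by (simp add: linear_map_def)
  have l: "linear_map B B (\<lambda>u. u \<otimes>\<^bsub>B\<^esub> v)" "linear_map B B (\<lambda>u. v \<otimes>\<^bsub>B\<^esub> u)" if "v \<in> carrier B" for v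
    using that by (auto intro!: linear_mapI
        simp: B.nu_mult_closed B.nu_l_distr B.nu_r_distr B.nu_smult_l B.nu_smult_r)
  have 0: "f (basis R x \<otimes>\<^bsub>F\<^esub> basis R y) = f (basis R x) \<otimes>\<^bsub>B\<^esub> f (basis R y)" if "x \<in> T" "y \<in> T" for x y
    using linear_map_free_zero[OF f B.module_axioms] that by (simp add: basis free_mult_basis)
  have 1: "f (basis R x \<otimes>\<^bsub>F\<^esub> v) = f (basis R x) \<otimes>\<^bsub>B\<^esub> f v" if "x \<in> T" "v \<in> carrier F" for x v
    using linear_map_comp[OF free_mult_linear_r[OF b[OF that(1)]] f]
      linear_map_comp[OF f l(2)[OF fc[OF b[OF that(1)]]]] B.module_axioms 0[OF that(1)] that(2)
    by (rule linear_map_free_eqI)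
  have 2: "f (u \<otimes>\<^bsub>F\<^esub> v) = f u \<otimes>\<^bsub>B\<^esub> f v" if "u \<in> carrier F" "v \<in> carrier F" for u v
    using linear_map_comp[OF free_mult_linear_l[OF that(2)] f]
      linear_map_comp[OF f l(1)[OF fc[OF that(2)]]] B.module_axioms 1[OF _ that(2)] that(1)
    by (rule linear_map_free_eqI)
  show ?thesis
    using f 2 by (intro alg_homI) (auto simp: linear_map_def)
qed

end

context cring
begin

section \<open>Linear extension\<close>

definition module_ext :: "('a, 'y) module \<Rightarrow> ('x \<Rightarrow> 'y) \<Rightarrow> ('x \<Rightarrow> 'a) \<Rightarrow> 'y" where
  "module_ext B v u = (\<Oplus>\<^bsub>B\<^esub>x\<in>free_support u. u x \<odot>\<^bsub>B\<^esub> v x)"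

lemma
  assumes B: "module R B" and v: "\<And>x. x \<in> T \<Longrightarrow> v x \<in> carrier B"
  shows module_ext_linear: "linear_map (free_on R T P m) B (module_ext B v)"
    and module_ext_basis: "x \<in> T \<Longrightarrow> module_ext B v (basis R x) = v x"
proof -
  interpret B: module R B by fact
  \<comment> \<open>The sum may run over any finite part of \<open>T\<close> that contains the
    support, so that elements with different supports share an index set.\<close>
  have sup: "module_ext B v u = (\<Oplus>\<^bsub>B\<^esub>x\<in>S. u x \<odot>\<^bsub>B\<^esub> v x)"
    if "u \<in> carrier (free_on R T P m)" "finite S" "free_support u \<subseteq> S" "S \<subseteq> T" for u S
    unfolding module_ext_def
    by (rule B.add.finprod_mono_neutral_cong_left)
      (use that free_valued[OF that(1)] v in \<open>auto simp: subset_iff free_support_def\<close>)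
  show "linear_map (free_on R T P m) B (module_ext B v)"
  proof (rule linear_mapI)
    fix u assume u: "u \<in> carrier (free_on R T P m)"
    show "module_ext B v u \<in> carrier B"
      unfolding module_ext_def
      by (rule B.add.finprod_closed) (use u free_valued[OF u] v in \<open>auto simp: free_carrier_iff subset_iff\<close>)
    fix w assume w: "w \<in> carrier (free_on R T P m)"
    let ?S = "free_support u \<union> free_support w"
    note c = free_valued[OF u] free_valued[OF w]
    have S: "finite ?S" "?S \<subseteq> T"
      using u w by (auto simp: free_carrier_iff)
    have "module_ext B v (u \<oplus>\<^bsub>free_on R T P m\<^esub> w) = (\<Oplus>\<^bsub>B\<^esub>x\<in>?S. (u x \<oplus> w x) \<odot>\<^bsub>B\<^esub> v x)"
      using sup[OF free_add_closed[OF u w] S(1) _ S(2)] by (force simp: free_support_def)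
    also have "\<dots> = (\<Oplus>\<^bsub>B\<^esub>x\<in>?S. u x \<odot>\<^bsub>B\<^esub> v x \<oplus>\<^bsub>B\<^esub> w x \<odot>\<^bsub>B\<^esub> v x)"
      by (rule B.add.finprod_cong') (use c S v in \<open>auto simp: B.smult_l_distr subset_iff\<close>)
    also have "\<dots> = (\<Oplus>\<^bsub>B\<^esub>x\<in>?S. u x \<odot>\<^bsub>B\<^esub> v x) \<oplus>\<^bsub>B\<^esub> (\<Oplus>\<^bsub>B\<^esub>x\<in>?S. w x \<odot>\<^bsub>B\<^esub> v x)"
      by (rule B.add.finprod_multf) (use c S v in \<open>auto simp: subset_iff\<close>)
    finally show "module_ext B v (u \<oplus>\<^bsub>free_on R T P m\<^esub> w) = module_ext B v u \<oplus>\<^bsub>B\<^esub> module_ext B v w"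
      using sup[OF u S(1) _ S(2)] sup[OF w S(1) _ S(2)] by simp
  next
    fix r u assume r: "r \<in> carrier R" and u: "u \<in> carrier (free_on R T P m)"
    let ?S = "free_support u"
    note c = free_valued[OF u]
    have S: "finite ?S" "?S \<subseteq> T"
      using u by (auto simp: free_carrier_iff)
    have "module_ext B v (r \<odot>\<^bsub>free_on R T P m\<^esub> u) = (\<Oplus>\<^bsub>B\<^esub>x\<in>?S. (r \<otimes> u x) \<odot>\<^bsub>B\<^esub> v x)"
      using sup[OF free_smult_closed[OF r u] S(1) _ S(2)] r by (force simp: free_support_def)
    also have "\<dots> = (\<Oplus>\<^bsub>B\<^esub>x\<in>?S. r \<odot>\<^bsub>B\<^esub> (u x \<odot>\<^bsub>B\<^esub> v x))"
      by (rule B.add.finprod_cong') (use r c S v in \<open>auto simp: B.smult_assoc1 subset_iff\<close>)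
    also have "\<dots> = r \<odot>\<^bsub>B\<^esub> module_ext B v u"
      unfolding module_ext_def
      by (rule B.finsum_smult_ldistr[symmetric]) (use r c S v in \<open>auto simp: subset_iff\<close>)
    finally show "module_ext B v (r \<odot>\<^bsub>free_on R T P m\<^esub> u) = r \<odot>\<^bsub>B\<^esub> module_ext B v u" .
  qed
  show "module_ext B v (basis R x) = v x" if "x \<in> T"
  proof -
    have "module_ext B v (basis R x) = (\<Oplus>\<^bsub>B\<^esub>y\<in>{x}. basis R x y \<odot>\<^bsub>B\<^esub> v y)"
      by (rule sup) (use that free_basis_closed in \<open>auto simp: free_support_def basis_def\<close>)
    also have "\<dots> = v x"
      using v[OF that] by (simp add: basis_def)
    finally show ?thesis .
  qed
qed

lemma finsum_free_on:
  assumes "finite S" "\<And>x. x \<in> S \<Longrightarrow> f x \<in> carrier (free_on R T P m)"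
  shows "(\<Oplus>\<^bsub>free_on R T P m\<^esub>x\<in>S. f x) y = (\<Oplus>x\<in>S. f x y)"
proof -
  interpret F: module R "free_on R T P m" by (rule free_module)
  show ?thesis
    using assms
  proof (induction S)
    case empty
    then show ?case by simp
  next
    case (insert a S)
    then show ?case
      by (simp add: Pi_def free_valued[where T = T and P = P and m = m])
  qed
qed

text \<open>\<open>lin_ext\<close> adds coefficients along the fibres of \<open>g\<close>. Seen as
  an extension with values in basis elements, it inherits linearity from the general case.\<close>

lemma lin_ext_eq_module_ext:
  assumes g: "g \<in> T \<rightarrow> T'" and u: "u \<in> carrier (free_on R T P m)"
  shows "lin_ext R g u = module_ext (free_on R T' P' m') (\<lambda>x. basis R (g x)) u"
proof
  fix y
  note c = free_valued[OF u]
  have S: "finite (free_support u)" "free_support u \<subseteq> T"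
    using u by (auto simp: free_carrier_iff)
  have "module_ext (free_on R T' P' m') (\<lambda>x. basis R (g x)) u y =
    (\<Oplus>x\<in>free_support u. (u x \<odot>\<^bsub>free_on R T' P' m'\<^esub> basis R (g x)) y)"
    unfolding module_ext_def
    by (rule finsum_free_on)
      (use S g c free_smult_closed[OF _ free_basis_closed[of _ T' P' m']] in \<open>auto simp: Pi_iff subset_iff\<close>)
  also have "\<dots> = (\<Oplus>x\<in>{x. u x \<noteq> \<zero> \<and> g x = y}. u x)"
    by (rule add.finprod_mono_neutral_cong_right)
      (use S c in \<open>auto simp: free_support_def basis_def\<close>)
  finally show "lin_ext R g u y = module_ext (free_on R T' P' m') (\<lambda>x. basis R (g x)) u y"
    by (simp add: lin_ext_def)
qed

lemma
  assumes g: "g \<in> T \<rightarrow> T'"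
  shows lin_ext_linear: "linear_map (free_on R T P m) (free_on R T' P' m') (lin_ext R g)"
    and lin_ext_basis: "x \<in> T \<Longrightarrow> lin_ext R g (basis R x) = basis R (g x)"
proof -
  have v: "basis R (g x) \<in> carrier (free_on R T' P' m')" if "x \<in> T" for x
    using funcset_mem[OF g that] by (rule free_basis_closed)
  have eq: "lin_ext R g u = module_ext (free_on R T' P' m') (\<lambda>x. basis R (g x)) u"
    if "u \<in> carrier (free_on R T P m)" for u
    using lin_ext_eq_module_ext[OF g that] .
  show "linear_map (free_on R T P m) (free_on R T' P' m') (lin_ext R g)"
    using linear_map_cong[OF module_ext_linear[OF free_module v] free_module eq] .
  show "lin_ext R g (basis R x) = basis R (g x)" if "x \<in> T"
    by (simp only: eq[OF free_basis_closed[OF that]] module_ext_basis[OF free_module v that])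
qed

text \<open>Composability has to be reflected as well as preserved: a product that is 0 in the
  source must have image 0.\<close>

lemma lin_ext_alg_hom:
  assumes "partial_semigroup R T P m" "partial_semigroup R T' P' m'" "g \<in> T \<rightarrow> T'"
    and "\<And>x y. \<lbrakk>x \<in> T; y \<in> T\<rbrakk> \<Longrightarrow> P' (g x) (g y) \<longleftrightarrow> P x y"
    and "\<And>x y. \<lbrakk>x \<in> T; y \<in> T; P x y\<rbrakk> \<Longrightarrow> m' (g x) (g y) = g (m x y)"
  shows "lin_ext R g \<in> alg_hom R (free_on R T P m) (free_on R T' P' m')"
proof -
  interpret S: partial_semigroup R T P m by fact
  interpret S': partial_semigroup R T' P' m' by fact
  have g: "g x \<in> T'" if "x \<in> T" for x
    using that assms(3) by blast
  show ?thesis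
    by (rule S.linear_map_alg_homI[OF lin_ext_linear[OF assms(3)] S'.free_nonunital_algebra])
      (simp add: lin_ext_basis[OF assms(3)] S.prod_closed g assms(4,5) free_mult_basis)
qed

lemma free_alg_hom_eqI:
  assumes "f \<in> alg_hom R (free_on R T P m) B" "g \<in> alg_hom R (free_on R T P m) B"
    and "nonunital_algebra R B" "\<And>x. x \<in> T \<Longrightarrow> f (basis R x) = g (basis R x)"
    and "u \<in> carrier (free_on R T P m)"
  shows "f u = g u"
  using linear_map_free_eqI[OF alg_hom_linear[OF assms(1)] alg_hom_linear[OF assms(2)]
      nonunital_algebra.axioms(1)[OF assms(3)] assms(4,5)] .

end


section \<open>The coproduct of two algebras\<close>

text \<open>Evaluation of a word in an algebra. For want of a unit the recursion stops at one
  letter; the value at \<open>[]\<close> is a default outside the basis of non-empty words.\<close>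

fun word_value :: "('c, 'k) ring_scheme \<Rightarrow> ('x \<Rightarrow> 'c) \<Rightarrow> 'x list \<Rightarrow> 'c" where
  "word_value C e [] = \<zero>\<^bsub>C\<^esub>"
| "word_value C e [x] = e x"
| "word_value C e (x # y # w) = e x \<otimes>\<^bsub>C\<^esub> word_value C e (y # w)"

lemma (in nonunital_algebra) word_value_closed:
  "\<lbrakk>w \<noteq> []; \<And>x. x \<in> set w \<Longrightarrow> e x \<in> carrier A\<rbrakk> \<Longrightarrow> word_value A e w \<in> carrier A"
  by (induction w rule: induct_list012) (auto simp: nu_mult_closed)

lemma (in nonunital_algebra) word_value_append:
  "\<lbrakk>w \<noteq> []; w' \<noteq> []; \<And>x. x \<in> set w \<union> set w' \<Longrightarrow> e x \<in> carrier A\<rbrakk> \<Longrightarrow>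
    word_value A e (w @ w') = word_value A e w \<otimes>\<^bsub>A\<^esub> word_value A e w'"
proof (induction w)
  case (Cons x w)
  show ?case
  proof (cases w)
    case Nil
    then show ?thesis
      using Cons.prems(2) by (cases w') auto
  next
    case (Cons y v)
    have "word_value A e w' \<in> carrier A" "word_value A e w \<in> carrier A" "e x \<in> carrier A"
      using Cons Cons.prems by (auto intro!: word_value_closed)
    then show ?thesis
      using Cons.IH Cons.prems Cons by (simp add: nu_mult_assoc)
  qed
qed simp

section \<open>The free non-unital algebra and its universal property\<close>

lemma (in cring) words_partial_semigroup:
  "partial_semigroup R {w. w \<noteq> [] \<and> set w \<subseteq> S} (\<lambda>_ _. True) (@)"
  by unfold_locales auto

lemma (in cring) free_nonunital_algebra: "nonunital_algebra R (free_nonunital R S)"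
  unfolding free_nonunital_def
  by (rule partial_semigroup.free_nonunital_algebra[OF words_partial_semigroup])

lemma (in cring) free_nonunital_basis_closed:
  "x \<in> S \<Longrightarrow> basis R [x] \<in> carrier (free_nonunital R S)"
  unfolding free_nonunital_def by (rule free_basis_closed) auto

lemma (in cring) free_nonunital_basis_Cons:
  assumes "x \<in> S" "w \<noteq> []" "set w \<subseteq> S"
  shows "basis R (x # w) = basis R [x] \<otimes>\<^bsub>free_nonunital R S\<^esub> basis R w"
    and "basis R w \<in> carrier (free_nonunital R S)"
  using assms free_mult_basis[of "[x]" "{w. w \<noteq> [] \<and> set w \<subseteq> S}" w "\<lambda>_ _. True" "(@)"]
  by (auto simp: free_nonunital_def intro!: free_basis_closed)

lemma (in cring) free_nonunital_hom:
  assumes "nonunital_algebra R C" "\<And>x. x \<in> S \<Longrightarrow> e x \<in> carrier C"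
  obtains u where "u \<in> alg_hom R (free_nonunital R S) C" "\<And>x. x \<in> S \<Longrightarrow> u (basis R [x]) = e x"
proof -
  interpret C: nonunital_algebra R C by fact
  let ?T = "{w. w \<noteq> [] \<and> set w \<subseteq> S}"
  interpret S: partial_semigroup R ?T "\<lambda>_ _. True" "(@)"
    by (rule words_partial_semigroup)
  have v: "word_value C e w \<in> carrier C" if "w \<in> ?T" for w
    using that assms(2) by (auto intro!: C.word_value_closed)
  have b: "module_ext C (word_value C e) (basis R w) = word_value C e w" if "w \<in> ?T" for w
    using C.module_axioms v that by (rule module_ext_basis)
  have "module_ext C (word_value C e) \<in> alg_hom R (free_nonunital R S) C"
    unfolding free_nonunital_def
  proof (rule S.linear_map_alg_homI[OF module_ext_linear[OF C.module_axioms v] C.nonunital_algebra_axioms])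
    fix w w' assume w: "w \<in> ?T" "w' \<in> ?T"
    then have ww: "w @ w' \<in> ?T" by auto
    have "word_value C e (w @ w') = word_value C e w \<otimes>\<^bsub>C\<^esub> word_value C e w'"
      by (rule C.word_value_append) (use w assms(2) in auto)
    then show "module_ext C (word_value C e) (basis R w) \<otimes>\<^bsub>C\<^esub> module_ext C (word_value C e) (basis R w') =
        (if True then module_ext C (word_value C e) (basis R (w @ w')) else \<zero>\<^bsub>C\<^esub>)"
      by (simp only: b[OF w(1)] b[OF w(2)] b[OF ww] if_True)
  qed
  moreover have "module_ext C (word_value C e) (basis R [x]) = e x" if "x \<in> S" for x
    using b[of "[x]"] that by simp
  ultimately show thesis
    using that by blast
qed

text \<open>A basis word is the product of its letters, so multiplicativity fixes the values on
  words and linearity fixes the rest.\<close>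

lemma (in cring) free_nonunital_hom_eqI:
  assumes u: "u \<in> alg_hom R (free_nonunital R S) C" and v: "v \<in> alg_hom R (free_nonunital R S) C"
    and C: "nonunital_algebra R C" and eq: "\<And>x. x \<in> S \<Longrightarrow> u (basis R [x]) = v (basis R [x])"
    and z: "z \<in> carrier (free_nonunital R S)"
  shows "u z = v z"
proof -
  have "u (basis R w) = v (basis R w)" if "w \<noteq> []" "set w \<subseteq> S" for w
    using that
  proof (induction w)
    case (Cons x w)
    show ?case
    proof (cases "w = []")
      case False
      then have "x \<in> S" "set w \<subseteq> S"
        using Cons.prems by auto
      then show ?thesis
        using Cons.IH[OF False] eq
        by (simp add: free_nonunital_basis_Cons[OF _ False, of x S] alg_hom_mult[OF u]
            alg_hom_mult[OF v] free_nonunital_basis_closed)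
    qed (use eq Cons.prems in simp)
  qed simp
  then show ?thesis
    using free_alg_hom_eqI[OF u[unfolded free_nonunital_def] v[unfolded free_nonunital_def] C]
      z[unfolded free_nonunital_def] by simp
qed

section \<open>Universal property of the free product of two algebras\<close>

locale two_algebras = A: nonunital_algebra R A + B: nonunital_algebra R B
  for R :: "('r, 'm) ring_scheme" (structure) and A :: "('r, 'a) module" (structure)
    and B :: "('r, 'b) module" (structure)
begin

abbreviation F where "F \<equiv> free_nonunital R (carrier A <+> carrier B)"
abbreviation J where "J \<equiv> coprod_ideal R A B"
abbreviation relations where "relations \<equiv> hom_relations R A Inl F \<union> hom_relations R B Inr F"

sublocale F: nonunital_algebra R F
  by (rule A.free_nonunital_algebra)

lemma gen_closed:
  "x \<in> carrier A \<Longrightarrow> basis R [Inl x] \<in> carrier F" "y \<in> carrier B \<Longrightarrow> basis R [Inr y] \<in> carrier F"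
  by (auto intro!: A.free_nonunital_basis_closed)

lemma relations_closed: "relations \<subseteq> carrier F"
  unfolding hom_relations_def
  by (auto intro!: F.M.minus_closed F.M.add.m_closed F.nu_mult_closed F.smult_closed gen_closed
      A.nu_mult_closed B.nu_mult_closed)

lemma J_ideal: "alg_ideal R F J" and relations_J: "relations \<subseteq> J"
  using gen_alg_ideal[OF F.nonunital_algebra_axioms relations_closed]
  by (auto simp: coprod_ideal_def Let_def)

sublocale Q: algebra_ideal R F J
  by unfold_locales (rule J_ideal)

lemma coprod_nonunital: "nonunital_algebra R (coprod R A B)"
  unfolding coprod_def by (rule Q.quot_nonunital)

text \<open>Each defining relation is one homomorphism law read modulo \<open>J\<close>. The
  embedding \<open>e\<close> stays arbitrary so that both injections are instances.\<close>

lemma relation_hom: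
  assumes "nonunital_algebra R D" "hom_relations R D e F \<subseteq> J"
    and e: "\<And>x. x \<in> carrier D \<Longrightarrow> basis R [e x] \<in> carrier F"
  shows "(\<lambda>x. J +>\<^bsub>F\<^esub> basis R [e x]) \<in> alg_hom R D (quot_alg F J)"
proof -
  interpret D: nonunital_algebra R D by fact
  have rel: "z \<in> J" if "z \<in> hom_relations R D e F" for z
    using that assms(2) by blast
  show ?thesis
  proof (rule alg_homI)
    fix x assume x: "x \<in> carrier D"
    show "J +>\<^bsub>F\<^esub> basis R [e x] \<in> carrier (quot_alg F J)"
      using x by (simp add: Q.quot_closed e)
    show "J +>\<^bsub>F\<^esub> basis R [e (r \<odot>\<^bsub>D\<^esub> x)] = r \<odot>\<^bsub>quot_alg F J\<^esub> (J +>\<^bsub>F\<^esub> basis R [e x])"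
      if "r \<in> carrier R" for r
    proof -
      have "basis R [e (r \<odot>\<^bsub>D\<^esub> x)] \<ominus>\<^bsub>F\<^esub> (r \<odot>\<^bsub>F\<^esub> basis R [e x]) \<in> J"
        by (rule rel) (use that x in \<open>unfold hom_relations_def, blast\<close>)
      then show ?thesis
        using that x by (simp add: Q.quot_smult e Q.coset_eq_iff)
    qed
    fix y assume y: "y \<in> carrier D"
    have "basis R [e (x \<oplus>\<^bsub>D\<^esub> y)] \<ominus>\<^bsub>F\<^esub> (basis R [e x] \<oplus>\<^bsub>F\<^esub> basis R [e y]) \<in> J"
      by (rule rel) (use x y in \<open>unfold hom_relations_def, blast\<close>)
    then show "J +>\<^bsub>F\<^esub> basis R [e (x \<oplus>\<^bsub>D\<^esub> y)] =
        (J +>\<^bsub>F\<^esub> basis R [e x]) \<oplus>\<^bsub>quot_alg F J\<^esub> (J +>\<^bsub>F\<^esub> basis R [e y])"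
      using x y by (simp add: Q.quot_add e Q.coset_eq_iff)
    have m: "basis R [e (x \<otimes>\<^bsub>D\<^esub> y)] \<ominus>\<^bsub>F\<^esub> (basis R [e x] \<otimes>\<^bsub>F\<^esub> basis R [e y]) \<in> J"
      by (rule rel) (use x y in \<open>unfold hom_relations_def, blast\<close>)
    show "J +>\<^bsub>F\<^esub> basis R [e (x \<otimes>\<^bsub>D\<^esub> y)] =
        (J +>\<^bsub>F\<^esub> basis R [e x]) \<otimes>\<^bsub>quot_alg F J\<^esub> (J +>\<^bsub>F\<^esub> basis R [e y])"
      unfolding Q.quot_mult[OF e[OF x] e[OF y]]
      by (intro iffD2[OF Q.coset_eq_iff] m e D.nu_mult_closed F.nu_mult_closed x y)
  qed
qed

lemma coprod_inl_hom: "coprod_inl R A B \<in> alg_hom R A (coprod R A B)"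
  and coprod_inr_hom: "coprod_inr R A B \<in> alg_hom R B (coprod R A B)"
  using relation_hom[where e = Inl, OF A.nonunital_algebra_axioms _ gen_closed(1)]
    relation_hom[where e = Inr, OF B.nonunital_algebra_axioms _ gen_closed(2)] relations_J
  unfolding coprod_inl_def[abs_def] coprod_inr_def[abs_def] coprod_def by blast+

text \<open>Composed with the projection from the free algebra, both maps are determined by their
  values on letters, that is, on the images of the two factors. This is how maps out of the
  coproduct are compared from here on.\<close>

lemma coprod_hom_eqI:
  assumes u: "u \<in> alg_hom R (coprod R A B) C" and v: "v \<in> alg_hom R (coprod R A B) C"
    and C: "nonunital_algebra R C"
    and "\<And>a. a \<in> carrier A \<Longrightarrow> u (coprod_inl R A B a) = v (coprod_inl R A B a)"
    and "\<And>b. b \<in> carrier B \<Longrightarrow> u (coprod_inr R A B b) = v (coprod_inr R A B b)"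
    and z: "z \<in> carrier (coprod R A B)"
  shows "u z = v z"
proof -
  obtain x where x: "x \<in> carrier F" "z = J +>\<^bsub>F\<^esub> x"
    using z unfolding coprod_def by (rule Q.quot_carrierE)
  note p = Q.quot_proj[folded coprod_def]
  have "u (J +>\<^bsub>F\<^esub> x) = v (J +>\<^bsub>F\<^esub> x)"
    using alg_hom_comp[OF p u] alg_hom_comp[OF p v] C _ x(1)
    by (rule A.free_nonunital_hom_eqI) (use assms(4,5) in \<open>auto simp: coprod_inl_def coprod_inr_def\<close>)
  then show ?thesis
    using x by simp
qed

lemma copair_exists:
  assumes C: "nonunital_algebra R C" and f: "f \<in> alg_hom R A C" and g: "g \<in> alg_hom R B C"
  obtains u where "u \<in> alg_hom R (coprod R A B) C"
    "\<And>a. a \<in> carrier A \<Longrightarrow> u (coprod_inl R A B a) = f a"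
    "\<And>b. b \<in> carrier B \<Longrightarrow> u (coprod_inr R A B b) = g b"
proof -
  interpret C: nonunital_algebra R C by fact
  have "case_sum f g x \<in> carrier C" if "x \<in> carrier A <+> carrier B" for x
    using that f g by (auto simp: alg_hom_closed)
  then obtain w where w: "w \<in> alg_hom R F C"
    and wb: "\<And>x. x \<in> carrier A <+> carrier B \<Longrightarrow> w (basis R [x]) = case_sum f g x"
    using A.free_nonunital_hom[OF C, of "carrier A <+> carrier B" "case_sum f g"] by blast
  interpret w: algebra_hom R F C w
    by unfold_locales (rule w)
  interpret f: algebra_hom R A C f
    by unfold_locales (rule f)
  interpret g: algebra_hom R B C g
    by unfold_locales (rule g)
  have wl: "w (basis R [Inl x]) = f x" if "x \<in> carrier A" for x
    using wb[OF InlI[OF that]] by simp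
  have wr: "w (basis R [Inr x]) = g x" if "x \<in> carrier B" for x
    using wb[OF InrI[OF that]] by simp
  \<comment> \<open>Under \<open>w\<close> every relation turns into a homomorphism law of
    \<open>f\<close> or of \<open>g\<close>, which holds by assumption.\<close>
  have rel: "w x = \<zero>\<^bsub>C\<^esub>" if "x \<in> relations" for x
    using that unfolding hom_relations_def
    by (auto simp: w.diff w.add w.smult w.mult gen_closed wl wr f.add f.smult f.mult g.add g.smult g.mult
        A.nu_mult_closed B.nu_mult_closed F.nu_mult_closed C.minus_eq_zero_iff C.nu_mult_closed)
  have "w x = \<zero>\<^bsub>C\<^esub>" if "x \<in> J" for x
    using w.vanish_gen_alg_ideal[OF relations_closed rel] that
    by (simp add: coprod_ideal_def Let_def)
  then obtain u where "u \<in> alg_hom R (quot_alg F J) C" "\<And>x. x \<in> carrier F \<Longrightarrow> u (J +>\<^bsub>F\<^esub> x) = w x"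
    using Q.quot_lift[OF C w] by blast
  then show thesis
    using that[of u] by (simp add: coprod_def coprod_inl_def coprod_inr_def gen_closed wl wr)
qed

text \<open>\<open>copair\<close> is a definite description, so nothing can be said about it before
  existence and uniqueness are known. A map from \<open>copair_exists\<close> is restricted to the
  carrier; extensionality then turns agreement on the carrier into equality.\<close>

lemma
  assumes C: "nonunital_algebra R C" and f: "f \<in> alg_hom R A C" and g: "g \<in> alg_hom R B C"
  shows copair_hom: "copair R A B C f g \<in> alg_hom R (coprod R A B) C"
    and copair_inl: "a \<in> carrier A \<Longrightarrow> copair R A B C f g (coprod_inl R A B a) = f a"
    and copair_inr: "b \<in> carrier B \<Longrightarrow> copair R A B C f g (coprod_inr R A B b) = g b"
proof -
  let ?Q = "coprod R A B"
  let ?P = "\<lambda>u. u \<in> alg_hom R ?Q C \<and> u \<in> extensional (carrier ?Q) \<and>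
     (\<forall>a\<in>carrier A. u (coprod_inl R A B a) = f a) \<and> (\<forall>b\<in>carrier B. u (coprod_inr R A B b) = g b)"
  obtain u where u: "u \<in> alg_hom R ?Q C"
    "\<And>a. a \<in> carrier A \<Longrightarrow> u (coprod_inl R A B a) = f a"
    "\<And>b. b \<in> carrier B \<Longrightarrow> u (coprod_inr R A B b) = g b"
    using copair_exists[OF assms] by blast
  have "?P (restrict u (carrier ?Q))"
    using u alg_hom_cong[OF u(1) coprod_nonunital, of "restrict u (carrier ?Q)"]
    by (simp add: alg_hom_closed[OF coprod_inl_hom] alg_hom_closed[OF coprod_inr_hom])
  moreover have "v = restrict u (carrier ?Q)" if "?P v" for v
  proof (rule extensionalityI)
    show "v x = restrict u (carrier ?Q) x" if "x \<in> carrier ?Q" for x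
      using coprod_hom_eqI[OF _ u(1) C _ _ that, of v] u(2,3) \<open>?P v\<close> that by simp
  qed (use that in auto)
  ultimately have "?P (copair R A B C f g)"
    unfolding copair_def by (rule theI)
  then show "copair R A B C f g \<in> alg_hom R (coprod R A B) C"
    "a \<in> carrier A \<Longrightarrow> copair R A B C f g (coprod_inl R A B a) = f a"
    "b \<in> carrier B \<Longrightarrow> copair R A B C f g (coprod_inr R A B b) = g b"
    by auto
qed

end

lemmas two_algebrasI = two_algebras.intro


section \<open>Simplicial algebras\<close>

lemma
  assumes "simplicial_algebra R S"
  shows simplicial_level: "nonunital_algebra R (level S n)"
    and simplicial_face: "\<lbrakk>1 \<le> n; j \<le> n\<rbrakk> \<Longrightarrow> face S n j \<in> alg_hom R (level S n) (level S (n - 1))"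
    and simplicial_degen: "k \<le> n \<Longrightarrow> degen S n k \<in> alg_hom R (level S n) (level S (n + 1))"
    and simplicial_face_face: "\<lbrakk>2 \<le> n; i < j; j \<le> n; x \<in> carrier (level S n)\<rbrakk> \<Longrightarrow>
       face S (n - 1) i (face S n j x) = face S (n - 1) (j - 1) (face S n i x)"
    and simplicial_face_degen_less: "\<lbrakk>i < j; j \<le> n; x \<in> carrier (level S n)\<rbrakk> \<Longrightarrow>
       face S (n + 1) i (degen S n j x) = degen S (n - 1) (j - 1) (face S n i x)"
    and simplicial_face_degen_same: "\<lbrakk>j \<le> n; x \<in> carrier (level S n)\<rbrakk> \<Longrightarrow> face S (n + 1) j (degen S n j x) = x"
    and simplicial_face_degen_Suc: "\<lbrakk>j \<le> n; x \<in> carrier (level S n)\<rbrakk> \<Longrightarrow> face S (n + 1) (j + 1) (degen S n j x) = x"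
    and simplicial_face_degen_greater: "\<lbrakk>j + 1 < i; i \<le> n + 1; x \<in> carrier (level S n)\<rbrakk> \<Longrightarrow>
       face S (n + 1) i (degen S n j x) = degen S (n - 1) j (face S n (i - 1) x)"
    and simplicial_degen_degen: "\<lbrakk>i \<le> j; j \<le> n; x \<in> carrier (level S n)\<rbrakk> \<Longrightarrow>
       degen S (n + 1) i (degen S n j x) = degen S (n + 1) (j + 1) (degen S n i x)"
  subgoal using assms[unfolded simplicial_algebra_def, THEN conjunct1] by blast
  subgoal using assms[unfolded simplicial_algebra_def, THEN conjunct2, THEN conjunct1] by blast
  subgoal using assms[unfolded simplicial_algebra_def, THEN conjunct2, THEN conjunct2, THEN conjunct1] by blast
  subgoal using assms[unfolded simplicial_algebra_def, THEN conjunct2, THEN conjunct2, THEN conjunct2, THEN conjunct1] by blast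
  subgoal using assms[unfolded simplicial_algebra_def, THEN conjunct2, THEN conjunct2, THEN conjunct2, THEN conjunct2, THEN conjunct1] by blast
  subgoal using assms[unfolded simplicial_algebra_def, THEN conjunct2, THEN conjunct2, THEN conjunct2, THEN conjunct2, THEN conjunct2, THEN conjunct1] by blast
  subgoal using assms[unfolded simplicial_algebra_def, THEN conjunct2, THEN conjunct2, THEN conjunct2, THEN conjunct2, THEN conjunct2, THEN conjunct1] by blast
  subgoal using assms[unfolded simplicial_algebra_def, THEN conjunct2, THEN conjunct2, THEN conjunct2, THEN conjunct2, THEN conjunct2, THEN conjunct2, THEN conjunct1] by blast
  subgoal using assms[unfolded simplicial_algebra_def, THEN conjunct2, THEN conjunct2, THEN conjunct2, THEN conjunct2, THEN conjunct2, THEN conjunct2, THEN conjunct2] by blast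
  done

text \<open>The mixed identities may be checked for \<open>1 \<le> n\<close> only, because
  \<open>i < j \<le> n\<close> and \<open>j + 1 < i \<le> n + 1\<close> both force it. This keeps
  truncated subtraction harmless.\<close>

lemma simplicial_algebraI:
  assumes "\<And>n. nonunital_algebra R (level S n)"
    and "\<And>n j. \<lbrakk>1 \<le> n; j \<le> n\<rbrakk> \<Longrightarrow> face S n j \<in> alg_hom R (level S n) (level S (n - 1))"
    and "\<And>n k. k \<le> n \<Longrightarrow> degen S n k \<in> alg_hom R (level S n) (level S (n + 1))"
    and "\<And>n i j x. \<lbrakk>2 \<le> n; i < j; j \<le> n; x \<in> carrier (level S n)\<rbrakk> \<Longrightarrow>
       face S (n - 1) i (face S n j x) = face S (n - 1) (j - 1) (face S n i x)"
    and "\<And>n i j x. \<lbrakk>1 \<le> n; i < j; j \<le> n; x \<in> carrier (level S n)\<rbrakk> \<Longrightarrow>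
       face S (n + 1) i (degen S n j x) = degen S (n - 1) (j - 1) (face S n i x)"
    and "\<And>n j x. \<lbrakk>j \<le> n; x \<in> carrier (level S n)\<rbrakk> \<Longrightarrow> face S (n + 1) j (degen S n j x) = x"
    and "\<And>n j x. \<lbrakk>j \<le> n; x \<in> carrier (level S n)\<rbrakk> \<Longrightarrow> face S (n + 1) (j + 1) (degen S n j x) = x"
    and "\<And>n i j x. \<lbrakk>1 \<le> n; j + 1 < i; i \<le> n + 1; x \<in> carrier (level S n)\<rbrakk> \<Longrightarrow>
       face S (n + 1) i (degen S n j x) = degen S (n - 1) j (face S n (i - 1) x)"
    and "\<And>n i j x. \<lbrakk>i \<le> j; j \<le> n; x \<in> carrier (level S n)\<rbrakk> \<Longrightarrow>
       degen S (n + 1) i (degen S n j x) = degen S (n + 1) (j + 1) (degen S n i x)"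
  shows "simplicial_algebra R S"
  unfolding simplicial_algebra_def
  apply (intro conjI allI impI ballI)
  subgoal by (rule assms(1))
  subgoal by (rule assms(2))
  subgoal by (rule assms(3))
  subgoal by (rule assms(4))
  subgoal by (rule assms(5)) auto
  subgoal by (rule assms(6))
  subgoal by (rule assms(7))
  subgoal by (rule assms(8)) auto
  subgoal by (rule assms(9))
  done

lemma
  assumes "simplicial_map R S T f"
  shows simplicial_map_hom: "f n \<in> alg_hom R (level S n) (level T n)"
    and simplicial_map_face: "\<lbrakk>1 \<le> n; j \<le> n; x \<in> carrier (level S n)\<rbrakk> \<Longrightarrow>
      f (n - 1) (face S n j x) = face T n j (f n x)"
    and simplicial_map_degen: "\<lbrakk>k \<le> n; x \<in> carrier (level S n)\<rbrakk> \<Longrightarrow>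
      f (n + 1) (degen S n k x) = degen T n k (f n x)"
  using assms unfolding simplicial_map_def by blast+

section \<open>Coproducts of simplicial algebras\<close>

locale two_simplicial_algebras =
  fixes R :: "('r, 'm) ring_scheme" and S :: "('r, 'a) simp_alg" and T :: "('r, 'b) simp_alg"
  assumes S: "simplicial_algebra R S" and T: "simplicial_algebra R T"
begin

abbreviation C where "C \<equiv> simp_coprod R S T"
abbreviation inl where "inl n \<equiv> coprod_inl R (level S n) (level T n)"
abbreviation inr where "inr n \<equiv> coprod_inr R (level S n) (level T n)"

lemma level_coprod: "level C n = coprod R (level S n) (level T n)"
  by (simp add: simp_coprod_def)

lemma two: "two_algebras R (level S n) (level T n)"
  by (intro two_algebrasI simplicial_level[OF S] simplicial_level[OF T])

lemmas inl_hom = two_algebras.coprod_inl_hom[OF two, folded level_coprod]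
lemmas inr_hom = two_algebras.coprod_inr_hom[OF two, folded level_coprod]
lemmas level_nonunital = two_algebras.coprod_nonunital[OF two, folded level_coprod]
lemmas hom_eqI = two_algebras.coprod_hom_eqI[OF two, folded level_coprod]
lemmas copair_facts = two_algebras.copair_hom[OF two, folded level_coprod]
  two_algebras.copair_inl[OF two, folded level_coprod]
  two_algebras.copair_inr[OF two, folded level_coprod]

text \<open>\<open>\<phi>\<close> extends the pair \<open>f\<close>, \<open>g\<close> along the two
  injections. Such a map is determined by the pair, and lifts compose, so every simplicial identity
  of the coproduct reduces to the same identity in \<open>S\<close> and in \<open>T\<close>.\<close>

definition lifts where
  "lifts k l \<phi> f g \<longleftrightarrow> \<phi> \<in> alg_hom R (level C k) (level C l) \<and>
    (\<forall>a\<in>carrier (level S k). f a \<in> carrier (level S l) \<and> \<phi> (inl k a) = inl l (f a)) \<and>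
    (\<forall>b\<in>carrier (level T k). g b \<in> carrier (level T l) \<and> \<phi> (inr k b) = inr l (g b))"

lemma lifts_comp:
  "\<lbrakk>lifts k l \<phi> f g; lifts l m \<psi> f' g'\<rbrakk> \<Longrightarrow> lifts k m (\<lambda>x. \<psi> (\<phi> x)) (\<lambda>a. f' (f a)) (\<lambda>b. g' (g b))"
  by (auto simp: lifts_def intro: alg_hom_comp)

lemma alg_hom_of_lifts: "lifts k l \<phi> f g \<Longrightarrow> \<phi> \<in> alg_hom R (level C k) (level C l)"
  by (simp add: lifts_def)

lemma lifts_id: "lifts k k (\<lambda>x. x) (\<lambda>a. a) (\<lambda>b. b)"
  by (simp add: lifts_def alg_hom_id)

lemma lifts_eq:
  assumes "lifts k l \<phi> f g" "lifts k l \<psi> f' g'"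
    and "\<And>a. a \<in> carrier (level S k) \<Longrightarrow> f a = f' a" "\<And>b. b \<in> carrier (level T k) \<Longrightarrow> g b = g' b"
    and "x \<in> carrier (level C k)"
  shows "\<phi> x = \<psi> x"
  using alg_hom_of_lifts[OF assms(1)] alg_hom_of_lifts[OF assms(2)] level_nonunital _ _ assms(5)
  by (rule hom_eqI) (use assms(1-4) in \<open>simp_all add: lifts_def\<close>)

lemma lifts_copair:
  assumes "f \<in> alg_hom R (level S k) (level S l)" "g \<in> alg_hom R (level T k) (level T l)"
  shows "lifts k l (copair R (level S k) (level T k) (level C l) (\<lambda>x. inl l (f x)) (\<lambda>y. inr l (g y))) f g"
  using copair_facts[OF level_nonunital alg_hom_comp[OF assms(1) inl_hom] alg_hom_comp[OF assms(2) inr_hom]]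
  by (auto simp: lifts_def alg_hom_closed[OF assms(1)] alg_hom_closed[OF assms(2)])

lemma face_lifts:
  assumes "1 \<le> n" "j \<le> n"
  shows "lifts n (n - 1) (face C n j) (face S n j) (face T n j)"
  using lifts_copair[OF simplicial_face[OF S assms] simplicial_face[OF T assms]]
  by (simp add: simp_coprod_def)

lemma degen_lifts:
  assumes "k \<le> n"
  shows "lifts n (n + 1) (degen C n k) (degen S n k) (degen T n k)"
  using lifts_copair[OF simplicial_degen[OF S assms] simplicial_degen[OF T assms]]
  by (simp add: simp_coprod_def)

lemma simplicial_algebra_coprod: "simplicial_algebra R C"
proof (rule simplicial_algebraI)
  show "nonunital_algebra R (level C n)" for n
    by (rule level_nonunital)
  show "face C n j \<in> alg_hom R (level C n) (level C (n - 1))" if "1 \<le> n" "j \<le> n" for n j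
    using face_lifts[OF that] by (rule alg_hom_of_lifts)
  show "degen C n k \<in> alg_hom R (level C n) (level C (n + 1))" if "k \<le> n" for n k
    using degen_lifts[OF that] by (rule alg_hom_of_lifts)
next
  fix n i j x assume x: "x \<in> carrier (level C n)"
  have F: "lifts (n + 1) n (face C (n + 1) k) (face S (n + 1) k) (face T (n + 1) k)" if "k \<le> n + 1" for k
    using face_lifts[of "n + 1" k] that by simp
  have D: "lifts (n - 1) n (degen C (n - 1) k) (degen S (n - 1) k) (degen T (n - 1) k)"
    if "1 \<le> n" "k \<le> n - 1" for k
    using degen_lifts[of k "n - 1"] that by simp
  show "face C (n - 1) i (face C n j x) = face C (n - 1) (j - 1) (face C n i x)"
    if n: "2 \<le> n" "i < j" "j \<le> n"
    by (rule lifts_eq[OF lifts_comp[OF face_lifts face_lifts] lifts_comp[OF face_lifts face_lifts] _ _ x])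
      (use n simplicial_face_face[OF S n] simplicial_face_face[OF T n] in auto)
  show "face C (n + 1) i (degen C n j x) = degen C (n - 1) (j - 1) (face C n i x)"
    if n: "1 \<le> n" "i < j" "j \<le> n"
    by (rule lifts_eq[OF lifts_comp[OF degen_lifts F] lifts_comp[OF face_lifts D] _ _ x])
      (use n simplicial_face_degen_less[OF S n(2,3)] simplicial_face_degen_less[OF T n(2,3)] in auto)
  show "face C (n + 1) j (degen C n j x) = x" if n: "j \<le> n"
    by (rule lifts_eq[OF lifts_comp[OF degen_lifts F] lifts_id _ _ x])
      (use n simplicial_face_degen_same[OF S n] simplicial_face_degen_same[OF T n] in auto)
  show "face C (n + 1) (j + 1) (degen C n j x) = x" if n: "j \<le> n"
    by (rule lifts_eq[OF lifts_comp[OF degen_lifts F] lifts_id _ _ x])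
      (use n simplicial_face_degen_Suc[OF S n] simplicial_face_degen_Suc[OF T n] in auto)
  show "face C (n + 1) i (degen C n j x) = degen C (n - 1) j (face C n (i - 1) x)"
    if n: "1 \<le> n" "j + 1 < i" "i \<le> n + 1"
    by (rule lifts_eq[OF lifts_comp[OF degen_lifts F] lifts_comp[OF face_lifts D] _ _ x])
      (use n simplicial_face_degen_greater[OF S n(2,3)] simplicial_face_degen_greater[OF T n(2,3)] in auto)
  show "degen C (n + 1) i (degen C n j x) = degen C (n + 1) (j + 1) (degen C n i x)"
    if n: "i \<le> j" "j \<le> n"
    by (rule lifts_eq[OF lifts_comp[OF degen_lifts degen_lifts] lifts_comp[OF degen_lifts degen_lifts] _ _ x])
      (use n simplicial_degen_degen[OF S n] simplicial_degen_degen[OF T n] in auto)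
qed

lemma
  assumes U: "simplicial_algebra R U" and f: "simplicial_map R S U f" and g: "simplicial_map R T U g"
  shows simplicial_map_copair: "simplicial_map R C U (simp_copair R S T U f g)"
    and simp_copair_inl: "a \<in> carrier (level S n) \<Longrightarrow> simp_copair R S T U f g n (inl n a) = f n a"
    and simp_copair_inr: "b \<in> carrier (level T n) \<Longrightarrow> simp_copair R S T U f g n (inr n b) = g n b"
proof -
  let ?h = "simp_copair R S T U f g"
  note facts = copair_facts[OF simplicial_level[OF U] simplicial_map_hom[OF f] simplicial_map_hom[OF g]]
  have hom: "?h n \<in> alg_hom R (level C n) (level U n)" for n
    unfolding simp_copair_def by (rule facts)
  have l: "?h n (inl n a) = f n a" if "a \<in> carrier (level S n)" for n a
    unfolding simp_copair_def by (rule facts(2)[OF that])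
  have r: "?h n (inr n b) = g n b" if "b \<in> carrier (level T n)" for n b
    unfolding simp_copair_def by (rule facts(3)[OF that])
  show "?h n (inl n a) = f n a" if "a \<in> carrier (level S n)"
    using that by (rule l)
  show "?h n (inr n b) = g n b" if "b \<in> carrier (level T n)"
    using that by (rule r)
  have "?h (n - 1) (face C n j x) = face U n j (?h n x)"
    if n: "1 \<le> n" "j \<le> n" and x: "x \<in> carrier (level C n)" for n j x
    using alg_hom_comp[OF alg_hom_of_lifts[OF face_lifts[OF n]] hom]
      alg_hom_comp[OF hom simplicial_face[OF U n]] simplicial_level[OF U] _ _ x
    by (rule hom_eqI)
      (use face_lifts[OF n] simplicial_map_face[OF f n] simplicial_map_face[OF g n] in
        \<open>auto simp: lifts_def l r\<close>)
  moreover have "?h (n + 1) (degen C n k x) = degen U n k (?h n x)"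
    if n: "k \<le> n" and x: "x \<in> carrier (level C n)" for n k x
    using alg_hom_comp[OF alg_hom_of_lifts[OF degen_lifts[OF n]] hom]
      alg_hom_comp[OF hom simplicial_degen[OF U n]] simplicial_level[OF U] _ _ x
    by (rule hom_eqI)
      (use degen_lifts[OF n] simplicial_map_degen[OF f n] simplicial_map_degen[OF g n] in
        \<open>auto simp: lifts_def l r\<close>)
  ultimately show "simplicial_map R C U ?h"
    using hom by (simp add: simplicial_map_def)
qed

end


section \<open>Moore normalization and homology algebras\<close>

locale simplicial_alg =
  fixes R :: "('r, 'm) ring_scheme" (structure) and S :: "('r, 'a) simp_alg"
  assumes simplicial: "simplicial_algebra R S"
begin

sublocale L: nonunital_algebra R "level S n" for n
  by (rule simplicial_level[OF simplicial])

lemma face_algebra_hom: "j \<le> Suc n \<Longrightarrow> algebra_hom R (level S (Suc n)) (level S n) (face S (Suc n) j)"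
  using simplicial_face[OF simplicial, of "Suc n" j]
  by (simp add: algebra_hom_def algebra_hom_axioms_def L.nonunital_algebra_axioms)

lemma degen_algebra_hom: "k \<le> n \<Longrightarrow> algebra_hom R (level S n) (level S (Suc n)) (degen S n k)"
  using simplicial_degen[OF simplicial, of k n]
  by (simp add: algebra_hom_def algebra_hom_axioms_def L.nonunital_algebra_axioms)

lemmas face_closed = algebra_hom.closed[OF face_algebra_hom]
lemmas face_rules = algebra_hom.add[OF face_algebra_hom] algebra_hom.mult[OF face_algebra_hom]
  algebra_hom.smult[OF face_algebra_hom] algebra_hom.zero[OF face_algebra_hom]
  algebra_hom.minus[OF face_algebra_hom] algebra_hom.diff[OF face_algebra_hom]
lemmas degen_closed = algebra_hom.closed[OF degen_algebra_hom]
lemmas degen_zero = algebra_hom.zero[OF degen_algebra_hom]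

lemma face_face: "\<lbrakk>i < j; j \<le> Suc (Suc n); x \<in> carrier (level S (Suc (Suc n)))\<rbrakk> \<Longrightarrow>
    face S (Suc n) i (face S (Suc (Suc n)) j x) = face S (Suc n) (j - 1) (face S (Suc (Suc n)) i x)"
  using simplicial_face_face[OF simplicial, of "Suc (Suc n)" i j x] by simp

lemma face_degen_less: "\<lbrakk>i < j; j \<le> Suc n; x \<in> carrier (level S (Suc n))\<rbrakk> \<Longrightarrow>
    face S (Suc (Suc n)) i (degen S (Suc n) j x) = degen S n (j - 1) (face S (Suc n) i x)"
  using simplicial_face_degen_less[OF simplicial, of i j "Suc n" x] by simp

lemma face_degen_same: "\<lbrakk>j \<le> n; x \<in> carrier (level S n)\<rbrakk> \<Longrightarrow> face S (Suc n) j (degen S n j x) = x"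
  using simplicial_face_degen_same[OF simplicial, of j n x] by simp

lemma face_degen_Suc: "\<lbrakk>j \<le> n; x \<in> carrier (level S n)\<rbrakk> \<Longrightarrow> face S (Suc n) (Suc j) (degen S n j x) = x"
  using simplicial_face_degen_Suc[OF simplicial, of j n x] by simp

lemma face_degen_greater: "\<lbrakk>Suc j < i; i \<le> Suc (Suc n); x \<in> carrier (level S (Suc n))\<rbrakk> \<Longrightarrow>
    face S (Suc (Suc n)) i (degen S (Suc n) j x) = degen S n j (face S (Suc n) (i - 1) x)"
  using simplicial_face_degen_greater[OF simplicial, of j i "Suc n" x] by simp

definition N where "N n = {x \<in> carrier (level S n). \<forall>j<n. face S n j x = \<zero>\<^bsub>level S (n - 1)\<^esub>}"
text \<open>The cycles of the Moore complex: for a normalized element the differential vanishes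
  exactly if the last face does. In this form the sign disappears and all faces play the same role.
  In degree 0 there is no face to test.\<close>

definition Z where "Z n = {x \<in> carrier (level S n). n > 0 \<longrightarrow> (\<forall>j\<le>n. face S n j x = \<zero>\<^bsub>level S (n - 1)\<^esub>)}"
abbreviation ZA where "ZA n \<equiv> (level S n)\<lparr>carrier := Z n\<rparr>"
abbreviation \<delta> where "\<delta> \<equiv> moore_diff R S"
abbreviation B where "B \<equiv> boundaries R S"
abbreviation \<epsilon> where "\<epsilon> n \<equiv> (\<ominus> \<one>) [^] (n :: nat)"

lemma sign_closed [simp]: "\<epsilon> n \<in> carrier R"
  by simp

lemma sign_square: "\<epsilon> n \<otimes> \<epsilon> n = \<one>"
proof -
  have "\<epsilon> n \<otimes> \<epsilon> n = ((\<ominus> \<one>) \<otimes> (\<ominus> \<one>)) [^] n"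
    by (simp add: L.R.nat_pow_distrib)
  then show ?thesis
    by (simp add: L.R.l_minus)
qed

lemma N_Suc: "x \<in> N (Suc n) \<longleftrightarrow>
    x \<in> carrier (level S (Suc n)) \<and> (\<forall>j\<le>n. face S (Suc n) j x = \<zero>\<^bsub>level S n\<^esub>)"
  by (auto simp: N_def less_Suc_eq_le)

lemma Z_Suc: "x \<in> Z (Suc n) \<longleftrightarrow>
    x \<in> carrier (level S (Suc n)) \<and> (\<forall>j\<le>Suc n. face S (Suc n) j x = \<zero>\<^bsub>level S n\<^esub>)"
  by (auto simp: Z_def)

lemma Z_0: "Z 0 = carrier (level S 0)" and N_0: "N 0 = carrier (level S 0)"
  by (auto simp: Z_def N_def)

lemma Z_subset_N: "Z n \<subseteq> N n"
  by (auto simp: Z_def N_def)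

lemma N_closed: "x \<in> N n \<Longrightarrow> x \<in> carrier (level S n)" and Z_closed: "x \<in> Z n \<Longrightarrow> x \<in> carrier (level S n)"
  by (auto simp: N_def Z_def)

lemma N_submodule: "submodule (N n) R (level S n)"
proof (cases n)
  case 0
  then show ?thesis
    using L.carrier_is_submodule by (simp add: N_0)
next
  case (Suc m)
  show ?thesis
    unfolding Suc by (rule L.submoduleI_linear) (auto simp: N_Suc face_rules)
qed

lemma Z_submodule: "submodule (Z n) R (level S n)"
proof (cases n)
  case 0
  then show ?thesis
    using L.carrier_is_submodule by (simp add: Z_0)
next
  case (Suc m)
  show ?thesis
    unfolding Suc by (rule L.submoduleI_linear) (auto simp: Z_Suc face_rules)
qed

lemmas N_rules = L.submoduleE[OF N_submodule] L.submodule_minus[OF N_submodule]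
lemmas Z_rules = L.submoduleE[OF Z_submodule] L.submodule_minus[OF Z_submodule]

lemma Z_mult: "\<lbrakk>x \<in> Z n; y \<in> Z n\<rbrakk> \<Longrightarrow> x \<otimes>\<^bsub>level S n\<^esub> y \<in> Z n"
  by (cases n) (auto simp: Z_0 Z_Suc face_rules L.nu_mult_closed)

lemma diff_Suc: "\<delta> (Suc n) x = \<epsilon> (Suc n) \<odot>\<^bsub>level S n\<^esub> face S (Suc n) (Suc n) x"
  by (simp add: moore_diff_def)

lemma diff_closed: "x \<in> carrier (level S (Suc n)) \<Longrightarrow> \<delta> (Suc n) x \<in> carrier (level S n)"
  unfolding diff_Suc by (intro L.smult_closed sign_closed face_closed) auto

lemma
  assumes "x \<in> carrier (level S (Suc n))"
  shows diff_add: "y \<in> carrier (level S (Suc n)) \<Longrightarrow>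
      \<delta> (Suc n) (x \<oplus>\<^bsub>level S (Suc n)\<^esub> y) = \<delta> (Suc n) x \<oplus>\<^bsub>level S n\<^esub> \<delta> (Suc n) y"
    and diff_smult: "r \<in> carrier R \<Longrightarrow> \<delta> (Suc n) (r \<odot>\<^bsub>level S (Suc n)\<^esub> x) = r \<odot>\<^bsub>level S n\<^esub> \<delta> (Suc n) x"
    and diff_minus: "y \<in> carrier (level S (Suc n)) \<Longrightarrow>
      \<delta> (Suc n) (x \<ominus>\<^bsub>level S (Suc n)\<^esub> y) = \<delta> (Suc n) x \<ominus>\<^bsub>level S n\<^esub> \<delta> (Suc n) y"
proof -
  have c: "face S (Suc n) (Suc n) z \<in> carrier (level S n)" if "z \<in> carrier (level S (Suc n))" for z
    using that by (simp add: face_closed)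
  show "\<delta> (Suc n) (x \<oplus>\<^bsub>level S (Suc n)\<^esub> y) = \<delta> (Suc n) x \<oplus>\<^bsub>level S n\<^esub> \<delta> (Suc n) y"
    if "y \<in> carrier (level S (Suc n))"
    unfolding diff_Suc using c[OF assms] c[OF that] assms that
    by (simp only: face_rules L.smult_r_distr sign_closed le_refl)
  show "\<delta> (Suc n) (r \<odot>\<^bsub>level S (Suc n)\<^esub> x) = r \<odot>\<^bsub>level S n\<^esub> \<delta> (Suc n) x" if "r \<in> carrier R"
    unfolding diff_Suc using c[OF assms] assms that
    by (simp only: face_rules L.smult_assoc1[symmetric] sign_closed le_refl L.R.m_comm)
  show "\<delta> (Suc n) (x \<ominus>\<^bsub>level S (Suc n)\<^esub> y) = \<delta> (Suc n) x \<ominus>\<^bsub>level S n\<^esub> \<delta> (Suc n) y"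
    if "y \<in> carrier (level S (Suc n))"
    unfolding diff_Suc using c[OF assms] c[OF that] assms that
    by (simp only: face_rules L.M.minus_eq L.smult_r_distr L.smult_r_minus sign_closed le_refl
        L.M.add.inv_closed)
qed

text \<open>The sign is its own inverse, so applying it once more recovers the face from the
  differential.\<close>

lemma diff_zero_iff:
  assumes "x \<in> carrier (level S (Suc n))"
  shows "\<delta> (Suc n) x = \<zero>\<^bsub>level S n\<^esub> \<longleftrightarrow> face S (Suc n) (Suc n) x = \<zero>\<^bsub>level S n\<^esub>"
proof -
  have c: "face S (Suc n) (Suc n) x \<in> carrier (level S n)"
    using assms by (simp add: face_closed)
  then have "\<epsilon> (Suc n) \<odot>\<^bsub>level S n\<^esub> \<delta> (Suc n) x = face S (Suc n) (Suc n) x"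
    unfolding diff_Suc
    by (simp only: L.smult_assoc1[OF sign_closed sign_closed, symmetric] sign_square L.smult_one)
  then show ?thesis
    using diff_Suc L.smult_r_null[OF sign_closed] by metis
qed

text \<open>A face of the last face is, by the simplicial identity for two faces, also a face of one
  of the lower faces, and these vanish.\<close>

lemma diff_Z:
  assumes "x \<in> N (Suc n)"
  shows "\<delta> (Suc n) x \<in> Z n"
proof -
  have "face S (Suc n) (Suc n) x \<in> Z n"
  proof (cases n)
    case 0
    then show ?thesis
      using assms by (simp add: Z_0 N_Suc face_closed)
  next
    case (Suc m)
    then show ?thesis
      using assms by (auto simp: N_Suc Z_Suc face_closed face_face face_rules)
  qed
  then show ?thesis
    unfolding diff_Suc by (intro Z_rules(4) sign_closed)
qed

lemma diff_diff: "x \<in> N (Suc (Suc n)) \<Longrightarrow> \<delta> (Suc n) (\<delta> (Suc (Suc n)) x) = \<zero>\<^bsub>level S n\<^esub>"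
  using diff_Z[of x "Suc n"] by (simp add: Z_Suc diff_zero_iff)

lemma cycles_eq: "cycles R S n = ZA n"
proof -
  have "{x \<in> N n. \<delta> n x = \<zero>\<^bsub>level S (n - 1)\<^esub>} = Z n"
  proof (cases n)
    case 0
    then show ?thesis by (auto simp: moore_diff_def N_0 Z_0)
  next
    case (Suc m)
    then show ?thesis
      by (auto simp: N_Suc Z_Suc diff_zero_iff le_Suc_eq)
  qed
  then show ?thesis
    by (simp add: cycles_def moore_def N_def)
qed

lemma carrier_moore: "carrier (moore S n) = N n"
  by (simp add: moore_def N_def)

lemma boundaries_eq: "B n = \<delta> (Suc n) ` N (Suc n)"
  by (simp add: boundaries_def carrier_moore)

lemma boundaries_subset: "B n \<subseteq> Z n"
  using diff_Z by (auto simp: boundaries_eq)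

sublocale C: nonunital_algebra R "ZA n" for n
  by (rule L.subalgebra[OF Z_submodule Z_mult])

text \<open>The last face of \<open>degen S n n c\<close> is \<open>c\<close> again, and the lower
  faces of \<open>x\<close> annihilate the product. Hence the differential commutes with
  multiplication by elements of the lower level, which makes boundaries an ideal and later bounds
  products in the image of the connecting map.\<close>

lemma diff_mult:
  assumes x: "x \<in> N (Suc n)" and c: "c \<in> carrier (level S n)"
  shows "x \<otimes>\<^bsub>level S (Suc n)\<^esub> degen S n n c \<in> N (Suc n)"
    and "\<delta> (Suc n) (x \<otimes>\<^bsub>level S (Suc n)\<^esub> degen S n n c) = \<delta> (Suc n) x \<otimes>\<^bsub>level S n\<^esub> c"
    and "degen S n n c \<otimes>\<^bsub>level S (Suc n)\<^esub> x \<in> N (Suc n)"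
    and "\<delta> (Suc n) (degen S n n c \<otimes>\<^bsub>level S (Suc n)\<^esub> x) = c \<otimes>\<^bsub>level S n\<^esub> \<delta> (Suc n) x"
proof -
  have s: "degen S n n c \<in> carrier (level S (Suc n))" and xc: "x \<in> carrier (level S (Suc n))"
    using c x by (auto simp: degen_closed N_Suc)
  have fs: "face S (Suc n) (Suc n) (degen S n n c) = c"
    using c by (simp add: face_degen_Suc)
  have fx: "face S (Suc n) (Suc n) x \<in> carrier (level S n)"
    using xc by (simp add: face_closed)
  show "x \<otimes>\<^bsub>level S (Suc n)\<^esub> degen S n n c \<in> N (Suc n)"
    "degen S n n c \<otimes>\<^bsub>level S (Suc n)\<^esub> x \<in> N (Suc n)"
    using x s by (auto simp: N_Suc face_rules L.nu_mult_closed face_closed)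
  show "\<delta> (Suc n) (x \<otimes>\<^bsub>level S (Suc n)\<^esub> degen S n n c) = \<delta> (Suc n) x \<otimes>\<^bsub>level S n\<^esub> c"
    unfolding diff_Suc using s xc fx c
    by (simp only: face_rules le_refl fs L.nu_smult_l sign_closed)
  show "\<delta> (Suc n) (degen S n n c \<otimes>\<^bsub>level S (Suc n)\<^esub> x) = c \<otimes>\<^bsub>level S n\<^esub> \<delta> (Suc n) x"
    unfolding diff_Suc using s xc fx c
    by (simp only: face_rules le_refl fs L.nu_smult_r sign_closed)
qed

lemma boundaries_ideal: "alg_ideal R (ZA n) (B n)"
  unfolding alg_ideal_def
proof (intro conjI ballI)
  show "submodule (B n) R (ZA n)"
  proof (rule C.submoduleI_linear)
    show "B n \<subseteq> carrier (ZA n)"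
      using boundaries_subset by simp
    have "\<delta> (Suc n) \<zero>\<^bsub>level S (Suc n)\<^esub> = \<zero>\<^bsub>level S n\<^esub>"
      by (simp add: diff_zero_iff face_rules)
    moreover have "\<zero>\<^bsub>level S (Suc n)\<^esub> \<in> N (Suc n)"
      by (simp add: N_Suc face_rules)
    ultimately show "\<zero>\<^bsub>ZA n\<^esub> \<in> B n"
      unfolding boundaries_eq by force
    fix a assume "a \<in> B n"
    then obtain x where x: "x \<in> N (Suc n)" "a = \<delta> (Suc n) x"
      by (auto simp: boundaries_eq)
    show "r \<odot>\<^bsub>ZA n\<^esub> a \<in> B n" if "r \<in> carrier R" for r
      using diff_smult[OF N_closed[OF x(1)] that] N_rules(4)[OF that x(1)] x(2) by (force simp: boundaries_eq)
    fix b assume "b \<in> B n"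
    then obtain y where y: "y \<in> N (Suc n)" "b = \<delta> (Suc n) y"
      by (auto simp: boundaries_eq)
    show "a \<oplus>\<^bsub>ZA n\<^esub> b \<in> B n"
      using diff_add[OF N_closed[OF x(1)] N_closed[OF y(1)]] N_rules(5)[OF x(1) y(1)] x(2) y(2)
      by (force simp: boundaries_eq)
  qed
  fix a c assume "a \<in> B n" and c: "c \<in> carrier (ZA n)"
  then obtain x where x: "x \<in> N (Suc n)" "a = \<delta> (Suc n) x"
    by (auto simp: boundaries_eq)
  have c': "c \<in> carrier (level S n)"
    using c by (simp add: Z_closed)
  show "c \<otimes>\<^bsub>ZA n\<^esub> a \<in> B n" "a \<otimes>\<^bsub>ZA n\<^esub> c \<in> B n"
    using diff_mult[OF x(1) c'] x(2) by (force simp: boundaries_eq)+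
qed

sublocale H: algebra_ideal R "ZA n" "B n" for n
  by unfold_locales (rule boundaries_ideal)

abbreviation cls where "cls \<equiv> homology_class R S"

lemma homology_eq: "homology R S n = quot_alg (ZA n) (B n)"
  by (simp add: homology_def cycles_eq)

lemma cls_eq: "cls n x = B n +>\<^bsub>ZA n\<^esub> x"
  by (simp add: homology_class_def cycles_eq)

text \<open>Additive inverses are taken inside the carrier, so subtraction is not literally
  unchanged when the carrier shrinks. Scaling by -1 is the same in both algebras and identifies the
  two.\<close>

lemma C_minus:
  assumes "x \<in> Z n" "y \<in> Z n"
  shows "x \<ominus>\<^bsub>ZA n\<^esub> y = x \<ominus>\<^bsub>level S n\<^esub> y"
  using assms C.smult_minus_one[of y n] L.smult_minus_one[of y n]
  by (simp add: C.M.minus_eq L.M.minus_eq Z_closed)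

lemma cls_eq_iff: "\<lbrakk>x \<in> Z n; y \<in> Z n\<rbrakk> \<Longrightarrow> cls n x = cls n y \<longleftrightarrow> x \<ominus>\<^bsub>level S n\<^esub> y \<in> B n"
  using H.coset_eq_iff[of x n y] by (simp add: cls_eq C_minus)

lemma homology_nonunital: "nonunital_algebra R (homology R S n)"
  unfolding homology_eq by (rule H.quot_nonunital)

lemma homology_carrierE:
  assumes "X \<in> carrier (homology R S n)"
  obtains x where "x \<in> Z n" "X = cls n x"
  using assms unfolding homology_eq cls_eq H.quot_carrier by auto

lemma
  assumes "x \<in> Z n"
  shows cls_closed: "cls n x \<in> carrier (homology R S n)"
    and cls_add: "y \<in> Z n \<Longrightarrow> cls n x \<oplus>\<^bsub>homology R S n\<^esub> cls n y = cls n (x \<oplus>\<^bsub>level S n\<^esub> y)"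
    and cls_mult: "y \<in> Z n \<Longrightarrow> cls n x \<otimes>\<^bsub>homology R S n\<^esub> cls n y = cls n (x \<otimes>\<^bsub>level S n\<^esub> y)"
    and cls_smult: "r \<in> carrier R \<Longrightarrow> r \<odot>\<^bsub>homology R S n\<^esub> cls n x = cls n (r \<odot>\<^bsub>level S n\<^esub> x)"
  using assms H.quot_closed[of x n] H.quot_add[of x n y] H.quot_mult[of x n y] H.quot_smult[of r x n]
  unfolding homology_eq cls_eq by simp_all

lemma cls_zero: "cls n \<zero>\<^bsub>level S n\<^esub> = \<zero>\<^bsub>homology R S n\<^esub>"
  using H.quot_zero_coset[of n] unfolding homology_eq cls_eq by simp

lemma Z_zero: "\<zero>\<^bsub>level S n\<^esub> \<in> Z n"
  by (cases n) (auto simp: Z_0 Z_Suc face_rules)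

lemma cls_zero_iff: "x \<in> Z n \<Longrightarrow> cls n x = \<zero>\<^bsub>homology R S n\<^esub> \<longleftrightarrow> x \<in> B n"
  using cls_eq_iff[OF _ Z_zero, of x n] by (simp add: cls_zero Z_closed L.minus_zero)

text \<open>Up to sign, the bounding element is \<open>s\<^sub>n\<^sub>+\<^sub>1 x \<cdot> s\<^sub>n\<^sub>+\<^sub>1 y - s\<^sub>n\<^sub>+\<^sub>1 x \<cdot> s\<^sub>n y\<close>.\<close>

lemma cycles_mult_boundary:
  assumes x: "x \<in> Z (Suc n)" and y: "y \<in> Z (Suc n)"
  shows "x \<otimes>\<^bsub>level S (Suc n)\<^esub> y \<in> B (Suc n)"
proof -
  let ?L = "level S (Suc (Suc n))"
  let ?u = "degen S (Suc n) (Suc n) x" and ?v = "degen S (Suc n) (Suc n) y" and ?v' = "degen S (Suc n) n y"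
  let ?w = "?u \<otimes>\<^bsub>?L\<^esub> ?v \<ominus>\<^bsub>?L\<^esub> ?u \<otimes>\<^bsub>?L\<^esub> ?v'"
  note xc = Z_closed[OF x] and yc = Z_closed[OF y]
  have c: "?u \<in> carrier ?L" "?v \<in> carrier ?L" "?v' \<in> carrier ?L"
    using xc yc by (auto simp: degen_closed)
  then have cw: "?w \<in> carrier ?L"
    by (simp add: L.nu_mult_closed)
  have f: "face S (Suc (Suc n)) j ?w =
      face S (Suc (Suc n)) j ?u \<otimes>\<^bsub>level S (Suc n)\<^esub> face S (Suc (Suc n)) j ?v
      \<ominus>\<^bsub>level S (Suc n)\<^esub> face S (Suc (Suc n)) j ?u \<otimes>\<^bsub>level S (Suc n)\<^esub> face S (Suc (Suc n)) j ?v'"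
    if "j \<le> Suc (Suc n)" for j
    using c that by (simp add: face_rules L.nu_mult_closed)
  have low: "face S (Suc (Suc n)) j ?u = \<zero>\<^bsub>level S (Suc n)\<^esub>" if "j < Suc n" for j
    using that x xc by (simp add: face_degen_less Z_Suc degen_zero)
  \<comment> \<open>The top face moves past \<open>degen S (Suc n) n\<close> and becomes the last
    face of \<open>y\<close>. It is here that \<open>y\<close> has to be a cycle and not merely
    normalized.\<close>
  have v': "face S (Suc (Suc n)) (Suc (Suc n)) ?v' = \<zero>\<^bsub>level S (Suc n)\<^esub>"
    using y yc by (simp add: face_degen_greater Z_Suc degen_zero)
  have "face S (Suc (Suc n)) j ?w = \<zero>\<^bsub>level S (Suc n)\<^esub>" if j: "j \<le> Suc n" for j
  proof (cases "j = Suc n")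
    case True
    \<comment> \<open>Among the faces that have to vanish, this is the one that does not kill
      \<open>?u\<close>. Both degeneracies of \<open>y\<close> return \<open>y\<close>, so the two
      products cancel.\<close>
    have "face S (Suc (Suc n)) j ?u = x" "face S (Suc (Suc n)) j ?v = y" "face S (Suc (Suc n)) j ?v' = y"
      using True xc yc by (auto simp: face_degen_same face_degen_Suc)
    then show ?thesis
      using f[of j] xc yc j by (simp add: L.nu_mult_closed L.M.minus_eq L.M.r_neg)
  next
    case False
    then show ?thesis
      using f[of j] low[of j] c j by (simp add: face_closed L.M.minus_eq)
  qed
  then have wN: "?w \<in> N (Suc (Suc n))"
    using cw by (auto simp: N_Suc)
  have "face S (Suc (Suc n)) (Suc (Suc n)) ?u = x" "face S (Suc (Suc n)) (Suc (Suc n)) ?v = y"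
    using xc yc by (auto simp: face_degen_Suc)
  then have top: "face S (Suc (Suc n)) (Suc (Suc n)) ?w = x \<otimes>\<^bsub>level S (Suc n)\<^esub> y"
    using f[of "Suc (Suc n)"] v' xc yc by (simp add: L.nu_mult_closed L.M.minus_eq)
  \<comment> \<open>Scaling \<open>?w\<close> by the sign cancels the sign of the
    differential.\<close>
  let ?e = "\<epsilon> (Suc (Suc n))"
  have "\<delta> (Suc (Suc n)) (?e \<odot>\<^bsub>?L\<^esub> ?w) = ?e \<odot>\<^bsub>level S (Suc n)\<^esub> (?e \<odot>\<^bsub>level S (Suc n)\<^esub> (x \<otimes>\<^bsub>level S (Suc n)\<^esub> y))"
    using diff_smult[OF cw sign_closed] by (simp only: diff_Suc top)
  also have "\<dots> = x \<otimes>\<^bsub>level S (Suc n)\<^esub> y"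
    using L.nu_mult_closed[OF xc yc]
    by (simp only: L.smult_assoc1[OF sign_closed sign_closed, symmetric] sign_square L.smult_one)
  finally have "x \<otimes>\<^bsub>level S (Suc n)\<^esub> y = \<delta> (Suc (Suc n)) (?e \<odot>\<^bsub>?L\<^esub> ?w)" ..
  then show ?thesis
    using N_rules(4)[OF sign_closed wN] unfolding boundaries_eq by blast
qed

end


section \<open>Induced maps in homology\<close>

locale simplicial_hom = S: simplicial_alg R S + T: simplicial_alg R T
  for R :: "('r, 'm) ring_scheme" (structure) and S :: "('r, 'a) simp_alg" and T :: "('r, 'b) simp_alg" +
  fixes f
  assumes map: "simplicial_map R S T f"
begin

sublocale f: algebra_hom R "level S n" "level T n" "f n" for n
  by unfold_locales (rule simplicial_map_hom[OF map])

lemma map_face: "\<lbrakk>j \<le> Suc n; x \<in> carrier (level S (Suc n))\<rbrakk> \<Longrightarrow>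
    f n (face S (Suc n) j x) = face T (Suc n) j (f (Suc n) x)"
  using simplicial_map_face[OF map, of "Suc n" j x] by simp

lemma map_degen: "\<lbrakk>k \<le> n; x \<in> carrier (level S n)\<rbrakk> \<Longrightarrow>
    f (Suc n) (degen S n k x) = degen T n k (f n x)"
  using simplicial_map_degen[OF map, of k n x] by simp

lemma map_N: "x \<in> S.N n \<Longrightarrow> f n x \<in> T.N n"
  by (cases n) (auto simp: S.N_0 T.N_0 S.N_Suc T.N_Suc map_face[symmetric])

lemma map_Z: "x \<in> S.Z n \<Longrightarrow> f n x \<in> T.Z n"
  by (cases n) (auto simp: S.Z_0 T.Z_0 S.Z_Suc T.Z_Suc map_face[symmetric])

lemma map_diff:
  assumes "x \<in> carrier (level S (Suc n))"
  shows "f n (S.\<delta> (Suc n) x) = T.\<delta> (Suc n) (f (Suc n) x)"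
  unfolding S.diff_Suc T.diff_Suc
  using assms by (simp add: f.smult S.face_closed map_face)

lemma map_B:
  assumes "x \<in> S.B n"
  shows "f n x \<in> T.B n"
proof -
  obtain y where "y \<in> S.N (Suc n)" "x = S.\<delta> (Suc n) y"
    using assms by (auto simp: S.boundaries_eq)
  then have "f n x = T.\<delta> (Suc n) (f (Suc n) y)" "f (Suc n) y \<in> T.N (Suc n)"
    by (auto simp: map_diff S.N_closed map_N)
  then show ?thesis
    by (auto simp: T.boundaries_eq)
qed

text \<open>Boundaries go to boundaries, so homologous cycles have homologous images and the union
  in \<open>HA_map\<close> collapses.\<close>

lemma HA_map_cls:
  assumes "x \<in> S.Z n"
  shows "HA_map R T f (Suc n) (S.cls n x) = T.cls n (f n x)"
proof -
  have eq: "T.cls n (f n y) = T.cls n (f n x)" if "y \<in> S.Z n" "S.cls n y = S.cls n x" for y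
    using that assms map_B[of "y \<ominus>\<^bsub>level S n\<^esub> x" n]
    by (simp add: S.cls_eq_iff T.cls_eq_iff map_Z f.diff S.Z_closed)
  have "(\<Union>y\<in>S.cls n x. T.cls n (f n y)) = T.cls n (f n x)"
    unfolding S.cls_eq
  proof (rule S.H.coset_Union_const)
    fix y assume "y \<in> carrier (S.ZA n)"
      and y: "S.B n +>\<^bsub>S.ZA n\<^esub> y = S.B n +>\<^bsub>S.ZA n\<^esub> x"
    then have "y \<in> S.Z n" by simp
    then show "T.cls n (f n y) = T.cls n (f n x)"
      by (rule eq) (simp only: S.cls_eq y)
  qed (use assms in simp)
  then show ?thesis
    unfolding HA_map_def by simp
qed

lemma HA_map_hom: "HA_map R T f (Suc n) \<in> alg_hom R (homology R S n) (homology R T n)"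
proof (rule alg_homI)
  fix P assume "P \<in> carrier (homology R S n)"
  then obtain x where x: "x \<in> S.Z n" "P = S.cls n x"
    by (rule S.homology_carrierE)
  show "HA_map R T f (Suc n) P \<in> carrier (homology R T n)"
    using x by (simp add: HA_map_cls T.cls_closed map_Z)
  show "HA_map R T f (Suc n) (r \<odot>\<^bsub>homology R S n\<^esub> P) = r \<odot>\<^bsub>homology R T n\<^esub> HA_map R T f (Suc n) P"
    if "r \<in> carrier R" for r
    using x that S.Z_rules(4)[OF that x(1)]
    by (simp add: HA_map_cls S.cls_smult T.cls_smult map_Z f.smult S.Z_closed)
  fix Q assume "Q \<in> carrier (homology R S n)"
  then obtain y where y: "y \<in> S.Z n" "Q = S.cls n y"
    by (rule S.homology_carrierE)
  show "HA_map R T f (Suc n) (P \<oplus>\<^bsub>homology R S n\<^esub> Q) =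
      HA_map R T f (Suc n) P \<oplus>\<^bsub>homology R T n\<^esub> HA_map R T f (Suc n) Q"
    using x y S.Z_rules(5)[OF x(1) y(1)]
    by (simp add: HA_map_cls S.cls_add T.cls_add map_Z f.add S.Z_closed)
  show "HA_map R T f (Suc n) (P \<otimes>\<^bsub>homology R S n\<^esub> Q) =
      HA_map R T f (Suc n) P \<otimes>\<^bsub>homology R T n\<^esub> HA_map R T f (Suc n) Q"
    using x y S.Z_mult[OF x(1) y(1)]
    by (simp add: HA_map_cls S.cls_mult T.cls_mult map_Z f.mult S.Z_closed)
qed

end


section \<open>The long exact sequence of a surjection\<close>

lemma (in simplicial_alg) Z_Suc_iff:
  "x \<in> Z (Suc n) \<longleftrightarrow> x \<in> N (Suc n) \<and> \<delta> (Suc n) x = \<zero>\<^bsub>level S n\<^esub>"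
  by (auto simp: Z_Suc N_Suc diff_zero_iff le_Suc_eq)

locale simplicial_surjection =
  T: simplicial_alg R T + U: simplicial_alg R U + hom: simplicial_hom R T U g
  for R :: "('r, 'm) ring_scheme" (structure) and T :: "('r, 'a) simp_alg" and U :: "('r, 'b) simp_alg"
    and g +
  assumes surj: "y \<in> carrier (level U n) \<Longrightarrow> \<exists>x\<in>carrier (level T n). g n x = y"
begin

section \<open>The kernel of a surjection as a simplicial algebra\<close>

abbreviation K where "K \<equiv> simp_kernel T U g"

lemma level_K: "level K n = (level T n)\<lparr>carrier := a_kernel (level T n) (level U n) (g n)\<rparr>"
  and face_K: "face K = face T" and degen_K: "degen K = degen T"
  by (auto simp: simp_kernel_def)

lemma K_iff: "x \<in> carrier (level K n) \<longleftrightarrow> x \<in> carrier (level T n) \<and> g n x = \<zero>\<^bsub>level U n\<^esub>"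
  by (simp add: level_K a_kernel_def')

lemma K_ops [simp]:
  "x \<oplus>\<^bsub>level K n\<^esub> y = x \<oplus>\<^bsub>level T n\<^esub> y" "x \<otimes>\<^bsub>level K n\<^esub> y = x \<otimes>\<^bsub>level T n\<^esub> y"
  "r \<odot>\<^bsub>level K n\<^esub> x = r \<odot>\<^bsub>level T n\<^esub> x" "\<zero>\<^bsub>level K n\<^esub> = \<zero>\<^bsub>level T n\<^esub>"
  by (simp_all add: level_K)

lemma K_level_nonunital: "nonunital_algebra R (level K n)"
  unfolding level_K using hom.f.kernel_ideal[of n]
  by (intro T.L.subalgebra) (auto simp: alg_ideal_def a_kernel_def')

lemma K_face:
  assumes "j \<le> Suc n"
  shows "face K (Suc n) j \<in> alg_hom R (level K (Suc n)) (level K n)"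
  using assms
  by (intro alg_homI)
    (auto simp: K_iff face_K T.face_closed T.face_rules hom.map_face U.face_rules)

lemma K_degen:
  assumes "k \<le> n"
  shows "degen K n k \<in> alg_hom R (level K n) (level K (Suc n))"
proof -
  interpret s: algebra_hom R "level T n" "level T (Suc n)" "degen T n k"
    by (rule T.degen_algebra_hom[OF assms])
  show ?thesis
    using assms
    by (intro alg_homI)
      (auto simp: K_iff degen_K s.add s.mult s.smult hom.map_degen U.degen_zero)
qed

lemma simplicial_K: "simplicial_algebra R K"
proof (rule simplicial_algebraI)
  show "face K n j \<in> alg_hom R (level K n) (level K (n - 1))" if "1 \<le> n" "j \<le> n" for n j
    using K_face[of j "n - 1"] that by simp
  show "degen K n k \<in> alg_hom R (level K n) (level K (n + 1))" if "k \<le> n" for n k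
    using K_degen[OF that] by simp
qed (simp_all only: K_level_nonunital K_iff face_K degen_K
    simplicial_face_face[OF T.simplicial] simplicial_face_degen_less[OF T.simplicial]
    simplicial_face_degen_same[OF T.simplicial] simplicial_face_degen_Suc[OF T.simplicial]
    simplicial_face_degen_greater[OF T.simplicial] simplicial_degen_degen[OF T.simplicial])

lemma simplicial_incl: "simplicial_map R K T (\<lambda>n x. x)"
  by (auto simp: simplicial_map_def face_K degen_K K_iff intro!: alg_homI)

sublocale K: simplicial_alg R K
  by unfold_locales (rule simplicial_K)

sublocale incl: simplicial_hom R K T "\<lambda>n x. x"
  by unfold_locales (rule simplicial_incl)

lemma K_N: "x \<in> K.N n \<longleftrightarrow> x \<in> T.N n \<and> g n x = \<zero>\<^bsub>level U n\<^esub>"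
  by (auto simp: K.N_def T.N_def K_iff face_K)

lemma K_Z: "x \<in> K.Z n \<longleftrightarrow> x \<in> T.Z n \<and> g n x = \<zero>\<^bsub>level U n\<^esub>"
  by (auto simp: K.Z_def T.Z_def K_iff face_K)

lemma K_diff: "K.\<delta> (Suc n) x = T.\<delta> (Suc n) x"
  by (simp add: K.diff_Suc T.diff_Suc face_K)

lemma K_minus: "\<lbrakk>x \<in> carrier (level K n); y \<in> carrier (level K n)\<rbrakk> \<Longrightarrow> x \<ominus>\<^bsub>level K n\<^esub> y = x \<ominus>\<^bsub>level T n\<^esub> y"
  by (rule incl.f.diff)

lemma short_exact_kernel: "short_exact R K (\<lambda>n x. x) T g U"
proof -
  have z: "nonunital_algebra R (zero_algebra :: ('r, unit) module)"
    by (rule nonunital_zero_algebra) (rule T.L.R.is_cring)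
  have "exact_at R (zero_algebra :: ('r, unit) module) (\<lambda>_. \<zero>\<^bsub>level K n\<^esub>) (level K n) (\<lambda>x. x) (level T n)" for n
    unfolding exact_at_def using z K.L.nonunital_algebra_axioms T.L.nonunital_algebra_axioms incl.f.f
    by (auto simp: a_kernel_def' zero_algebra_def K_iff intro!: alg_homI)
  moreover have "exact_at R (level K n) (\<lambda>x. x) (level T n) (g n) (level U n)" for n
    unfolding exact_at_def using U.L.nonunital_algebra_axioms K.L.nonunital_algebra_axioms
      T.L.nonunital_algebra_axioms incl.f.f hom.f.f
    by (auto simp: a_kernel_def' K_iff)
  moreover have "exact_at R (level T n) (g n) (level U n) (\<lambda>_. ()) (zero_algebra :: ('r, unit) module)" for n
    unfolding exact_at_def using U.L.nonunital_algebra_axioms z T.L.nonunital_algebra_axioms hom.f.f surj[of _ n]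
    by (force simp: a_kernel_def' zero_algebra_def intro!: alg_homI)
  ultimately show ?thesis
    by (simp add: short_exact_def simplicial_K T.simplicial U.simplicial simplicial_incl hom.map)
qed

text \<open>A lift is moved into the normalization by successively subtracting \<open>s\<^sub>k d\<^sub>k\<close> of it.\<close>

lemma lift_N:
  assumes "w \<in> U.N n"
  obtains z where "z \<in> T.N n" "g n z = w"
proof (cases n)
  case 0
  then show thesis
    using that assms surj[of w 0] by (auto simp: U.N_0 T.N_0)
next
  case (Suc m)
  \<comment> \<open>\<open>k\<close> counts the initial faces already made zero. Normalization
    concerns faces \<open>0\<close> to \<open>m\<close>, so \<open>k\<close> ends at
    \<open>Suc m\<close> and the last face remains free.\<close>
  have "\<exists>z\<in>carrier (level T (Suc m)). g (Suc m) z = w \<and> (\<forall>j<k. face T (Suc m) j z = \<zero>\<^bsub>level T m\<^esub>)"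
    if "k \<le> Suc m" for k
    using that
  proof (induction k)
    case 0
    then show ?case
      using surj[of w "Suc m"] assms Suc by (auto simp: U.N_Suc)
  next
    case (Suc k)
    then obtain z where z: "z \<in> carrier (level T (Suc m))" "g (Suc m) z = w"
      "\<And>j. j < k \<Longrightarrow> face T (Suc m) j z = \<zero>\<^bsub>level T m\<^esub>"
      by auto
    have k: "k \<le> m" using Suc.prems by simp
    let ?y = "face T (Suc m) k z"
    let ?s = "degen T m k ?y"
    have y: "?y \<in> carrier (level T m)"
      using z k by (simp add: T.face_closed)
    have s: "?s \<in> carrier (level T (Suc m))"
      using y k by (simp add: T.degen_closed)
    have "face T (Suc m) j (z \<ominus>\<^bsub>level T (Suc m)\<^esub> ?s) = \<zero>\<^bsub>level T m\<^esub>" if j: "j < Suc k" for j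
    proof (cases "j = k")
      case True
      then show ?thesis
        using z(1) s y k by (simp add: T.face_rules T.face_degen_same T.L.M.minus_eq T.L.M.r_neg)
    next
      case False
      then have jk: "j < k" using j by simp
      then obtain m' where m: "m = Suc m'"
        using k by (cases m) auto
      \<comment> \<open>For \<open>j < k\<close>, face \<open>j\<close> of \<open>?y\<close> is a
        face of the vanishing face \<open>j\<close> of \<open>z\<close>. So the correction
        \<open>?s\<close> leaves the faces killed earlier at zero.\<close>
      have "face T m j ?y = \<zero>\<^bsub>level T m'\<^esub>"
        using jk k z m by (simp add: T.face_face T.face_rules)
      then have "face T (Suc m) j ?s = \<zero>\<^bsub>level T m\<^esub>"
        using jk k y m by (simp add: T.face_degen_less T.degen_zero)
      then show ?thesis
        using z jk k s by (simp add: T.face_rules T.L.minus_zero)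
    qed
    moreover have "g (Suc m) (z \<ominus>\<^bsub>level T (Suc m)\<^esub> ?s) = w"
    proof -
      \<comment> \<open>The correction is built from face \<open>k\<close> of \<open>z\<close>,
        whose image is face \<open>k\<close> of \<open>w\<close>. That one is zero because
        \<open>w\<close> is normalized, so the image \<open>w\<close> of the lift stays the
        same.\<close>
      have "g m ?y = \<zero>\<^bsub>level U m\<^esub>"
        using z k assms \<open>n = Suc m\<close> by (simp add: hom.map_face U.N_Suc)
      then have "g (Suc m) ?s = \<zero>\<^bsub>level U (Suc m)\<^esub>"
        using y k by (simp add: hom.map_degen U.degen_zero)
      moreover have "w \<in> carrier (level U (Suc m))"
        using z(1,2) hom.f.closed by blast
      ultimately show ?thesis
        using z s by (simp add: hom.f.diff U.L.minus_zero)
    qed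
    moreover have "z \<ominus>\<^bsub>level T (Suc m)\<^esub> ?s \<in> carrier (level T (Suc m))"
      using z s by simp
    ultimately show ?case by blast
  qed
  from this[of "Suc m"] show thesis
    using that Suc by (auto simp: T.N_Suc less_Suc_eq_le)
qed

section \<open>The connecting map\<close>

lemma diff_K_Z:
  assumes "z \<in> T.N (Suc n)" "g (Suc n) z \<in> U.Z (Suc n)"
  shows "T.\<delta> (Suc n) z \<in> K.Z n"
  using assms T.diff_Z[OF assms(1)] by (simp add: K_Z hom.map_diff T.N_closed U.Z_Suc_iff)

text \<open>The images of \<open>z\<close> and \<open>z'\<close> differ by the boundary of some
  \<open>w\<close>. After lifting \<open>w\<close> to \<open>v\<close>, the element
  \<open>z - z'\<close> minus the boundary of \<open>v\<close> is normalized and lies in the kernel.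
  Its own boundary is the difference of the two candidates, because the boundary of a boundary
  vanishes.\<close>

lemma connecting_well_defined:
  assumes z: "z \<in> T.N (Suc n)" "g (Suc n) z \<in> U.Z (Suc n)"
    and z': "z' \<in> T.N (Suc n)" "g (Suc n) z' \<in> U.Z (Suc n)"
    and eq: "U.cls (Suc n) (g (Suc n) z) = U.cls (Suc n) (g (Suc n) z')"
  shows "K.cls n (T.\<delta> (Suc n) z) = K.cls n (T.\<delta> (Suc n) z')"
proof -
  note zc = T.N_closed[OF z(1)] T.N_closed[OF z'(1)]
  have "g (Suc n) z \<ominus>\<^bsub>level U (Suc n)\<^esub> g (Suc n) z' \<in> U.B (Suc n)"
    using eq z(2) z'(2) U.cls_eq_iff by blast
  then obtain w where w: "w \<in> U.N (Suc (Suc n))"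
    "g (Suc n) (z \<ominus>\<^bsub>level T (Suc n)\<^esub> z') = U.\<delta> (Suc (Suc n)) w"
    using zc by (auto simp: U.boundaries_eq hom.f.diff)
  obtain v where v: "v \<in> T.N (Suc (Suc n))" "g (Suc (Suc n)) v = w"
    using lift_N[OF w(1)] .
  let ?b = "T.\<delta> (Suc (Suc n)) v"
  let ?u = "z \<ominus>\<^bsub>level T (Suc n)\<^esub> z' \<ominus>\<^bsub>level T (Suc n)\<^esub> ?b"
  have b: "?b \<in> T.N (Suc n)"
    using T.diff_Z[OF v(1)] T.Z_subset_N by blast
  note bc = T.N_closed[OF b]
  have zz: "z \<ominus>\<^bsub>level T (Suc n)\<^esub> z' \<in> T.N (Suc n)"
    using z z' by (simp add: T.N_rules)
  have "?u \<in> T.N (Suc n)"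
    using zz b by (simp add: T.N_rules)
  moreover have "g (Suc n) ?u = \<zero>\<^bsub>level U (Suc n)\<^esub>"
    using w v T.N_closed[OF zz] bc U.diff_closed[OF U.N_closed[OF w(1)]]
    by (simp add: hom.f.diff[of "z \<ominus>\<^bsub>level T (Suc n)\<^esub> z'"] hom.map_diff T.N_closed U.L.minus_eq_zero_iff)
  ultimately have "?u \<in> K.N (Suc n)"
    by (simp add: K_N)
  moreover have "T.\<delta> (Suc n) ?u = T.\<delta> (Suc n) z \<ominus>\<^bsub>level T n\<^esub> T.\<delta> (Suc n) z'"
    using zc bc v T.N_closed[OF zz] T.diff_closed[OF zc(1)] T.diff_closed[OF zc(2)]
    by (simp add: T.diff_minus T.diff_diff T.L.minus_zero)
  ultimately have "T.\<delta> (Suc n) z \<ominus>\<^bsub>level T n\<^esub> T.\<delta> (Suc n) z' \<in> K.B n"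
    unfolding K.boundaries_eq K_diff by (metis imageI)
  then show ?thesis
    using diff_K_Z[OF z] diff_K_Z[OF z'] by (simp add: K.cls_eq_iff K_minus K.Z_closed)
qed

text \<open>The choice ranges over the boundaries of all normalized lifts of all representatives of
  \<open>P\<close> at once; \<open>connecting_cls\<close> shows that the class does not depend on
  it.\<close>

definition connecting where
  "connecting n P = K.cls n (SOME y. \<exists>z. z \<in> T.N (Suc n) \<and> g (Suc n) z \<in> U.Z (Suc n) \<and>
     P = U.cls (Suc n) (g (Suc n) z) \<and> y = T.\<delta> (Suc n) z)"

lemma connecting_cls:
  assumes z: "z \<in> T.N (Suc n)" "g (Suc n) z \<in> U.Z (Suc n)"
  shows "connecting n (U.cls (Suc n) (g (Suc n) z)) = K.cls n (T.\<delta> (Suc n) z)"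
  unfolding connecting_def
proof (rule someI2)
  show "\<exists>z'. z' \<in> T.N (Suc n) \<and> g (Suc n) z' \<in> U.Z (Suc n) \<and>
     U.cls (Suc n) (g (Suc n) z) = U.cls (Suc n) (g (Suc n) z') \<and> T.\<delta> (Suc n) z = T.\<delta> (Suc n) z'"
    using z by blast
  fix y
  assume "\<exists>z'. z' \<in> T.N (Suc n) \<and> g (Suc n) z' \<in> U.Z (Suc n) \<and>
     U.cls (Suc n) (g (Suc n) z) = U.cls (Suc n) (g (Suc n) z') \<and> y = T.\<delta> (Suc n) z'"
  then show "K.cls n y = K.cls n (T.\<delta> (Suc n) z)"
    using connecting_well_defined[OF z] by auto
qed

lemma homology_U_E:
  assumes "P \<in> carrier (homology R U n)"
  obtains z where "z \<in> T.N n" "g n z \<in> U.Z n" "P = U.cls n (g n z)"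
proof -
  obtain x where "x \<in> U.Z n" "P = U.cls n x"
    using assms by (rule U.homology_carrierE)
  moreover obtain z where "z \<in> T.N n" "g n z = x"
    using lift_N[of x n] U.Z_subset_N \<open>x \<in> U.Z n\<close> by blast
  ultimately show thesis
    using that by blast
qed

text \<open>Products in the source vanish, and \<open>\<delta>(z) \<cdot> \<delta>(z')\<close> bounds \<open>z \<cdot> s\<^sub>n \<delta>(z')\<close>, which lies in the kernel.\<close>

lemma connecting_hom: "connecting n \<in> alg_hom R (homology R U (Suc n)) (homology R K n)"
proof (rule alg_homI)
  fix P assume "P \<in> carrier (homology R U (Suc n))"
  then obtain z where z: "z \<in> T.N (Suc n)" "g (Suc n) z \<in> U.Z (Suc n)" and P: "P = U.cls (Suc n) (g (Suc n) z)"
    by (rule homology_U_E)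
  note zc = T.N_closed[OF z(1)] and c = connecting_cls[OF z] and k = diff_K_Z[OF z]
  show "connecting n P \<in> carrier (homology R K n)"
    unfolding P c using k by (rule K.cls_closed)
  show "connecting n (r \<odot>\<^bsub>homology R U (Suc n)\<^esub> P) = r \<odot>\<^bsub>homology R K n\<^esub> connecting n P" if r: "r \<in> carrier R" for r
  proof -
    have "r \<odot>\<^bsub>level T (Suc n)\<^esub> z \<in> T.N (Suc n)" "r \<odot>\<^bsub>level U (Suc n)\<^esub> g (Suc n) z \<in> U.Z (Suc n)"
      using r z by (simp_all add: T.N_rules U.Z_rules)
    moreover have "g (Suc n) (r \<odot>\<^bsub>level T (Suc n)\<^esub> z) = r \<odot>\<^bsub>level U (Suc n)\<^esub> g (Suc n) z"
      using r zc by (simp add: hom.f.smult)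
    ultimately have "connecting n (U.cls (Suc n) (r \<odot>\<^bsub>level U (Suc n)\<^esub> g (Suc n) z)) =
        K.cls n (T.\<delta> (Suc n) (r \<odot>\<^bsub>level T (Suc n)\<^esub> z))"
      using connecting_cls by metis
    then show ?thesis
      unfolding P c using r z zc k by (simp add: U.cls_smult K.cls_smult T.diff_smult)
  qed
  fix Q assume "Q \<in> carrier (homology R U (Suc n))"
  then obtain z' where z': "z' \<in> T.N (Suc n)" "g (Suc n) z' \<in> U.Z (Suc n)" and Q: "Q = U.cls (Suc n) (g (Suc n) z')"
    by (rule homology_U_E)
  note zc' = T.N_closed[OF z'(1)] and c' = connecting_cls[OF z'] and k' = diff_K_Z[OF z']
  show "connecting n (P \<oplus>\<^bsub>homology R U (Suc n)\<^esub> Q) = connecting n P \<oplus>\<^bsub>homology R K n\<^esub> connecting n Q"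
  proof -
    have "z \<oplus>\<^bsub>level T (Suc n)\<^esub> z' \<in> T.N (Suc n)" "g (Suc n) z \<oplus>\<^bsub>level U (Suc n)\<^esub> g (Suc n) z' \<in> U.Z (Suc n)"
      using z z' by (simp_all add: T.N_rules U.Z_rules)
    moreover have "g (Suc n) (z \<oplus>\<^bsub>level T (Suc n)\<^esub> z') = g (Suc n) z \<oplus>\<^bsub>level U (Suc n)\<^esub> g (Suc n) z'"
      using zc zc' by (simp add: hom.f.add)
    ultimately have "connecting n (U.cls (Suc n) (g (Suc n) z \<oplus>\<^bsub>level U (Suc n)\<^esub> g (Suc n) z')) =
        K.cls n (T.\<delta> (Suc n) (z \<oplus>\<^bsub>level T (Suc n)\<^esub> z'))"
      using connecting_cls by metis
    then show ?thesis
      unfolding P Q c c' using z z' zc zc' k k' by (simp add: U.cls_add K.cls_add T.diff_add)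
  qed
  show "connecting n (P \<otimes>\<^bsub>homology R U (Suc n)\<^esub> Q) = connecting n P \<otimes>\<^bsub>homology R K n\<^esub> connecting n Q"
  proof -
    let ?y = "T.\<delta> (Suc n) z'"
    let ?v = "z \<otimes>\<^bsub>level T (Suc n)\<^esub> degen T n n ?y"
    have y: "?y \<in> carrier (level T n)" "g n ?y = \<zero>\<^bsub>level U n\<^esub>"
      using k' by (auto simp: K_Z T.Z_closed)
    have "g (Suc n) ?v = \<zero>\<^bsub>level U (Suc n)\<^esub>"
      using y zc by (simp add: hom.f.mult T.degen_closed hom.map_degen U.degen_zero)
    then have "?v \<in> K.N (Suc n)"
      using T.diff_mult(1)[OF z(1) y(1)] by (simp add: K_N)
    then have "T.\<delta> (Suc n) z \<otimes>\<^bsub>level T n\<^esub> ?y \<in> K.B n"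
      unfolding K.boundaries_eq K_diff T.diff_mult(2)[OF z(1) y(1), symmetric] by (rule imageI)
    moreover have "T.\<delta> (Suc n) z \<otimes>\<^bsub>level T n\<^esub> ?y \<in> K.Z n"
      using K.Z_mult[OF k k'] by simp
    ultimately have 1: "connecting n P \<otimes>\<^bsub>homology R K n\<^esub> connecting n Q = \<zero>\<^bsub>homology R K n\<^esub>"
      unfolding P Q c c' using k k' by (simp add: K.cls_mult K.cls_zero_iff)
    \<comment> \<open>The zero class has the lift 0, so \<open>connecting_cls\<close> evaluates the
      map there as well.\<close>
    have 0: "\<zero>\<^bsub>level T (Suc n)\<^esub> \<in> T.N (Suc n)" "\<zero>\<^bsub>level U (Suc n)\<^esub> \<in> U.Z (Suc n)"
      using T.Z_zero T.Z_subset_N U.Z_zero by blast+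
    have "P \<otimes>\<^bsub>homology R U (Suc n)\<^esub> Q = \<zero>\<^bsub>homology R U (Suc n)\<^esub>"
      unfolding P Q using z z' U.cycles_mult_boundary[OF z(2) z'(2)]
      by (simp add: U.cls_mult U.cls_zero_iff U.Z_mult)
    also have "\<dots> = U.cls (Suc n) (g (Suc n) \<zero>\<^bsub>level T (Suc n)\<^esub>)"
      by (simp add: U.cls_zero)
    finally have "connecting n (P \<otimes>\<^bsub>homology R U (Suc n)\<^esub> Q) = K.cls n (T.\<delta> (Suc n) \<zero>\<^bsub>level T (Suc n)\<^esub>)"
      using connecting_cls[OF 0(1)] 0(2) by simp
    also have "\<dots> = \<zero>\<^bsub>homology R K n\<^esub>"
      using K.cls_zero[of n] by (simp add: T.diff_zero_iff[THEN iffD2] T.face_rules)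
    finally show ?thesis
      using 1 by simp
  qed
qed

section \<open>Exactness at the kernel, at the source and at the target\<close>

lemma exact_homology_K:
  "exact_at R (homology R U (Suc n)) (connecting n) (homology R K n)
    (HA_map R T (\<lambda>n x. x) (Suc n)) (homology R T n)"
proof -
  have "connecting n ` carrier (homology R U (Suc n)) =
      a_kernel (homology R K n) (homology R T n) (HA_map R T (\<lambda>n x. x) (Suc n))" (is "_ = ?K")
  proof (intro equalityI subsetI)
    fix Q assume "Q \<in> connecting n ` carrier (homology R U (Suc n))"
    then obtain z where z: "z \<in> T.N (Suc n)" "g (Suc n) z \<in> U.Z (Suc n)"
      and Q: "Q = connecting n (U.cls (Suc n) (g (Suc n) z))"
      by (auto elim: homology_U_E)
    note k = diff_K_Z[OF z]
    have "T.\<delta> (Suc n) z \<in> T.B n"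
      using z by (auto simp: T.boundaries_eq)
    then show "Q \<in> ?K"
      unfolding Q connecting_cls[OF z] a_kernel_def'
      using k incl.map_Z[OF k] by (simp add: K.cls_closed incl.HA_map_cls T.cls_zero_iff)
  next
    fix Q assume Q: "Q \<in> ?K"
    then have "Q \<in> carrier (homology R K n)"
      by (simp add: a_kernel_def')
    then obtain y where y: "y \<in> K.Z n" "Q = K.cls n y"
      by (rule K.homology_carrierE)
    then have "y \<in> T.B n"
      using Q incl.map_Z[OF y(1)] by (simp add: a_kernel_def' incl.HA_map_cls T.cls_zero_iff)
    then obtain z where z: "z \<in> T.N (Suc n)" "y = T.\<delta> (Suc n) z"
      by (auto simp: T.boundaries_eq)
    \<comment> \<open>\<open>z\<close> itself need not lie in the kernel, but its boundary
      \<open>y\<close> does. So the image of \<open>z\<close> is a cycle, and the connecting map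
      sends its class to the class of \<open>y\<close>.\<close>
    have "g (Suc n) z \<in> U.Z (Suc n)"
      using z y by (simp add: U.Z_Suc_iff hom.map_N hom.map_diff[symmetric] T.N_closed K_Z)
    then show "Q \<in> connecting n ` carrier (homology R U (Suc n))"
      using connecting_cls[OF z(1)] y z U.cls_closed by (metis imageI)
  qed
  then show ?thesis
    by (simp add: exact_at_def U.homology_nonunital K.homology_nonunital T.homology_nonunital
        connecting_hom incl.HA_map_hom)
qed

lemma exact_homology_T:
  "exact_at R (homology R K n) (HA_map R T (\<lambda>n x. x) (Suc n)) (homology R T n)
    (HA_map R U g (Suc n)) (homology R U n)"
proof -
  have "HA_map R T (\<lambda>n x. x) (Suc n) ` carrier (homology R K n) =
      a_kernel (homology R T n) (homology R U n) (HA_map R U g (Suc n))" (is "_ = ?K")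
  proof (intro equalityI subsetI)
    fix P assume "P \<in> HA_map R T (\<lambda>n x. x) (Suc n) ` carrier (homology R K n)"
    then obtain y where y: "y \<in> K.Z n" and P: "P = HA_map R T (\<lambda>n x. x) (Suc n) (K.cls n y)"
      by (auto elim: K.homology_carrierE)
    then show "P \<in> ?K"
      using incl.map_Z[OF y] unfolding a_kernel_def'
      by (simp add: incl.HA_map_cls hom.HA_map_cls T.cls_closed K_Z U.cls_zero)
  next
    fix P assume P: "P \<in> ?K"
    then have "P \<in> carrier (homology R T n)"
      by (simp add: a_kernel_def')
    then obtain x where x: "x \<in> T.Z n" "P = T.cls n x"
      by (rule T.homology_carrierE)
    then have "g n x \<in> U.B n"
      using P by (simp add: a_kernel_def' hom.HA_map_cls U.cls_zero_iff hom.map_Z)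
    then obtain w where w: "w \<in> U.N (Suc n)" "g n x = U.\<delta> (Suc n) w"
      by (auto simp: U.boundaries_eq)
    obtain z where z: "z \<in> T.N (Suc n)" "g (Suc n) z = w"
      using lift_N[OF w(1)] .
    note dz = T.diff_Z[OF z(1)]
    \<comment> \<open>Subtracting the boundary of a lift of \<open>w\<close> moves \<open>x\<close>
      into the kernel without changing its class.\<close>
    let ?y = "x \<ominus>\<^bsub>level T n\<^esub> T.\<delta> (Suc n) z"
    have y: "?y \<in> T.Z n"
      using x dz by (simp add: T.Z_rules)
    have "g n ?y = \<zero>\<^bsub>level U n\<^esub>"
      using x w z dz U.diff_closed[OF U.N_closed[OF w(1)]]
      by (simp add: hom.f.diff T.Z_closed hom.map_diff T.N_closed U.L.minus_eq_zero_iff)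
    then have yK: "?y \<in> K.Z n"
      using y by (simp add: K_Z)
    note c = T.Z_closed[OF x(1)] T.Z_closed[OF dz]
    have "x \<ominus>\<^bsub>level T n\<^esub> ?y = T.\<delta> (Suc n) z"
      using c by (simp add: T.L.M.minus_eq T.L.M.minus_add T.L.M.a_assoc[symmetric] T.L.M.r_neg)
    then have "T.cls n x = T.cls n ?y"
      using x y z by (auto simp: T.cls_eq_iff T.boundaries_eq)
    then show "P \<in> HA_map R T (\<lambda>n x. x) (Suc n) ` carrier (homology R K n)"
      using x yK incl.HA_map_cls[OF yK] K.cls_closed[OF yK] by (metis imageI)
  qed
  then show ?thesis
    by (simp add: exact_at_def U.homology_nonunital K.homology_nonunital T.homology_nonunital
        hom.HA_map_hom incl.HA_map_hom)
qed

lemma exact_homology_U: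
  "exact_at R (homology R T (Suc n)) (HA_map R U g (Suc (Suc n))) (homology R U (Suc n))
    (connecting n) (homology R K n)"
proof -
  have "HA_map R U g (Suc (Suc n)) ` carrier (homology R T (Suc n)) =
      a_kernel (homology R U (Suc n)) (homology R K n) (connecting n)" (is "_ = ?K")
  proof (intro equalityI subsetI)
    fix P assume "P \<in> HA_map R U g (Suc (Suc n)) ` carrier (homology R T (Suc n))"
    then obtain z where z: "z \<in> T.Z (Suc n)" and P: "P = U.cls (Suc n) (g (Suc n) z)"
      by (auto elim!: T.homology_carrierE simp: hom.HA_map_cls)
    have zN: "z \<in> T.N (Suc n)" and d: "T.\<delta> (Suc n) z = \<zero>\<^bsub>level T n\<^esub>"
      using z by (auto simp: T.Z_Suc_iff)
    have "connecting n P = \<zero>\<^bsub>homology R K n\<^esub>"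
      unfolding P connecting_cls[OF zN hom.map_Z[OF z]] d using K.cls_zero[of n] by simp
    then show "P \<in> ?K"
      using P z by (simp add: a_kernel_def' U.cls_closed hom.map_Z)
  next
    fix P assume P: "P \<in> ?K"
    then have "P \<in> carrier (homology R U (Suc n))"
      by (simp add: a_kernel_def')
    then obtain z where z: "z \<in> T.N (Suc n)" "g (Suc n) z \<in> U.Z (Suc n)" and Pz: "P = U.cls (Suc n) (g (Suc n) z)"
      by (rule homology_U_E)
    have "T.\<delta> (Suc n) z \<in> K.B n"
      using P diff_K_Z[OF z] by (simp add: Pz a_kernel_def' connecting_cls[OF z] K.cls_zero_iff)
    then obtain v where v: "v \<in> K.N (Suc n)" "T.\<delta> (Suc n) z = T.\<delta> (Suc n) v"
      by (auto simp: K.boundaries_eq K_diff)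
    then have vT: "v \<in> T.N (Suc n)" "g (Suc n) v = \<zero>\<^bsub>level U (Suc n)\<^esub>"
      by (auto simp: K_N)
    note c = T.N_closed[OF z(1)] T.N_closed[OF vT(1)]
    \<comment> \<open>\<open>v\<close> has the same boundary as \<open>z\<close> and image 0, so the
      difference is a cycle with the same image as \<open>z\<close>.\<close>
    let ?x = "z \<ominus>\<^bsub>level T (Suc n)\<^esub> v"
    have "?x \<in> T.N (Suc n)"
      using z vT by (simp add: T.N_rules)
    moreover have "T.\<delta> (Suc n) ?x = \<zero>\<^bsub>level T n\<^esub>"
      using v(2) c T.diff_closed[OF c(2)] by (simp add: T.diff_minus T.L.minus_eq_zero_iff)
    ultimately have x: "?x \<in> T.Z (Suc n)"
      by (simp add: T.Z_Suc_iff)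
    have "g (Suc n) ?x = g (Suc n) z"
      using c vT by (simp add: hom.f.diff U.L.minus_zero)
    then show "P \<in> HA_map R U g (Suc (Suc n)) ` carrier (homology R T (Suc n))"
      using hom.HA_map_cls[OF x] T.cls_closed[OF x] Pz by (metis imageI)
  qed
  then show ?thesis
    by (simp add: exact_at_def U.homology_nonunital K.homology_nonunital T.homology_nonunital
        hom.HA_map_hom connecting_hom)
qed

text \<open>In degree 0 every element is a cycle, so the induced map is onto. The map to the zero
  algebra is the constant \<open>undefined\<close> because that is its sole element.\<close>

lemma exact_homology_U_0:
  "exact_at R (homology R T 0) (HA_map R U g (Suc 0)) (homology R U 0) (\<lambda>_. undefined)
    (zero_algebra :: ('r, 'c) module)"
proof -
  have "HA_map R U g (Suc 0) ` carrier (homology R T 0) = carrier (homology R U 0)"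
  proof (intro equalityI subsetI)
    fix P assume "P \<in> carrier (homology R U 0)"
    then obtain z where z: "z \<in> T.N 0" and P: "P = U.cls 0 (g 0 z)"
      by (rule homology_U_E)
    have "z \<in> T.Z 0"
      using z by (simp add: T.N_0 T.Z_0)
    then show "P \<in> HA_map R U g (Suc 0) ` carrier (homology R T 0)"
      using hom.HA_map_cls[of z 0] T.cls_closed[of z 0] P by (metis imageI)
  qed (use alg_hom_closed[OF hom.HA_map_hom] in auto)
  moreover have "a_kernel (homology R U 0) (zero_algebra :: ('r, 'c) module) (\<lambda>_. undefined) = carrier (homology R U 0)"
    by (auto simp: a_kernel_def' zero_algebra_def)
  moreover have "(\<lambda>_. undefined) \<in> alg_hom R (homology R U 0) (zero_algebra :: ('r, 'c) module)"
    by (rule alg_homI) (auto simp: zero_algebra_def)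
  ultimately show ?thesis
    by (simp add: exact_at_def U.homology_nonunital T.homology_nonunital hom.HA_map_hom
        nonunital_zero_algebra T.L.R.is_cring)
qed

theorem long_exact_sequence:
  "\<exists>d. long_exact_HA R K (\<lambda>n x. x) T g U d \<and> is_connecting R K (\<lambda>n x. x) T g U d"
proof -
  \<comment> \<open>\<open>HA\<close> of index \<open>q\<close> is homology in degree
    \<open>q - 1\<close>, and \<open>d (q + 1)\<close> lands in index \<open>q\<close>; hence the
    shift by 2. At \<open>q = 1\<close> the target is the zero algebra.\<close>
  define d where "d q = (if q \<le> 1 then (\<lambda>_. undefined) else connecting (q - 2))" for q
  have dS: "d (Suc (Suc n)) = connecting n" and d1: "d (Suc 0) = (\<lambda>_. undefined)" for n
    by (simp_all add: d_def)
  have HA_Suc: "HA R S (Suc n) = homology R S n" and HA_0: "HA R S 0 = zero_algebra"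
    for S :: "('r, 'c) simp_alg" and n
    by (simp_all add: HA_def)
  have "long_exact_HA R K (\<lambda>n x. x) T g U d"
    unfolding long_exact_HA_def
  proof (intro allI impI)
    fix q :: nat assume "1 \<le> q"
    then obtain n where q: "q = Suc n"
      by (cases q) auto
    have "exact_at R (HA R T q) (HA_map R U g q) (HA R U q) (d q) (HA R K (q - 1))"
      using exact_homology_U exact_homology_U_0 by (cases n) (simp_all add: q HA_Suc HA_0 dS d1)
    then show "exact_at R (HA R U (q + 1)) (d (q + 1)) (HA R K q) (HA_map R T (\<lambda>n x. x) q) (HA R T q) \<and>
         exact_at R (HA R K q) (HA_map R T (\<lambda>n x. x) q) (HA R T q) (HA_map R U g q) (HA R U q) \<and>
         exact_at R (HA R T q) (HA_map R U g q) (HA R U q) (d q) (HA R K (q - 1))"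
      using exact_homology_K exact_homology_T by (simp add: q HA_Suc dS)
  qed
  moreover have "is_connecting R K (\<lambda>n x. x) T g U d"
    unfolding is_connecting_def
  proof (intro allI impI ballI)
    fix q z y
    assume q: "1 \<le> q" and z: "z \<in> carrier (moore T q)" "g q z \<in> carrier (cycles R U q)"
      and y: "y = moore_diff R T q z"
    obtain n where n: "q = Suc n"
      using q by (cases q) auto
    show "d (q + 1) (homology_class R U q (g q z)) = homology_class R K (q - 1) y"
      using connecting_cls[of z n] z y by (simp add: n dS T.carrier_moore U.cycles_eq)
  qed
  ultimately show ?thesis
    by blast
qed

end


section \<open>Traces\<close>

abbreviation simplex_top :: "nat \<Rightarrow> (nat \<Rightarrow> real) topology" where
  "simplex_top n \<equiv> subtopology (powertop_real UNIV) (standard_simplex n)"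

abbreviation cylinder_top :: "nat \<Rightarrow> (real \<times> (nat \<Rightarrow> real)) topology" where
  "cylinder_top i \<equiv> prod_topology (top_of_set {0..1}) (simplex_top (i - 1))"

text \<open>\<open>m\<close> and \<open>n\<close> are indices of traces, each one more than the
  dimension of its simplex.\<close>

abbreviation simplex_map :: "nat \<Rightarrow> nat \<Rightarrow> ((nat \<Rightarrow> real) \<Rightarrow> nat \<Rightarrow> real) \<Rightarrow> bool" where
  "simplex_map m n \<sigma> \<equiv> continuous_map (simplex_top (m - 1)) (simplex_top (n - 1)) \<sigma>"

lemma simplex_mapD:
  "\<lbrakk>simplex_map m n \<sigma>; t \<in> standard_simplex (m - 1)\<rbrakk> \<Longrightarrow> \<sigma> t \<in> standard_simplex (n - 1)"
  by (drule continuous_map_funspace) auto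

definition time_change :: "(real \<Rightarrow> real) \<Rightarrow> bool" where
  "time_change \<phi> \<longleftrightarrow> continuous_on {0..1} \<phi> \<and> mono_on {0..1} \<phi> \<and> \<phi> 0 = 0 \<and> \<phi> 1 = 1"

text \<open>By the intermediate value theorem, a continuous monotone map that fixes 0 and 1 is onto;
  conversely monotonicity forces the extreme values to the end points. The end point form is the one
  to verify for explicit piecewise maps.\<close>

lemma time_change_iff:
  "time_change \<phi> \<longleftrightarrow> continuous_on {0..1} \<phi> \<and> mono_on {0..1} \<phi> \<and> \<phi> ` {0..1} = {0..1}"
proof (intro iffI conjI)
  assume \<phi>: "time_change \<phi>"
  then show "continuous_on {0..1} \<phi>" "mono_on {0..1} \<phi>"
    by (auto simp: time_change_def)
  have "y \<in> \<phi> ` {0..1}" if "y \<in> {0..1}" for y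
    using IVT'[of \<phi> 0 y 1] that \<phi> by (auto simp: time_change_def)
  moreover have "\<phi> s \<in> {0..1}" if "s \<in> {0..1}" for s
    using mono_onD[of "{0..1}" \<phi> 0 s] mono_onD[of "{0..1}" \<phi> s 1] that \<phi>
    by (auto simp: time_change_def)
  ultimately show "\<phi> ` {0..1} = {0..1}"
    by blast
next
  assume \<phi>: "continuous_on {0..1} \<phi> \<and> mono_on {0..1} \<phi> \<and> \<phi> ` {0..1} = {0..1}"
  then have m: "mono_on {0..1} \<phi>" and im: "\<phi> ` {0..1} = {0..1}"
    by auto
  have "0 \<in> \<phi> ` {0..1}" "1 \<in> \<phi> ` {0..1}"
    using im by auto
  then obtain s0 s1 where s: "s0 \<in> {0..1}" "\<phi> s0 = 0" "s1 \<in> {0..1}" "\<phi> s1 = 1"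
    by auto
  have "\<phi> 0 \<in> {0..1}" "\<phi> 1 \<in> {0..1}"
    using im by auto
  moreover have "\<phi> 0 \<le> \<phi> s0" "\<phi> s1 \<le> \<phi> 1"
    by (rule mono_onD[OF m]; use s in simp)+
  ultimately show "time_change \<phi>"
    using \<phi> s by (auto simp: time_change_def)
qed

lemma time_change_range: "time_change \<phi> \<Longrightarrow> s \<in> {0..1} \<Longrightarrow> \<phi> s \<in> {0..1}"
  unfolding time_change_iff by blast

text \<open>Time and simplex are changed together, so that reparametrizations, faces and
  degeneracies are special cases of one operation.\<close>

definition pull :: "nat \<Rightarrow> (real \<Rightarrow> real) \<Rightarrow> ((nat \<Rightarrow> real) \<Rightarrow> nat \<Rightarrow> real) \<Rightarrow>
    (real \<times> (nat \<Rightarrow> real) \<Rightarrow> 'a) \<Rightarrow> real \<times> (nat \<Rightarrow> real) \<Rightarrow> 'a" where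
  "pull m \<phi> \<sigma> p = (\<lambda>(s, t)\<in>cylinder m. p (\<phi> s, \<sigma> t))"

lemma pull_apply: "\<lbrakk>s \<in> {0..1}; t \<in> standard_simplex (m - 1)\<rbrakk> \<Longrightarrow> pull m \<phi> \<sigma> p (s, t) = p (\<phi> s, \<sigma> t)"
  by (simp add: pull_def cylinder_def)

lemma cylinder_fun_eqI:
  assumes "p \<in> extensional (cylinder i)" "q \<in> extensional (cylinder i)"
    "\<And>s t. \<lbrakk>s \<in> {0..1}; t \<in> standard_simplex (i - 1)\<rbrakk> \<Longrightarrow> p (s, t) = q (s, t)"
  shows "p = q"
  using assms by (intro extensionalityI[of p "cylinder i" q]) (auto simp: cylinder_def)

lemma pull_extensional: "pull m \<phi> \<sigma> p \<in> extensional (cylinder m)"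
  by (simp add: pull_def)

lemma reparam_iff:
  "(p, q) \<in> reparam i X \<longleftrightarrow> p \<in> ipaths i X \<and> (\<exists>\<phi>. time_change \<phi> \<and> q = pull i \<phi> (\<lambda>t. t) p)"
  by (auto simp: reparam_def time_change_iff pull_def)

locale dspace =
  fixes X :: "'a dspace"
  assumes dspace: "is_dspace X"
begin

lemma dpath_reparam:
  "\<lbrakk>p \<in> dpaths X; continuous_on {0..1} \<phi>; mono_on {0..1} \<phi>; \<phi> ` {0..1} \<subseteq> {0..1}\<rbrakk> \<Longrightarrow>
    (\<lambda>s\<in>{0..1}. p (\<phi> s)) \<in> dpaths X"
  using dspace by (auto simp: is_dspace_def)

lemma dpath_concat: "\<lbrakk>p \<in> dpaths X; q \<in> dpaths X; p 1 = q 0\<rbrakk> \<Longrightarrow> path_concat p q \<in> dpaths X"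
  using dspace by (auto simp: is_dspace_def)

lemma pull_ipath:
  assumes p: "p \<in> ipaths n X" and \<phi>: "time_change \<phi>"
    and \<sigma>: "simplex_map m n \<sigma>"
  shows "pull m \<phi> \<sigma> p \<in> ipaths m X"
proof -
  note \<sigma>' = simplex_mapD[OF \<sigma>]
  have "continuous_map (top_of_set {0..1}) (top_of_set {0..1}) \<phi>"
    using \<phi> time_change_range by (auto simp: time_change_def continuous_map_in_subtopology)
  with \<sigma> have "continuous_map (cylinder_top m) (cylinder_top n) (\<lambda>(s, t). (\<phi> s, \<sigma> t))"
    by (simp add: continuous_map_prod_top)
  moreover have "continuous_map (cylinder_top n) (dtop X) p"
    using p by (simp add: ipaths_def)
  ultimately have "continuous_map (cylinder_top m) (dtop X) (p \<circ> (\<lambda>(s, t). (\<phi> s, \<sigma> t)))"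
    by (rule continuous_map_compose)
  then have "continuous_map (cylinder_top m) (dtop X) (pull m \<phi> \<sigma> p)"
    by (rule continuous_map_eq) (auto simp: pull_apply)
  moreover have "(\<lambda>s\<in>{0..1}. pull m \<phi> \<sigma> p (s, t)) \<in> dpaths X" if t: "t \<in> standard_simplex (m - 1)" for t
  proof -
    have "(\<lambda>s\<in>{0..1}. p (s, \<sigma> t)) \<in> dpaths X"
      using p \<sigma>'[OF t] by (simp add: ipaths_def)
    then have "(\<lambda>s\<in>{0..1}. (\<lambda>s\<in>{0..1}. p (s, \<sigma> t)) (\<phi> s)) \<in> dpaths X"
      by (rule dpath_reparam) (use \<phi> in \<open>auto simp: time_change_iff\<close>)
    moreover have "(\<lambda>s\<in>{0..1}. (\<lambda>s\<in>{0..1}. p (s, \<sigma> t)) (\<phi> s)) = (\<lambda>s\<in>{0..1}. pull m \<phi> \<sigma> p (s, t))"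
      using t time_change_range[OF \<phi>] by (intro restrict_ext) (simp add: pull_apply)
    ultimately show ?thesis by simp
  qed
  ultimately show ?thesis
    by (simp add: ipaths_def pull_extensional)
qed

lemma pull_between:
  assumes p: "p \<in> ipaths_between n X a b" and \<phi>: "time_change \<phi>"
    and \<sigma>: "simplex_map m n \<sigma>"
  shows "pull m \<phi> \<sigma> p \<in> ipaths_between m X a b"
proof -
  note \<sigma>' = simplex_mapD[OF \<sigma>]
  have "p \<in> ipaths n X"
    using p by (simp add: ipaths_between_def)
  then have "pull m \<phi> \<sigma> p \<in> ipaths m X"
    using \<phi> \<sigma> by (rule pull_ipath)
  then show ?thesis
    using p \<phi> \<sigma>' by (auto simp: ipaths_between_def pull_apply time_change_def)
qed

end

lemma time_change_id: "time_change (\<lambda>s. s)"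
  by (auto simp: time_change_def mono_on_def)

lemma trace_of_self: "p \<in> trace_of i X p"
  by (simp add: trace_of_def)

lemma trace_of_eq: "q \<in> trace_of i X p \<Longrightarrow> trace_of i X q = trace_of i X p"
proof -
  let ?E = "(reparam i X \<union> (reparam i X)\<inverse>)\<^sup>*"
  assume "q \<in> trace_of i X p"
  then have 1: "(p, q) \<in> ?E"
    by (simp add: trace_of_def)
  have "sym ?E"
    by (intro sym_rtrancl sym_Un_converse)
  then have 2: "(q, p) \<in> ?E"
    using 1 by (auto dest: symD)
  show ?thesis
    unfolding trace_of_def using rtrancl_trans[OF 1] rtrancl_trans[OF 2] by blast
qed

lemma trace_of_reparam: "(p, q) \<in> reparam i X \<Longrightarrow> trace_of i X q = trace_of i X p"
  by (rule trace_of_eq) (auto simp: trace_of_def)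

context dspace
begin

lemma reparam_between: "(p, q) \<in> reparam i X \<Longrightarrow> q \<in> ipaths_between i X a b \<longleftrightarrow> p \<in> ipaths_between i X a b"
proof -
  assume pq: "(p, q) \<in> reparam i X"
  then obtain \<phi> where \<phi>: "time_change \<phi>" "q = pull i \<phi> (\<lambda>t. t) p" and p: "p \<in> ipaths i X"
    by (auto simp: reparam_iff)
  have "q \<in> ipaths i X"
    unfolding \<phi>(2) by (rule pull_ipath[OF p \<phi>(1)]) simp
  then show ?thesis
    using p \<phi> by (auto simp: ipaths_between_def pull_apply time_change_def)
qed

text \<open>A trace is a class under zigzags of reparametrizations. The end points are carried along
  the zigzag because \<open>F\<close> is only known to be invariant on paths from \<open>a\<close>
  to \<open>b\<close>; backward steps need \<open>reparam_between\<close> as an equivalence.\<close>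

lemma trace_of_invariant:
  assumes p: "p \<in> ipaths_between i X a b" and q: "q \<in> trace_of i X p"
    and F: "\<And>p q. \<lbrakk>p \<in> ipaths_between i X a b; (p, q) \<in> reparam i X\<rbrakk> \<Longrightarrow> F q = F p"
  shows "q \<in> ipaths_between i X a b \<and> F q = F p"
proof -
  have "(p, q) \<in> (reparam i X \<union> (reparam i X)\<inverse>)\<^sup>*"
    using q by (simp add: trace_of_def)
  then show ?thesis
  proof (induction rule: rtrancl_induct)
    case base
    then show ?case using p by simp
  next
    case (step r s)
    then consider "(r, s) \<in> reparam i X" | "(s, r) \<in> reparam i X" by blast
    then show ?case
    proof cases
      case 1
      then show ?thesis
        using F[of r s] reparam_between[of r s i a b] step.IH by simp
    next
      case 2
      then have "s \<in> ipaths_between i X a b"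
        using reparam_between[of s r i a b] step.IH by simp
      then show ?thesis
        using F[of s r] 2 step.IH by simp
    qed
  qed
qed

text \<open>The counterpart of \<open>coset_Union_const\<close> for traces: it makes an operation on
  traces computable on one representative.\<close>

lemma trace_of_Union:
  assumes "p \<in> ipaths_between i X a b"
    and "\<And>p q. \<lbrakk>p \<in> ipaths_between i X a b; (p, q) \<in> reparam i X\<rbrakk> \<Longrightarrow> F q = F p"
  shows "(\<Union>q\<in>trace_of i X p. F q) = F p"
proof -
  have "F q = F p" if "q \<in> trace_of i X p" for q
    using trace_of_invariant[OF assms(1) that, of F] assms(2) by blast
  then show ?thesis
    using trace_of_self[of p i X] by blast
qed

lemma traces_betweenE:
  assumes "P \<in> traces_between i X a b"
  obtains p where "p \<in> ipaths_between i X a b" "P = trace_of i X p"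
  using assms by (auto simp: traces_between_def)

text \<open>Reparametrization preserves both ends and the simplex is non-empty, so a trace
  determines its end points. Composability thereby becomes a comparison of two points.\<close>

lemma traces_between_unique:
  assumes "P \<in> traces_between i X a b" "P \<in> traces_between i X a' b'"
  shows "a = a'" "b = b'"
proof -
  obtain p where p: "p \<in> ipaths_between i X a b" "P = trace_of i X p"
    using assms(1) by (rule traces_betweenE)
  obtain q where q: "q \<in> ipaths_between i X a' b'" "P = trace_of i X q"
    using assms(2) by (rule traces_betweenE)
  have "q \<in> trace_of i X p"
    using p q trace_of_self by metis
  then have "q \<in> ipaths_between i X a b"
    using trace_of_invariant[OF p(1), of q "\<lambda>_. ()"] by simp
  moreover obtain t where "t \<in> standard_simplex (i - 1)"
    using nonempty_standard_simplex by blast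
  ultimately show "a = a'" "b = b'"
    using q(1) by (auto simp: ipaths_between_def)
qed

lemma between_topspace:
  assumes "p \<in> ipaths_between i X a b"
  shows "a \<in> topspace (dtop X)" "b \<in> topspace (dtop X)"
proof -
  obtain t where t: "t \<in> standard_simplex (i - 1)"
    using nonempty_standard_simplex by blast
  have "continuous_map (cylinder_top i) (dtop X) p"
    using assms by (simp add: ipaths_between_def ipaths_def)
  then have "p (s, t) \<in> topspace (dtop X)" if "s \<in> {0..1}" for s
    using that t by (auto dest!: continuous_map_funspace)
  from this[of 0] this[of 1] show "a \<in> topspace (dtop X)" "b \<in> topspace (dtop X)"
    using assms t by (auto simp: ipaths_between_def)
qed

lemma traces_iff: "P \<in> traces i X \<longleftrightarrow> (\<exists>a b. P \<in> traces_between i X a b)"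
  by (auto simp: traces_def traces_between_def dest: between_topspace)

lemma composable_iff:
  "\<lbrakk>P \<in> traces_between i X a b; Q \<in> traces_between i X b' c\<rbrakk> \<Longrightarrow> composable i X P Q \<longleftrightarrow> b = b'"
  unfolding composable_def by (metis traces_between_unique)


section \<open>Concatenation of traces\<close>

lemma ipath_concat_apply: "\<lbrakk>s \<in> {0..1}; t \<in> standard_simplex (i - 1)\<rbrakk> \<Longrightarrow>
    ipath_concat i p q (s, t) = (if s \<le> 1/2 then p (2 * s, t) else q (2 * s - 1, t))"
  by (simp add: ipath_concat_def cylinder_def)

lemma ipath_concat_extensional: "ipath_concat i p q \<in> extensional (cylinder i)"
  by (simp add: ipath_concat_def)

lemma ipath_concat_between:
  assumes p: "p \<in> ipaths_between i X a b" and q: "q \<in> ipaths_between i X b c"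
  shows "ipath_concat i p q \<in> ipaths_between i X a c"
proof -
  let ?T = "cylinder_top i"
  have pc: "continuous_map ?T (dtop X) p" and qc: "continuous_map ?T (dtop X) q"
    using p q by (auto simp: ipaths_between_def ipaths_def)
  have fst: "continuous_map ?T euclideanreal fst"
    using continuous_map_fst[of "top_of_set {0..1::real}" "simplex_top (i - 1)"]
    by (simp add: continuous_map_in_subtopology)
  have half: "continuous_map ?T euclideanreal (\<lambda>x. c * fst x - d)" for c d :: real
    by (intro continuous_map_diff continuous_map_real_mult fst) auto
  \<comment> \<open>Both halves of a concatenation rescale time affinely; the condition on
    \<open>S\<close> keeps the rescaled time inside the unit interval.\<close>
  have piece: "continuous_map (subtopology ?T S) ?T (\<lambda>x. (c * fst x - d, snd x))"
    if "\<And>s t. (s, t) \<in> S \<Longrightarrow> s \<in> {0..1} \<Longrightarrow> d \<le> c * s \<and> c * s - d \<le> 1" for S and c d :: real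
  proof (subst continuous_map_paired, intro conjI)
    show "continuous_map (subtopology ?T S) (top_of_set {0..1}) (\<lambda>x. c * fst x - d)"
      unfolding continuous_map_in_subtopology
      using that by (intro conjI continuous_map_from_subtopology half) auto
    show "continuous_map (subtopology ?T S) (simplex_top (i - 1)) snd"
      by (intro continuous_map_from_subtopology continuous_map_snd)
  qed
  \<comment> \<open>The first half is written with \<open>- 0\<close> to fit \<open>piece\<close>.
    The halves agree at time 1/2 because the end of \<open>p\<close> and the start of
    \<open>q\<close> are the same constant point \<open>b\<close>.\<close>
  have "continuous_map ?T (dtop X) (\<lambda>x. if fst x \<le> 1/2 then p (2 * fst x - 0, snd x) else q (2 * fst x - 1, snd x))"
  proof (rule continuous_map_cases_le[OF fst])
    show "continuous_map (subtopology ?T {x \<in> topspace ?T. fst x \<le> 1/2}) (dtop X) (\<lambda>x. p (2 * fst x - 0, snd x))"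
      by (rule continuous_map_compose[OF piece pc, unfolded o_def]) auto
    show "continuous_map (subtopology ?T {x \<in> topspace ?T. 1/2 \<le> fst x}) (dtop X) (\<lambda>x. q (2 * fst x - 1, snd x))"
      by (rule continuous_map_compose[OF piece qc, unfolded o_def]) auto
    fix x :: "real \<times> (nat \<Rightarrow> real)" assume "x \<in> topspace ?T" "fst x = 1/2"
    then have x: "x = (1/2, snd x)" "snd x \<in> standard_simplex (i - 1)"
      by (auto simp: prod_eq_iff)
    have "p (1, snd x) = b" "q (0, snd x) = b"
      using p q x(2) by (auto simp: ipaths_between_def)
    moreover have "2 * fst x - 0 = 1" "2 * fst x - 1 = 0"
      using \<open>fst x = 1/2\<close> by auto
    ultimately show "p (2 * fst x - 0, snd x) = q (2 * fst x - 1, snd x)"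
      by metis
  qed simp
  then have cont: "continuous_map ?T (dtop X) (ipath_concat i p q)"
    by (rule continuous_map_eq) (auto simp: ipath_concat_apply)
  have "(\<lambda>s\<in>{0..1}. ipath_concat i p q (s, t)) \<in> dpaths X" if t: "t \<in> standard_simplex (i - 1)" for t
  proof -
    have "(\<lambda>s\<in>{0..1}. ipath_concat i p q (s, t)) =
        path_concat (\<lambda>s\<in>{0..1}. p (s, t)) (\<lambda>s\<in>{0..1}. q (s, t))"
      unfolding path_concat_def using t by (intro restrict_ext) (auto simp: ipath_concat_apply)
    moreover have "path_concat (\<lambda>s\<in>{0..1}. p (s, t)) (\<lambda>s\<in>{0..1}. q (s, t)) \<in> dpaths X"
      by (rule dpath_concat) (use p q t in \<open>auto simp: ipaths_between_def ipaths_def\<close>)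
    ultimately show ?thesis by simp
  qed
  with cont show ?thesis
    using p q by (auto simp: ipaths_between_def ipaths_def ipath_concat_extensional ipath_concat_apply)
qed

lemma trace_of_pull:
  assumes "p \<in> ipaths_between i X a b" "time_change \<phi>" "q = pull i \<phi> (\<lambda>t. t) p"
  shows "trace_of i X q = trace_of i X p"
  by (rule trace_of_reparam) (use assms in \<open>auto simp: reparam_iff ipaths_between_def\<close>)

text \<open>Both factors change at once. Combined with \<open>reparam_refl\<close> for one of them,
  this gives invariance in each argument separately.\<close>

lemma trace_of_concat_reparam:
  assumes p: "p \<in> ipaths_between i X a b" and q: "q \<in> ipaths_between i X b c"
    and p': "(p, p') \<in> reparam i X" and q': "(q, q') \<in> reparam i X"
  shows "trace_of i X (ipath_concat i p' q') = trace_of i X (ipath_concat i p q)"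
proof -
  obtain \<phi> where \<phi>: "time_change \<phi>" "p' = pull i \<phi> (\<lambda>t. t) p"
    using p' by (auto simp: reparam_iff)
  obtain \<psi> where \<psi>: "time_change \<psi>" "q' = pull i \<psi> (\<lambda>t. t) q"
    using q' by (auto simp: reparam_iff)
  \<comment> \<open>The two time changes side by side, \<open>\<phi>\<close> squeezed into the first
    half of the interval and \<open>\<psi>\<close> into the second. They meet at 1/2 since
    \<open>\<phi>\<close> ends at 1 and \<open>\<psi>\<close> starts at 0.\<close>
  let ?\<phi> = "\<lambda>s. if s \<le> 1/2 then \<phi> (2 * s) / 2 else (1 + \<psi> (2 * s - 1)) / 2"
  note c = \<phi>(1)[unfolded time_change_def] \<psi>(1)[unfolded time_change_def]
  note r = time_change_range[OF \<phi>(1)] time_change_range[OF \<psi>(1)]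
  have e: "\<phi> (2 * s) = 1 \<and> \<psi> (2 * s - 1) = 0" if "s * 2 = 1" for s
    using c that by (simp add: mult.commute)
  have "continuous_on ({0..1/2} \<union> {1/2..1}) ?\<phi>"
    by (rule continuous_on_If) (use c in \<open>auto simp: e intro!: continuous_intros
        intro: continuous_on_compose2[of "{0..1}" \<phi>] continuous_on_compose2[of "{0..1}" \<psi>]\<close>)
  moreover have "{0..1/2} \<union> {1/2..1} = {0..1 :: real}"
    by auto
  moreover have "mono_on {0..1} ?\<phi>"
  proof (rule mono_onI)
    fix x y :: real assume xy: "x \<in> {0..1}" "y \<in> {0..1}" "x \<le> y"
    consider "y \<le> 1/2" | "x \<le> 1/2" "1/2 < y" | "1/2 < x"
      by linarith
    then show "?\<phi> x \<le> ?\<phi> y"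
    proof cases
      case 2
      then show ?thesis
        using xy r(1)[of "2 * x"] r(2)[of "2 * y - 1"] by auto
    qed (use xy c in \<open>auto intro!: mono_onD[of "{0..1}" \<phi>] mono_onD[of "{0..1}" \<psi>]\<close>)
  qed
  ultimately have "time_change ?\<phi>"
    using c by (simp add: time_change_def)
  moreover have "ipath_concat i p' q' = pull i ?\<phi> (\<lambda>t. t) (ipath_concat i p q)"
  proof (rule cylinder_fun_eqI[OF ipath_concat_extensional pull_extensional])
    fix s t assume s: "s \<in> {0..1 :: real}" and t: "t \<in> standard_simplex (i - 1)"
    have b: "p (1, t) = b" "q (0, t) = b"
      using p q t by (auto simp: ipaths_between_def)
    have half: "(1 + y) / 2 \<le> 1 / 2 \<longleftrightarrow> y \<le> 0" "(2 + 2 * y) / 2 - 1 = y" for y :: real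
      by (auto simp: field_simps)
    show "ipath_concat i p' q' (s, t) = pull i ?\<phi> (\<lambda>t. t) (ipath_concat i p q) (s, t)"
    proof (cases "s \<le> 1/2")
      case True
      then show ?thesis
        using s t r(1)[of "2 * s"] by (auto simp: ipath_concat_apply pull_apply \<phi>(2))
    next
      case False
      then have "\<psi> (2 * s - 1) \<in> {0..1}"
        using s r(2)[of "2 * s - 1"] by auto
      \<comment> \<open>While \<open>\<psi>\<close> is still 0, the new time is exactly 1/2 and the
        concatenation takes its first branch; there \<open>p\<close> at 1 and \<open>q\<close> at 0
        are both \<open>b\<close>.\<close>
      then show ?thesis
        using False s t b
        by (cases "\<psi> (2 * s - 1) = 0") (auto simp: ipath_concat_apply pull_apply \<psi>(2) half)
    qed
  qed
  ultimately show ?thesis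
    by (rule trace_of_pull[OF ipath_concat_between[OF p q]])
qed

lemma reparam_refl: "p \<in> ipaths_between i X a b \<Longrightarrow> (p, p) \<in> reparam i X"
  unfolding reparam_iff
  by (auto simp: ipaths_between_def ipaths_def pull_apply intro!: exI[of _ "\<lambda>s. s"] time_change_id
      cylinder_fun_eqI[OF _ pull_extensional])

lemma trace_concat_trace_of:
  assumes p: "p \<in> ipaths_between i X a b" and q: "q \<in> ipaths_between i X b c"
  shows "trace_concat i X (trace_of i X p) (trace_of i X q) = trace_of i X (ipath_concat i p q)"
proof -
  have "(\<Union>q'\<in>trace_of i X q. trace_of i X (ipath_concat i p' q')) = trace_of i X (ipath_concat i p' q)"
    if "p' \<in> ipaths_between i X a b" for p'
    by (rule trace_of_Union[OF q]) (rule trace_of_concat_reparam[OF that _ reparam_refl[OF that]])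
  moreover have "p' \<in> ipaths_between i X a b" if "p' \<in> trace_of i X p" for p'
    using trace_of_invariant[OF p that, of "\<lambda>_. ()"] by simp
  ultimately have "trace_concat i X (trace_of i X p) (trace_of i X q) =
      (\<Union>p'\<in>trace_of i X p. trace_of i X (ipath_concat i p' q))"
    by (simp add: trace_concat_def)
  also have "\<dots> = trace_of i X (ipath_concat i p q)"
    by (rule trace_of_Union[OF p]) (rule trace_of_concat_reparam[OF _ q _ reparam_refl[OF q]])
  finally show ?thesis .
qed

lemma trace_concat_between:
  assumes "P \<in> traces_between i X a b" "Q \<in> traces_between i X b c"
  shows "trace_concat i X P Q \<in> traces_between i X a c"
  using assms by (auto elim!: traces_betweenE simp: trace_concat_trace_of)
    (auto simp: traces_between_def intro: ipath_concat_between)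

text \<open>The time change by \<open>max (s/2) (s - 1/4) (2 s - 1)\<close> rebrackets a triple concatenation.\<close>

lemma trace_concat_assoc:
  assumes "P \<in> traces_between i X a b" "Q \<in> traces_between i X b c" "W \<in> traces_between i X c d"
  shows "trace_concat i X (trace_concat i X P Q) W = trace_concat i X P (trace_concat i X Q W)"
proof -
  obtain p where p: "p \<in> ipaths_between i X a b" "P = trace_of i X p"
    using assms(1) by (rule traces_betweenE)
  obtain q where q: "q \<in> ipaths_between i X b c" "Q = trace_of i X q"
    using assms(2) by (rule traces_betweenE)
  obtain w where w: "w \<in> ipaths_between i X c d" "W = trace_of i X w"
    using assms(3) by (rule traces_betweenE)
  note pq = ipath_concat_between[OF p(1) q(1)] and qw = ipath_concat_between[OF q(1) w(1)]
  let ?\<phi> = "\<lambda>s :: real. max (max (s / 2) (s - 1/4)) (2 * s - 1)"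
  have "mono_on {0..1} ?\<phi>"
    by (rule mono_onI) (intro max.mono; simp)
  then have \<phi>: "time_change ?\<phi>"
    by (auto simp: time_change_def intro!: continuous_intros)
  have "ipath_concat i p (ipath_concat i q w) = pull i ?\<phi> (\<lambda>t. t) (ipath_concat i (ipath_concat i p q) w)"
  proof (rule cylinder_fun_eqI[OF ipath_concat_extensional pull_extensional])
    fix s t assume s: "s \<in> {0..1 :: real}" and t: "t \<in> standard_simplex (i - 1)"
    have r: "?\<phi> s \<in> {0..1}"
      using time_change_range[OF \<phi> s] .
    consider "s \<le> 1/2" | "1/2 < s" "s \<le> 3/4" | "3/4 < s" by linarith
    then show "ipath_concat i p (ipath_concat i q w) (s, t) =
        pull i ?\<phi> (\<lambda>t. t) (ipath_concat i (ipath_concat i p q) w) (s, t)"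
    proof cases
      case 1
      then have "?\<phi> s = s / 2" by auto
      with 1 r s t show ?thesis
        by (simp add: ipath_concat_apply pull_apply)
    next
      case 2
      then have "?\<phi> s = s - 1/4" by auto
      with 2 r s t show ?thesis
        by (simp add: ipath_concat_apply pull_apply algebra_simps)
    next
      case 3
      then have "?\<phi> s = 2 * s - 1" by auto
      with 3 r s t show ?thesis
        by (simp add: ipath_concat_apply pull_apply algebra_simps)
    qed
  qed
  then have "trace_of i X (ipath_concat i p (ipath_concat i q w)) =
      trace_of i X (ipath_concat i (ipath_concat i p q) w)"
    by (rule trace_of_pull[OF ipath_concat_between[OF pq w(1)] \<phi>])
  then show ?thesis
    using p q w pq qw by (simp add: trace_concat_trace_of)
qed


section \<open>Faces, degeneracies and d-maps on traces\<close>

text \<open>Faces and degeneracies are both precomposition with a map of simplices. Treating them as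
  one contravariant operation turns the simplicial identities into identities between maps of
  simplices.\<close>

definition trace_pull :: "nat \<Rightarrow> ((nat \<Rightarrow> real) \<Rightarrow> nat \<Rightarrow> real) \<Rightarrow>
    (real \<times> (nat \<Rightarrow> real) \<Rightarrow> 'a) set \<Rightarrow> (real \<times> (nat \<Rightarrow> real) \<Rightarrow> 'a) set" where
  "trace_pull m \<sigma> P = (\<Union>p\<in>P. trace_of m X (pull m (\<lambda>s. s) \<sigma> p))"

lemma trace_face_eq_pull: "trace_face i j X = trace_pull i (simplical_face j)"
  by (rule ext) (simp add: trace_face_def trace_pull_def pull_def)

lemma trace_degen_eq_pull: "trace_degen i k X = trace_pull (i + 1) (simplex_degen k)"
  by (rule ext) (simp add: trace_degen_def trace_pull_def pull_def)

text \<open>A change of time and a map of simplices act on different factors of the cylinder and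
  therefore commute.\<close>

lemma trace_pull_trace_of:
  assumes p: "p \<in> ipaths_between n X a b"
    and \<sigma>: "simplex_map m n \<sigma>"
  shows "trace_pull m \<sigma> (trace_of n X p) = trace_of m X (pull m (\<lambda>s. s) \<sigma> p)"
  unfolding trace_pull_def
proof (rule trace_of_Union[OF p])
  fix p q assume p: "p \<in> ipaths_between n X a b" and pq: "(p, q) \<in> reparam n X"
  note \<sigma>' = simplex_mapD[OF \<sigma>]
  obtain \<phi> where \<phi>: "time_change \<phi>" "q = pull n \<phi> (\<lambda>t. t) p"
    using pq by (auto simp: reparam_iff)
  have "pull m (\<lambda>s. s) \<sigma> q = pull m \<phi> (\<lambda>t. t) (pull m (\<lambda>s. s) \<sigma> p)"
    using \<sigma>' time_change_range[OF \<phi>(1)]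
    by (intro cylinder_fun_eqI[OF pull_extensional pull_extensional]) (simp add: pull_apply \<phi>(2))
  then show "trace_of m X (pull m (\<lambda>s. s) \<sigma> q) = trace_of m X (pull m (\<lambda>s. s) \<sigma> p)"
    by (rule trace_of_pull[OF pull_between[OF p time_change_id \<sigma>] \<phi>(1)])
qed

lemma trace_pull_between:
  assumes "P \<in> traces_between n X a b"
    and \<sigma>: "simplex_map m n \<sigma>"
  shows "trace_pull m \<sigma> P \<in> traces_between m X a b"
  using assms(1)
  by (auto elim!: traces_betweenE simp: trace_pull_trace_of[OF _ \<sigma>])
    (auto simp: traces_between_def intro: pull_between time_change_id \<sigma>)

lemma trace_pull_closed:
  "\<lbrakk>P \<in> traces n X; continuous_map (simplex_top (m - 1)) (simplex_top (n - 1)) \<sigma>\<rbrakk> \<Longrightarrow>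
    trace_pull m \<sigma> P \<in> traces m X"
  unfolding traces_iff using trace_pull_between by blast

lemma trace_pull_concat:
  assumes "P \<in> traces_between n X a b" "Q \<in> traces_between n X b c"
    and \<sigma>: "simplex_map m n \<sigma>"
  shows "trace_pull m \<sigma> (trace_concat n X P Q) = trace_concat m X (trace_pull m \<sigma> P) (trace_pull m \<sigma> Q)"
proof -
  obtain p where p: "p \<in> ipaths_between n X a b" "P = trace_of n X p"
    using assms(1) by (rule traces_betweenE)
  obtain q where q: "q \<in> ipaths_between n X b c" "Q = trace_of n X q"
    using assms(2) by (rule traces_betweenE)
  note \<sigma>' = simplex_mapD[OF \<sigma>]
  have "pull m (\<lambda>s. s) \<sigma> (ipath_concat n p q) =
      ipath_concat m (pull m (\<lambda>s. s) \<sigma> p) (pull m (\<lambda>s. s) \<sigma> q)"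
    using \<sigma>' by (intro cylinder_fun_eqI[OF pull_extensional ipath_concat_extensional])
      (auto simp: pull_apply ipath_concat_apply)
  then show ?thesis
    using p q pull_between[OF p(1) time_change_id \<sigma>] pull_between[OF q(1) time_change_id \<sigma>]
    by (simp add: trace_concat_trace_of trace_pull_trace_of[OF _ \<sigma>]
        trace_pull_trace_of[OF ipath_concat_between[OF p(1) q(1)] \<sigma>])
qed

lemma trace_pull_pull:
  assumes "P \<in> traces n X"
    and \<sigma>: "simplex_map m n \<sigma>"
    and \<tau>: "simplex_map l m \<tau>"
  shows "trace_pull l \<tau> (trace_pull m \<sigma> P) = trace_pull l (\<lambda>t. \<sigma> (\<tau> t)) P"
proof -
  obtain a b p where p: "p \<in> ipaths_between n X a b" "P = trace_of n X p"
    using assms(1) by (auto simp: traces_iff elim!: traces_betweenE)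
  note \<tau>' = simplex_mapD[OF \<tau>]
  have \<sigma>\<tau>: "simplex_map l n (\<lambda>t. \<sigma> (\<tau> t))"
    using continuous_map_compose[OF \<tau> \<sigma>] by (simp add: o_def)
  have "pull l (\<lambda>s. s) \<tau> (pull m (\<lambda>s. s) \<sigma> p) = pull l (\<lambda>s. s) (\<lambda>t. \<sigma> (\<tau> t)) p"
    using \<tau>' by (intro cylinder_fun_eqI[OF pull_extensional pull_extensional]) (simp add: pull_apply)
  then show ?thesis
    using p pull_between[OF p(1) time_change_id \<sigma>]
    by (simp add: trace_pull_trace_of[OF _ \<sigma>] trace_pull_trace_of[OF _ \<tau>] trace_pull_trace_of[OF _ \<sigma>\<tau>])
qed

lemma trace_pull_id:
  assumes "P \<in> traces n X"
  shows "trace_pull n (\<lambda>t. t) P = P"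
proof -
  obtain a b p where p: "p \<in> ipaths_between n X a b" "P = trace_of n X p"
    using assms(1) by (auto simp: traces_iff elim!: traces_betweenE)
  have "p \<in> extensional (cylinder n)"
    using p by (simp add: ipaths_between_def ipaths_def)
  then have "pull n (\<lambda>s. s) (\<lambda>t. t) p = p"
    by (intro cylinder_fun_eqI[OF pull_extensional]) (auto simp: pull_apply)
  then show ?thesis
    using p by (simp add: trace_pull_trace_of)
qed

end

section \<open>Face and degeneracy maps between simplices\<close>

lemma continuous_simplical_face:
  assumes "1 \<le> n" "k \<le> n"
  shows "continuous_map (simplex_top (n - 1)) (simplex_top n) (simplical_face k)"
proof -
  have "continuous_map (powertop_real UNIV) euclideanreal (\<lambda>x. if i < k then x i else if i = k then 0 else x (i - 1))" for i
    by (auto intro: continuous_map_product_projection)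
  then have "continuous_map (simplex_top (n - 1)) euclideanreal (\<lambda>x. simplical_face k x i)" for i
    by (simp add: simplical_face_def continuous_map_from_subtopology)
  then show ?thesis
    using simplical_face_in_standard_simplex[OF assms]
    by (auto simp: continuous_map_in_subtopology continuous_map_componentwise_UNIV)
qed

lemma simplex_degen_in_standard_simplex:
  assumes "k \<le> n" "t \<in> standard_simplex (n + 1)"
  shows "simplex_degen k t \<in> standard_simplex n"
proof -
  have t: "0 \<le> t i" "i > n + 1 \<Longrightarrow> t i = 0" "sum t {..n + 1} = 1" for i
    using assms(2) by (auto simp: standard_simplex_def)
  have nonneg: "0 \<le> simplex_degen k t i" for i
    using t(1) by (simp add: simplex_degen_def)
  \<comment> \<open>The induction starts at \<open>n = k\<close>, where the merged entry is the last
    one; every further entry is merely shifted by one place.\<close>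
  have eq: "sum (simplex_degen k t) {..n} = sum t {..n + 1}"
    using assms(1)
  proof (induction n rule: dec_induct)
    case base
    have "sum (simplex_degen k t) {..<k} = sum t {..<k}"
      by (rule sum.cong) (auto simp: simplex_degen_def)
    then show ?case
      by (simp add: lessThan_Suc_atMost[symmetric] simplex_degen_def)
  next
    case (step n)
    then show ?case
      by (simp add: simplex_degen_def)
  qed
  have zero: "simplex_degen k t i = 0" if "i > n" for i
    using that assms(1) t(2) by (simp add: simplex_degen_def)
  have "simplex_degen k t i \<le> 1" for i
  proof (cases "i \<le> n")
    case True
    then have "simplex_degen k t i \<le> sum (simplex_degen k t) {..n}"
      using nonneg by (intro member_le_sum) auto
    then show ?thesis
      using eq t(3) by simp
  qed (use zero in simp)
  with nonneg zero eq t(3) show ?thesis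
    by (simp add: standard_simplex_def)
qed

lemma continuous_simplex_degen:
  assumes "k \<le> n"
  shows "continuous_map (simplex_top (n + 1)) (simplex_top n) (simplex_degen k)"
proof -
  have proj: "continuous_map (powertop_real UNIV) euclideanreal (\<lambda>x. x i)" for i :: nat
    by (auto intro: continuous_map_product_projection)
  have "continuous_map (powertop_real UNIV) euclideanreal
      (\<lambda>x. if i < k then x i else if i = k then x k + x (k + 1) else x (i + 1))" for i
    using proj[of i] proj[of "i + 1"] continuous_map_add[OF proj[of k] proj[of "k + 1"]] by simp
  then have "continuous_map (simplex_top (n + 1)) euclideanreal (\<lambda>x. simplex_degen k x i)" for i
    by (simp add: simplex_degen_def continuous_map_from_subtopology)
  then show ?thesis
    using simplex_degen_in_standard_simplex[OF assms]
    by (auto simp: continuous_map_in_subtopology continuous_map_componentwise_UNIV)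
qed

section \<open>Injective d-maps and their action on traces\<close>

locale dmap = X: dspace X + Y: dspace Y for X :: "'a dspace" and Y :: "'b dspace" +
  fixes f :: "'a \<Rightarrow> 'b"
  assumes cont: "continuous_map (dtop X) (dtop Y) f"
    and dpath: "p \<in> dpaths X \<Longrightarrow> (\<lambda>s\<in>{0..1}. f (p s)) \<in> dpaths Y"
    and inj: "inj f"
begin

definition push where "push i p = (\<lambda>x\<in>cylinder i. f (p x))"

lemma push_apply: "\<lbrakk>s \<in> {0..1}; t \<in> standard_simplex (i - 1)\<rbrakk> \<Longrightarrow> push i p (s, t) = f (p (s, t))"
  by (simp add: push_def cylinder_def)

lemma push_extensional: "push i p \<in> extensional (cylinder i)"
  by (simp add: push_def)

lemma push_ipath:
  assumes p: "p \<in> ipaths i X"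
  shows "push i p \<in> ipaths i Y"
proof -
  have "continuous_map (cylinder_top i) (dtop Y) (f \<circ> p)"
    using p cont by (auto simp: ipaths_def intro: continuous_map_compose)
  then have "continuous_map (cylinder_top i) (dtop Y) (push i p)"
    by (rule continuous_map_eq) (auto simp: push_apply)
  moreover have "(\<lambda>s\<in>{0..1}. push i p (s, t)) \<in> dpaths Y" if t: "t \<in> standard_simplex (i - 1)" for t
  proof -
    have "(\<lambda>s\<in>{0..1}. p (s, t)) \<in> dpaths X"
      using p t unfolding ipaths_def by blast
    then have "(\<lambda>s\<in>{0..1}. f ((\<lambda>s\<in>{0..1}. p (s, t)) s)) \<in> dpaths Y"
      by (rule dpath)
    moreover have "(\<lambda>s\<in>{0..1}. f ((\<lambda>s\<in>{0..1}. p (s, t)) s)) = (\<lambda>s\<in>{0..1}. push i p (s, t))"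
      using t by (intro restrict_ext) (simp add: push_apply)
    ultimately show ?thesis by simp
  qed
  ultimately show ?thesis
    by (simp add: ipaths_def push_extensional)
qed

lemma push_between: "p \<in> ipaths_between i X a b \<Longrightarrow> push i p \<in> ipaths_between i Y (f a) (f b)"
  using push_ipath by (auto simp: ipaths_between_def push_apply)

lemma trace_map_trace_of:
  assumes p: "p \<in> ipaths_between i X a b"
  shows "trace_map i Y f (trace_of i X p) = trace_of i Y (push i p)"
proof -
  have "(\<Union>p\<in>trace_of i X p. trace_of i Y (push i p)) = trace_of i Y (push i p)"
  proof (rule X.trace_of_Union[OF p])
    fix p q assume p: "p \<in> ipaths_between i X a b" and pq: "(p, q) \<in> reparam i X"
    obtain \<phi> where \<phi>: "time_change \<phi>" "q = pull i \<phi> (\<lambda>t. t) p"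
      using pq by (auto simp: reparam_iff)
    have "push i q = pull i \<phi> (\<lambda>t. t) (push i p)"
      using time_change_range[OF \<phi>(1)]
      by (intro cylinder_fun_eqI[OF push_extensional pull_extensional])
        (simp add: pull_apply push_apply \<phi>(2))
    then show "trace_of i Y (push i q) = trace_of i Y (push i p)"
      by (rule Y.trace_of_pull[OF push_between[OF p] \<phi>(1)])
  qed
  then show ?thesis
    by (simp add: trace_map_def push_def)
qed

lemma trace_map_between:
  "P \<in> traces_between i X a b \<Longrightarrow> trace_map i Y f P \<in> traces_between i Y (f a) (f b)"
  by (auto elim!: X.traces_betweenE simp: trace_map_trace_of)
    (auto simp: traces_between_def intro: push_between)

lemma trace_map_closed: "P \<in> traces i X \<Longrightarrow> trace_map i Y f P \<in> traces i Y"
  by (auto simp: X.traces_iff Y.traces_iff intro: trace_map_between)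

lemma trace_map_concat:
  assumes "P \<in> traces_between i X a b" "Q \<in> traces_between i X b c"
  shows "trace_map i Y f (trace_concat i X P Q) = trace_concat i Y (trace_map i Y f P) (trace_map i Y f Q)"
proof -
  obtain p where p: "p \<in> ipaths_between i X a b" "P = trace_of i X p"
    using assms(1) by (rule X.traces_betweenE)
  obtain q where q: "q \<in> ipaths_between i X b c" "Q = trace_of i X q"
    using assms(2) by (rule X.traces_betweenE)
  have "push i (ipath_concat i p q) = ipath_concat i (push i p) (push i q)"
    by (intro cylinder_fun_eqI[OF push_extensional Y.ipath_concat_extensional])
      (auto simp: push_apply X.ipath_concat_apply Y.ipath_concat_apply)
  then show ?thesis
    using p q push_between[OF p(1)] push_between[OF q(1)]
    by (simp add: X.trace_concat_trace_of Y.trace_concat_trace_of trace_map_trace_of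
        trace_map_trace_of[OF X.ipath_concat_between[OF p(1) q(1)]])
qed

lemma trace_map_pull:
  assumes "P \<in> traces n X"
    and \<sigma>: "simplex_map m n \<sigma>"
  shows "trace_map m Y f (X.trace_pull m \<sigma> P) = Y.trace_pull m \<sigma> (trace_map n Y f P)"
proof -
  obtain a b p where p: "p \<in> ipaths_between n X a b" "P = trace_of n X p"
    using assms(1) by (auto simp: X.traces_iff elim!: X.traces_betweenE)
  note \<sigma>' = simplex_mapD[OF \<sigma>]
  have "push m (pull m (\<lambda>s. s) \<sigma> p) = pull m (\<lambda>s. s) \<sigma> (push n p)"
    using \<sigma>' by (intro cylinder_fun_eqI[OF push_extensional pull_extensional])
      (simp add: pull_apply push_apply)
  then show ?thesis
    using p X.pull_between[OF p(1) time_change_id \<sigma>] push_between[OF p(1)]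
    by (simp add: X.trace_pull_trace_of[OF _ \<sigma>] Y.trace_pull_trace_of[OF _ \<sigma>] trace_map_trace_of)
qed

text \<open>Injectivity of \<open>f\<close> prevents traces with different end and start points from
  becoming composable. Without this the linear extension would not be multiplicative.\<close>

lemma trace_map_composable:
  assumes "P \<in> traces i X" "Q \<in> traces i X"
  shows "composable i Y (trace_map i Y f P) (trace_map i Y f Q) \<longleftrightarrow> composable i X P Q"
proof -
  obtain a b a' b' where "P \<in> traces_between i X a b" "Q \<in> traces_between i X a' b'"
    using assms by (auto simp: X.traces_iff)
  then show ?thesis
    using X.composable_iff[of P i a b Q a' b'] Y.composable_iff[OF trace_map_between trace_map_between]
      inj by (auto simp: inj_def)
qed

end


section \<open>The simplicial algebra of a directed space\<close>

text \<open>Traces compose like the arrows of a category: composability compares an inner pair of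
  points, and composing keeps the outer ones. So both bracketings ask for the same two
  matches.\<close>

lemma (in dspace) traces_partial_semigroup:
  assumes "cring R"
  shows "partial_semigroup R (traces i X) (composable i X) (trace_concat i X)"
proof -
  interpret cring R by fact
  show ?thesis
  proof
    fix P Q assume "P \<in> traces i X" "Q \<in> traces i X" "composable i X P Q"
    then show "trace_concat i X P Q \<in> traces i X"
      using trace_concat_between unfolding composable_def traces_iff by blast
  next
    fix P Q W assume "P \<in> traces i X" "Q \<in> traces i X" "W \<in> traces i X"
    then obtain a b b' c c' d where t: "P \<in> traces_between i X a b"
        "Q \<in> traces_between i X b' c" "W \<in> traces_between i X c' d"
      by (auto simp: traces_iff)
    note pq = composable_iff[OF t(1,2)] and qw = composable_iff[OF t(2,3)]
    show "composable i X P Q \<and> composable i X (trace_concat i X P Q) W \<longleftrightarrow>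
        composable i X Q W \<and> composable i X P (trace_concat i X Q W)"
    proof (cases "b = b' \<and> c = c'")
      case True
      then have "trace_concat i X P Q \<in> traces_between i X a c" "trace_concat i X Q W \<in> traces_between i X b' d"
        using t trace_concat_between by blast+
      then show ?thesis
        using True t pq qw composable_iff by blast
    next
      case False
      have "trace_concat i X P Q \<in> traces_between i X a c" if "b = b'"
        using t that trace_concat_between by blast
      moreover have "trace_concat i X Q W \<in> traces_between i X b' d" if "c = c'"
        using t that trace_concat_between by blast
      ultimately show ?thesis
        using False t pq qw composable_iff by blast
    qed
    show "trace_concat i X (trace_concat i X P Q) W = trace_concat i X P (trace_concat i X Q W)"
      if "composable i X P Q" "composable i X (trace_concat i X P Q) W"
    proof -
      have b: "b = b'"
        using that pq by simp
      then have "trace_concat i X P Q \<in> traces_between i X a c"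
        using t trace_concat_between by blast
      then have "c = c'"
        using that(2) t(3) composable_iff by blast
      then show ?thesis
        using t b trace_concat_assoc by blast
    qed
  qed
qed

lemma (in dspace) trace_algebra_nonunital: "cring R \<Longrightarrow> nonunital_algebra R (trace_algebra R X i)"
  unfolding trace_algebra_def
  by (rule partial_semigroup.free_nonunital_algebra[OF traces_partial_semigroup])

lemma (in dspace) trace_pull_alg_hom:
  assumes R: "cring R" and \<sigma>: "simplex_map m n \<sigma>"
  shows "lin_ext R (trace_pull m \<sigma>) \<in> alg_hom R (trace_algebra R X n) (trace_algebra R X m)"
  unfolding trace_algebra_def
proof (rule cring.lin_ext_alg_hom[OF R traces_partial_semigroup[OF R] traces_partial_semigroup[OF R]])
  show "trace_pull m \<sigma> \<in> traces n X \<rightarrow> traces m X"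
    using trace_pull_closed[OF _ \<sigma>] by blast
  fix P Q assume "P \<in> traces n X" "Q \<in> traces n X"
  then obtain a b b' c where t: "P \<in> traces_between n X a b" "Q \<in> traces_between n X b' c"
    by (auto simp: traces_iff)
  note tp = trace_pull_between[OF t(1) \<sigma>] trace_pull_between[OF t(2) \<sigma>]
  show "composable m X (trace_pull m \<sigma> P) (trace_pull m \<sigma> Q) \<longleftrightarrow> composable n X P Q"
    using composable_iff[OF t] composable_iff[OF tp] by simp
  show "trace_concat m X (trace_pull m \<sigma> P) (trace_pull m \<sigma> Q) = trace_pull m \<sigma> (trace_concat n X P Q)"
    if "composable n X P Q"
    using that composable_iff[OF t] t trace_pull_concat[OF t(1) _ \<sigma>] by simp
qed

lemma (in dspace) lin_ext_trace_pull_basis: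
  assumes R: "cring R" and \<sigma>: "simplex_map m n \<sigma>"
    and P: "P \<in> traces n X"
  shows "lin_ext R (trace_pull m \<sigma>) (basis R P) = basis R (trace_pull m \<sigma> P)"
  by (rule cring.lin_ext_basis[OF R _ P, where T' = "traces m X"]) (use trace_pull_closed[OF _ \<sigma>] in blast)

lemma (in dspace) trace_alg_hom_eqI:
  assumes "cring R" "f \<in> alg_hom R (trace_algebra R X n) B" "g \<in> alg_hom R (trace_algebra R X n) B"
    and "nonunital_algebra R B" "\<And>P. P \<in> traces n X \<Longrightarrow> f (basis R P) = g (basis R P)"
    and "u \<in> carrier (trace_algebra R X n)"
  shows "f u = g u"
  using cring.free_alg_hom_eqI[OF assms(1) assms(2,3)[unfolded trace_algebra_def] assms(4,5)
      assms(6)[unfolded trace_algebra_def]] .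

text \<open>The composite is given a name \<open>\<rho>\<close> of its own so that it can be
  supplied in simplified form, in particular as the identity when a face cancels a
  degeneracy.\<close>

lemma (in dspace) lin_ext_trace_pull_pull:
  assumes R: "cring R" and u: "u \<in> carrier (trace_algebra R X n)"
    and \<sigma>: "simplex_map m n \<sigma>"
    and \<tau>: "simplex_map l m \<tau>"
    and \<rho>: "(\<lambda>t. \<sigma> (\<tau> t)) = \<rho>"
  shows "lin_ext R (trace_pull l \<tau>) (lin_ext R (trace_pull m \<sigma>) u) = lin_ext R (trace_pull l \<rho>) u"
proof -
  have \<rho>': "simplex_map l n \<rho>"
    using continuous_map_compose[OF \<tau> \<sigma>] \<rho> by (simp add: o_def)
  show ?thesis
    using R alg_hom_comp[OF trace_pull_alg_hom[OF R \<sigma>] trace_pull_alg_hom[OF R \<tau>]]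
      trace_pull_alg_hom[OF R \<rho>'] trace_algebra_nonunital[OF R] _ u
    by (rule trace_alg_hom_eqI)
      (simp add: lin_ext_trace_pull_basis[OF R \<sigma>] lin_ext_trace_pull_basis[OF R \<tau>]
        lin_ext_trace_pull_basis[OF R \<rho>'] trace_pull_closed[OF _ \<sigma>] trace_pull_pull[OF _ \<sigma> \<tau>] \<rho>)
qed

text \<open>The simplicial identities in which nothing cancels are commuting squares of maps of
  simplices, read contravariantly.\<close>

lemma (in dspace) lin_ext_trace_pull_square:
  assumes "cring R" "u \<in> carrier (trace_algebra R X n)"
    and "simplex_map m n \<sigma>" "simplex_map l m \<tau>" "simplex_map m' n \<sigma>'" "simplex_map l m' \<tau>'"
    and "(\<lambda>t. \<sigma> (\<tau> t)) = (\<lambda>t. \<sigma>' (\<tau>' t))"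
  shows "lin_ext R (trace_pull l \<tau>) (lin_ext R (trace_pull m \<sigma>) u) =
    lin_ext R (trace_pull l \<tau>') (lin_ext R (trace_pull m' \<sigma>') u)"
  using lin_ext_trace_pull_pull[OF assms(1-4) refl] lin_ext_trace_pull_pull[OF assms(1,2,5,6) refl] assms(7)
  by simp

lemma (in dspace) lin_ext_trace_pull_id:
  assumes R: "cring R" and u: "u \<in> carrier (trace_algebra R X n)"
  shows "lin_ext R (trace_pull n (\<lambda>t. t)) u = u"
proof -
  have i: "simplex_map n n (\<lambda>t. t)"
    by simp
  show ?thesis
    using R trace_pull_alg_hom[OF R i] alg_hom_id trace_algebra_nonunital[OF R] _ u
    by (rule trace_alg_hom_eqI) (simp add: lin_ext_trace_pull_basis[OF R i] trace_pull_id)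
qed

lemma simplical_face_face:
  "i < j \<Longrightarrow> (\<lambda>t. simplical_face j (simplical_face i t)) = (\<lambda>t. simplical_face i (simplical_face (j - 1) t))"
  by (intro ext) (auto simp: simplical_face_def)

lemma simplex_degen_face_less:
  "i < j \<Longrightarrow> (\<lambda>t. simplex_degen j (simplical_face i t)) = (\<lambda>t. simplical_face i (simplex_degen (j - 1) t))"
  by (intro ext) (auto simp: simplical_face_def simplex_degen_def)

lemma simplex_degen_face_same: "(\<lambda>t. simplex_degen j (simplical_face j t)) = (\<lambda>t. t)"
  by (intro ext) (auto simp: simplical_face_def simplex_degen_def)

lemma simplex_degen_face_Suc: "(\<lambda>t. simplex_degen j (simplical_face (j + 1) t)) = (\<lambda>t. t)"
  by (intro ext) (auto simp: simplical_face_def simplex_degen_def)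

lemma simplex_degen_face_greater:
  "j + 1 < i \<Longrightarrow> (\<lambda>t. simplex_degen j (simplical_face i t)) = (\<lambda>t. simplical_face (i - 1) (simplex_degen j t))"
  by (intro ext) (auto simp: simplical_face_def simplex_degen_def)

lemma simplex_degen_degen:
  "i \<le> j \<Longrightarrow> (\<lambda>t. simplex_degen j (simplex_degen i t)) = (\<lambda>t. simplex_degen i (simplex_degen (j + 1) t))"
  by (intro ext) (auto simp: simplex_degen_def)

lemma simp_trace_algebra_sel:
  "level (simp_trace_algebra R X) n = trace_algebra R X (n + 1)"
  "face (simp_trace_algebra R X) n j = lin_ext R (trace_face n j X)"
  "degen (simp_trace_algebra R X) n k = lin_ext R (trace_degen (n + 1) k X)"
  by (simp_all add: simp_trace_algebra_def)

lemma (in dspace) simplicial_trace_algebra: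
  assumes R: "cring R"
  shows "simplicial_algebra R (simp_trace_algebra R X)"
proof -
  \<comment> \<open>Degree \<open>n\<close> of the simplicial algebra is spanned by traces of index
    \<open>n + 1\<close>. All four rules are stated with trace indices; the primed ones are the
    unprimed ones one degree lower.\<close>
  have f: "simplex_map n (n + 1) (simplical_face j)" if "1 \<le> n" "j \<le> n" for n j
    using continuous_simplical_face[OF that] by simp
  have d: "simplex_map (n + 1 + 1) (n + 1) (simplex_degen k)" if "k \<le> n" for n k
    using continuous_simplex_degen[OF that] by simp
  have f': "simplex_map (n - 1) n (simplical_face j)" if "2 \<le> n" "j \<le> n - 1" for n j
    using f[of "n - 1" j] that by simp
  have d': "simplex_map (n + 1) n (simplex_degen k)" if "1 \<le> n" "k \<le> n - 1" for n k
    using d[of k "n - 1"] that by simp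
  let ?F = "\<lambda>n j. lin_ext R (trace_pull n (simplical_face j))"
    and ?D = "\<lambda>n k. lin_ext R (trace_pull n (simplex_degen k))"
  note sel = simp_trace_algebra_sel trace_face_eq_pull trace_degen_eq_pull
  show ?thesis
  proof (rule simplicial_algebraI; unfold sel)
    show "nonunital_algebra R (trace_algebra R X (n + 1))" for n
      by (rule trace_algebra_nonunital[OF R])
    show "?F n j \<in> alg_hom R (trace_algebra R X (n + 1)) (trace_algebra R X (n - 1 + 1))"
      if "1 \<le> n" "j \<le> n" for n j
      using trace_pull_alg_hom[OF R f[OF that]] that by simp
    show "?D (n + 1 + 1) k \<in> alg_hom R (trace_algebra R X (n + 1)) (trace_algebra R X (n + 1 + 1))"
      if "k \<le> n" for n k
      by (rule trace_pull_alg_hom[OF R d[OF that]])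
  next
    fix n i j u
    assume u: "u \<in> carrier (trace_algebra R X (n + 1))"
    note sq = lin_ext_trace_pull_square[OF R u] and pp = lin_ext_trace_pull_pull[OF R u]
    have e: "n - 1 + 1 = n" if "1 \<le> n"
      using that by simp
    show "?F (n - 1) i (?F n j u) = ?F (n - 1) (j - 1) (?F n i u)" if n: "2 \<le> n" "i < j" "j \<le> n"
      by (rule sq) (use n f f' simplical_face_face[OF n(2)] in auto)
    show "?F (n + 1) i (?D (n + 1 + 1) j u) = ?D (n - 1 + 1 + 1) (j - 1) (?F n i u)"
      if n: "1 \<le> n" "i < j" "j \<le> n"
      unfolding e[OF n(1)]
      by (rule sq) (use n f[of "n + 1" i] f[of n i] d[of j n] d' simplex_degen_face_less[OF n(2)] in auto)
    show "?F (n + 1) j (?D (n + 1 + 1) j u) = u" if n: "j \<le> n"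
      using pp[OF d[OF n] f[of "n + 1" j] simplex_degen_face_same] n lin_ext_trace_pull_id[OF R u] by simp
    show "?F (n + 1) (j + 1) (?D (n + 1 + 1) j u) = u" if n: "j \<le> n"
      using pp[OF d[OF n] f[of "n + 1" "j + 1"] simplex_degen_face_Suc] n lin_ext_trace_pull_id[OF R u] by simp
    show "?F (n + 1) i (?D (n + 1 + 1) j u) = ?D (n - 1 + 1 + 1) j (?F n (i - 1) u)"
      if n: "1 \<le> n" "j + 1 < i" "i \<le> n + 1"
      unfolding e[OF n(1)]
      by (rule sq) (use n f[of "n + 1" i] f[of n "i - 1"] d[of j n] d' simplex_degen_face_greater[OF n(2)] in auto)
    show "?D (n + 1 + 1 + 1) i (?D (n + 1 + 1) j u) = ?D (n + 1 + 1 + 1) (j + 1) (?D (n + 1 + 1) i u)"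
      if n: "i \<le> j" "j \<le> n"
      by (rule sq) (use n d[of i "n + 1"] d[of j n] d[of "j + 1" "n + 1"] d[of i n] simplex_degen_degen[OF n(1)] in auto)
  qed
qed

lemma (in dmap) trace_map_alg_hom:
  assumes R: "cring R"
  shows "lin_ext R (trace_map i Y f) \<in> alg_hom R (trace_algebra R X i) (trace_algebra R Y i)"
  unfolding trace_algebra_def
proof (rule cring.lin_ext_alg_hom[OF R X.traces_partial_semigroup[OF R] Y.traces_partial_semigroup[OF R]])
  show "trace_map i Y f \<in> traces i X \<rightarrow> traces i Y"
    using trace_map_closed by blast
  fix P Q assume PQ: "P \<in> traces i X" "Q \<in> traces i X"
  show "composable i Y (trace_map i Y f P) (trace_map i Y f Q) \<longleftrightarrow> composable i X P Q"
    by (rule trace_map_composable[OF PQ])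
  show "trace_concat i Y (trace_map i Y f P) (trace_map i Y f Q) = trace_map i Y f (trace_concat i X P Q)"
    if "composable i X P Q"
    using that trace_map_concat unfolding composable_def by metis
qed

lemma (in dmap) lin_ext_trace_map_basis:
  assumes R: "cring R" and P: "P \<in> traces i X"
  shows "lin_ext R (trace_map i Y f) (basis R P) = basis R (trace_map i Y f P)"
  by (rule cring.lin_ext_basis[OF R _ P, where T' = "traces i Y"]) (use trace_map_closed in blast)

lemma (in dmap) lin_ext_trace_map_pull:
  assumes R: "cring R" and \<sigma>: "simplex_map m n \<sigma>"
    and u: "u \<in> carrier (trace_algebra R X n)"
  shows "lin_ext R (trace_map m Y f) (lin_ext R (X.trace_pull m \<sigma>) u) =
    lin_ext R (Y.trace_pull m \<sigma>) (lin_ext R (trace_map n Y f) u)"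
  using R alg_hom_comp[OF X.trace_pull_alg_hom[OF R \<sigma>] trace_map_alg_hom[OF R]]
    alg_hom_comp[OF trace_map_alg_hom[OF R] Y.trace_pull_alg_hom[OF R \<sigma>]]
    Y.trace_algebra_nonunital[OF R] _ u
  by (rule X.trace_alg_hom_eqI)
    (simp add: X.lin_ext_trace_pull_basis[OF R \<sigma>] Y.lin_ext_trace_pull_basis[OF R \<sigma>]
      lin_ext_trace_map_basis[OF R] X.trace_pull_closed[OF _ \<sigma>] trace_map_closed trace_map_pull[OF _ \<sigma>])

lemma (in dmap) simplicial_trace_map:
  assumes R: "cring R"
  shows "simplicial_map R (simp_trace_algebra R X) (simp_trace_algebra R Y) (simp_trace_map R Y f)"
  unfolding simplicial_map_def simp_trace_algebra_sel simp_trace_map_def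
    X.trace_face_eq_pull X.trace_degen_eq_pull Y.trace_face_eq_pull Y.trace_degen_eq_pull
proof (intro conjI allI impI ballI)
  show "lin_ext R (trace_map (n + 1) Y f) \<in> alg_hom R (trace_algebra R X (n + 1)) (trace_algebra R Y (n + 1))" for n
    by (rule trace_map_alg_hom[OF R])
  show "lin_ext R (trace_map (n - 1 + 1) Y f) (lin_ext R (X.trace_pull n (simplical_face j)) u) =
      lin_ext R (Y.trace_pull n (simplical_face j)) (lin_ext R (trace_map (n + 1) Y f) u)"
    if "1 \<le> n" "j \<le> n" "u \<in> carrier (trace_algebra R X (n + 1))" for n j u
    using lin_ext_trace_map_pull[OF R _ that(3), of n "simplical_face j"] continuous_simplical_face[OF that(1,2)] that(1)
    by simp
  show "lin_ext R (trace_map (n + 1 + 1) Y f) (lin_ext R (X.trace_pull (n + 1 + 1) (simplex_degen k)) u) =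
      lin_ext R (Y.trace_pull (n + 1 + 1) (simplex_degen k)) (lin_ext R (trace_map (n + 1) Y f) u)"
    if "k \<le> n" "u \<in> carrier (trace_algebra R X (n + 1))" for n k u
    using lin_ext_trace_map_pull[OF R _ that(2), of "n + 1 + 1" "simplex_degen k"] continuous_simplex_degen[OF that(1)]
    by simp
qed


section \<open>Disjoint unions\<close>

lemma continuous_map_Inl: "continuous_map (dtop X1) (dtop (disjoint_union X1 X2)) Inl"
  and continuous_map_Inr: "continuous_map (dtop X2) (dtop (disjoint_union X1 X2)) Inr"
  by (auto simp: continuous_map_def topspace_disjoint_union openin_disjoint_union Collect_conj_eq
      vimage_def[symmetric])

lemma dpaths_disjoint_union:
  "dpaths (disjoint_union X1 X2) =
    (\<lambda>p. \<lambda>s\<in>{0..1}. Inl (p s)) ` dpaths X1 \<union> (\<lambda>p. \<lambda>s\<in>{0..1}. Inr (p s)) ` dpaths X2"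
  by (simp add: disjoint_union_def)

lemma (in dspace) dpath_continuous: "p \<in> dpaths X \<Longrightarrow> continuous_map (top_of_set {0..1}) (dtop X) p"
  using dspace by (simp add: is_dspace_def)

lemma (in dspace) dpath_image:
  assumes f: "continuous_map (dtop X) T f" and p: "p \<in> dpaths X"
  shows "continuous_map (top_of_set {0..1}) T (\<lambda>s\<in>{0..1}. f (p s))"
proof -
  have "continuous_map (top_of_set {0..1}) T (f \<circ> p)"
    using dpath_continuous[OF p] f by (rule continuous_map_compose)
  then show ?thesis
    by (rule continuous_map_eq) auto
qed

lemma dpath_image_reparam:
  assumes "\<phi> ` {0..1} \<subseteq> {0..1 :: real}"
  shows "(\<lambda>s\<in>{0..1}. (\<lambda>s\<in>{0..1}. f (p s)) (\<phi> s)) = (\<lambda>s\<in>{0..1}. f ((\<lambda>s\<in>{0..1}. p (\<phi> s)) s))"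
  using assms by (intro restrict_ext) (auto simp: image_subset_iff)

lemma dpath_image_concat:
  "path_concat (\<lambda>s\<in>{0..1}. f (p s)) (\<lambda>s\<in>{0..1}. f (q s)) = (\<lambda>s\<in>{0..1}. f (path_concat p q s))"
  unfolding path_concat_def by (intro restrict_ext) auto

lemma is_dspace_disjoint_union:
  assumes "is_dspace X1" "is_dspace X2"
  shows "is_dspace (disjoint_union X1 X2)"
proof -
  interpret X1: dspace X1 by (unfold_locales) fact
  interpret X2: dspace X2 by (unfold_locales) fact
  let ?X = "disjoint_union X1 X2"
  show ?thesis
    unfolding is_dspace_def
  proof (intro conjI ballI allI impI)
    fix p assume p: "p \<in> dpaths ?X"
    then show "p \<in> extensional {0..1}"
      by (auto simp: dpaths_disjoint_union)
    show "continuous_map (top_of_set {0..1}) (dtop ?X) p"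
      using p X1.dpath_image[OF continuous_map_Inl] X2.dpath_image[OF continuous_map_Inr]
      unfolding dpaths_disjoint_union by blast
    show "(\<lambda>s\<in>{0..1}. p (\<phi> s)) \<in> dpaths ?X"
      if \<phi>: "continuous_on {0..1} \<phi>" "mono_on {0..1} \<phi>" "\<phi> ` {0..1} \<subseteq> {0..1}" for \<phi>
      using p X1.dpath_reparam[OF _ \<phi>] X2.dpath_reparam[OF _ \<phi>]
      unfolding dpaths_disjoint_union by (auto simp only: Un_iff image_iff dpath_image_reparam[OF \<phi>(3)])
    fix q assume q: "q \<in> dpaths ?X" and pq: "p 1 = q 0"
    from p consider p' where "p' \<in> dpaths X1" "p = (\<lambda>s\<in>{0..1}. Inl (p' s))"
      | p' where "p' \<in> dpaths X2" "p = (\<lambda>s\<in>{0..1}. Inr (p' s))"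
      by (auto simp: dpaths_disjoint_union)
    then show "path_concat p q \<in> dpaths ?X"
    proof cases
      case 1
      \<comment> \<open>The common point \<open>p 1 = q 0\<close> lies in the left summand, which
        excludes a \<open>q\<close> coming from the right one.\<close>
      then obtain q' where q': "q' \<in> dpaths X1" "q = (\<lambda>s\<in>{0..1}. Inl (q' s))"
        using q pq by (auto simp: dpaths_disjoint_union)
      then have "path_concat p' q' \<in> dpaths X1"
        using 1 pq by (intro X1.dpath_concat) auto
      then show ?thesis
        unfolding 1 q' dpath_image_concat dpaths_disjoint_union by blast
    next
      case 2
      then obtain q' where q': "q' \<in> dpaths X2" "q = (\<lambda>s\<in>{0..1}. Inr (q' s))"
        using q pq by (auto simp: dpaths_disjoint_union)
      then have "path_concat p' q' \<in> dpaths X2"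
        using 2 pq by (intro X2.dpath_concat) auto
      then show ?thesis
        unfolding 2 q' dpath_image_concat dpaths_disjoint_union by blast
    qed
  next
    fix a assume "a \<in> topspace (dtop ?X)"
    then consider b where "b \<in> topspace (dtop X1)" "a = Inl b" | b where "b \<in> topspace (dtop X2)" "a = Inr b"
      by (auto simp: topspace_disjoint_union)
    then show "(\<lambda>s\<in>{0..1}. a) \<in> dpaths ?X"
    proof cases
      case 1
      then have "(\<lambda>s\<in>{0..1}. b) \<in> dpaths X1"
        using X1.dspace by (simp add: is_dspace_def)
      moreover have "(\<lambda>s\<in>{0..1::real}. a) = (\<lambda>s\<in>{0..1}. Inl ((\<lambda>s\<in>{0..1}. b) s))"
        using 1 by (intro restrict_ext) auto
      ultimately show ?thesis
        unfolding dpaths_disjoint_union by blast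
    next
      case 2
      then have "(\<lambda>s\<in>{0..1}. b) \<in> dpaths X2"
        using X2.dspace by (simp add: is_dspace_def)
      moreover have "(\<lambda>s\<in>{0..1::real}. a) = (\<lambda>s\<in>{0..1}. Inr ((\<lambda>s\<in>{0..1}. b) s))"
        using 2 by (intro restrict_ext) auto
      ultimately show ?thesis
        unfolding dpaths_disjoint_union by blast
    qed
  qed
qed

lemma dmap_Inl: "\<lbrakk>is_dspace X1; is_dspace X2\<rbrakk> \<Longrightarrow> dmap X1 (disjoint_union X1 X2) Inl"
  by unfold_locales (auto simp: is_dspace_disjoint_union continuous_map_Inl dpaths_disjoint_union)

lemma dmap_Inr: "\<lbrakk>is_dspace X1; is_dspace X2\<rbrakk> \<Longrightarrow> dmap X2 (disjoint_union X1 X2) Inr"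
  by unfold_locales (auto simp: is_dspace_disjoint_union continuous_map_Inr dpaths_disjoint_union)

lemma (in dmap) trace_map_surj:
  assumes op: "\<And>U. openin (dtop X) U \<Longrightarrow> openin (dtop Y) (f ` U)"
    and p: "p \<in> ipaths_between i Y a b"
    and lift: "\<And>t. t \<in> standard_simplex (i - 1) \<Longrightarrow>
      \<exists>q\<in>dpaths X. (\<lambda>s\<in>{0..1}. p (s, t)) = (\<lambda>s\<in>{0..1}. f (q s))"
  shows "\<exists>Q\<in>traces i X. trace_map i Y f Q = trace_of i Y p"
proof -
  define p' where "p' = (\<lambda>x\<in>cylinder i. the_inv f (p x))"
  have inv: "the_inv f (f x) = x" for x
    using inj by (rule the_inv_f_f)
  have p'_dpath: "(\<lambda>s\<in>{0..1}. p' (s, t)) \<in> dpaths X"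
    and p'_eq: "s \<in> {0..1} \<Longrightarrow> f (p' (s, t)) = p (s, t)" if t: "t \<in> standard_simplex (i - 1)" for s t
  proof -
    obtain q where q: "q \<in> dpaths X" "(\<lambda>s\<in>{0..1}. p (s, t)) = (\<lambda>s\<in>{0..1}. f (q s))"
      using lift[OF t] by blast
    have pq: "p (s, t) = f (q s)" if "s \<in> {0..1}" for s
      using fun_cong[OF q(2), of s] that by simp
    then have p'q: "p' (s, t) = q s" if "s \<in> {0..1}" for s
      using that t by (simp add: p'_def cylinder_def inv)
    have "q \<in> extensional {0..1}"
      using X.dspace q(1) by (simp add: is_dspace_def)
    then have "(\<lambda>s\<in>{0..1}. p' (s, t)) = q"
      by (intro extensionalityI[of _ "{0..1}"]) (auto simp: p'q)
    then show "(\<lambda>s\<in>{0..1}. p' (s, t)) \<in> dpaths X"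
      using q(1) by simp
    show "f (p' (s, t)) = p (s, t)" if "s \<in> {0..1}"
      using that by (simp add: pq p'q)
  qed
  have p_eq: "p x = f (p' x)" if "x \<in> topspace (cylinder_top i)" for x
    using that p'_eq by (cases x) simp
  have pc: "continuous_map (cylinder_top i) (dtop Y) p"
    using p by (simp add: ipaths_between_def ipaths_def)
  have p'_top: "p' (s, t) \<in> topspace (dtop X)" if "s \<in> {0..1}" "t \<in> standard_simplex (i - 1)" for s t
  proof -
    have "continuous_map (top_of_set {0..1}) (dtop X) (\<lambda>s\<in>{0..1}. p' (s, t))"
      using p'_dpath[OF that(2)] by (rule X.dpath_continuous)
    then show ?thesis
      using that by (auto dest!: continuous_map_funspace)
  qed
  have "continuous_map (cylinder_top i) (dtop X) p'"
    unfolding continuous_map_def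
  proof (intro conjI allI impI)
    show "p' \<in> topspace (cylinder_top i) \<rightarrow> topspace (dtop X)"
      using p'_top by auto
    fix U assume U: "openin (dtop X) U"
    have "{x \<in> topspace (cylinder_top i). p' x \<in> U} = {x \<in> topspace (cylinder_top i). p x \<in> f ` U}"
      using p_eq inj_image_mem_iff[OF inj] by force
    then show "openin (cylinder_top i) {x \<in> topspace (cylinder_top i). p' x \<in> U}"
      using openin_continuous_map_preimage[OF pc op[OF U]] by simp
  qed
  then have p'_ipath: "p' \<in> ipaths i X"
    using p'_dpath by (simp add: ipaths_def p'_def)
  obtain t0 where t0: "t0 \<in> standard_simplex (i - 1)"
    using nonempty_standard_simplex by blast
  \<comment> \<open>The end points of \<open>p\<close> do not depend on \<open>t\<close>, and
    injectivity of \<open>f\<close> transfers this to the lift; \<open>t0\<close> merely names the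
    common values.\<close>
  have "p' (0, t) = p' (0, t0) \<and> p' (1, t) = p' (1, t0)" if t: "t \<in> standard_simplex (i - 1)" for t
    using p'_eq[OF t, of 0] p'_eq[OF t, of 1] p'_eq[OF t0, of 0] p'_eq[OF t0, of 1] p t t0
    by (auto simp: ipaths_between_def intro!: injD[OF inj])
  then have b: "p' \<in> ipaths_between i X (p' (0, t0)) (p' (1, t0))"
    using p'_ipath by (simp add: ipaths_between_def)
  have "push i p' = p"
    by (rule cylinder_fun_eqI[OF push_extensional])
      (use p p'_eq in \<open>auto simp: ipaths_between_def ipaths_def push_apply\<close>)
  then have "trace_map i Y f (trace_of i X p') = trace_of i Y p"
    using trace_map_trace_of[OF b] by simp
  moreover have "trace_of i X p' \<in> traces i X"
    using b by (auto simp: X.traces_iff traces_between_def)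
  ultimately show ?thesis by blast
qed

text \<open>The common start point of all the paths \<open>p(\<cdot>, t)\<close> decides in which summand a trace lies.\<close>

lemma traces_disjoint_union:
  assumes "is_dspace X1" "is_dspace X2" and P: "P \<in> traces i (disjoint_union X1 X2)"
  shows "(\<exists>Q\<in>traces i X1. trace_map i (disjoint_union X1 X2) Inl Q = P) \<or>
    (\<exists>Q\<in>traces i X2. trace_map i (disjoint_union X1 X2) Inr Q = P)"
proof -
  let ?X = "disjoint_union X1 X2"
  interpret l: dmap X1 ?X Inl
    using assms by (intro dmap_Inl)
  interpret r: dmap X2 ?X Inr
    using assms by (intro dmap_Inr)
  obtain a b p where p: "p \<in> ipaths_between i ?X a b" "P = trace_of i ?X p"
    using P by (auto simp: l.Y.traces_iff elim!: l.Y.traces_betweenE)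
  have dp: "(\<lambda>s\<in>{0..1}. p (s, t)) \<in> dpaths ?X" "p (0, t) = a" if "t \<in> standard_simplex (i - 1)" for t
    using p(1) that by (auto simp: ipaths_between_def ipaths_def)
  have vim: "Inl -` Inl ` U = U" "Inr -` Inl ` U = {}" "Inr -` Inr ` V = V" "Inl -` Inr ` V = {}"
    for U :: "'a set" and V :: "'b set"
    by auto
  show ?thesis
  proof (cases a)
    case (Inl c)
    have "\<exists>Q\<in>traces i X1. trace_map i ?X Inl Q = trace_of i ?X p"
    proof (rule l.trace_map_surj[OF _ p(1)])
      fix t assume t: "t \<in> standard_simplex (i - 1)"
      have "(\<lambda>s\<in>{0..1}. p (s, t)) \<noteq> (\<lambda>s\<in>{0..1}. Inr (q s))" for q
        using dp(2)[OF t] Inl by (auto dest!: fun_cong[of _ _ 0])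
      then show "\<exists>q\<in>dpaths X1. (\<lambda>s\<in>{0..1}. p (s, t)) = (\<lambda>s\<in>{0..1}. Inl (q s))"
        using dp(1)[OF t] unfolding dpaths_disjoint_union by blast
    qed (simp add: openin_disjoint_union vim)
    with p show ?thesis by blast
  next
    case (Inr c)
    have "\<exists>Q\<in>traces i X2. trace_map i ?X Inr Q = trace_of i ?X p"
    proof (rule r.trace_map_surj[OF _ p(1)])
      fix t assume t: "t \<in> standard_simplex (i - 1)"
      have "(\<lambda>s\<in>{0..1}. p (s, t)) \<noteq> (\<lambda>s\<in>{0..1}. Inl (q s))" for q
        using dp(2)[OF t] Inr by (auto dest!: fun_cong[of _ _ 0])
      then show "\<exists>q\<in>dpaths X2. (\<lambda>s\<in>{0..1}. p (s, t)) = (\<lambda>s\<in>{0..1}. Inr (q s))"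
        using dp(1)[OF t] unfolding dpaths_disjoint_union by blast
    qed (simp add: openin_disjoint_union vim)
    with p show ?thesis by blast
  qed
qed

theorem mainTheorem6:
  fixes R :: "('r, 'm) ring_scheme" and X1 :: "'a dspace" and X2 :: "'b dspace"
  assumes "cring R" and "is_dspace X1" and "is_dspace X2"
  shows "let X = disjoint_union X1 X2;
             A1 = simp_trace_algebra R X1;
             A2 = simp_trace_algebra R X2;
             A = simp_trace_algebra R X;
             C = simp_coprod R A1 A2;
             h = simp_copair R A1 A2 A (simp_trace_map R X Inl) (simp_trace_map R X Inr);
             K = simp_kernel C A h;
             incl = (\<lambda>n x. x)
         in short_exact R K incl C h A \<and>
            (\<exists>d. long_exact_HA R K incl C h A d \<and> is_connecting R K incl C h A d)"
proof -
  let ?X = "disjoint_union X1 X2"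
  let ?A1 = "simp_trace_algebra R X1" and ?A2 = "simp_trace_algebra R X2" and ?A = "simp_trace_algebra R ?X"
  let ?C = "simp_coprod R ?A1 ?A2"
  let ?h = "simp_copair R ?A1 ?A2 ?A (simp_trace_map R ?X Inl) (simp_trace_map R ?X Inr)"
  interpret R: cring R by fact
  interpret l: dmap X1 ?X Inl
    using assms by (intro dmap_Inl)
  interpret r: dmap X2 ?X Inr
    using assms by (intro dmap_Inr)
  interpret C: two_simplicial_algebras R ?A1 ?A2
    by unfold_locales (rule l.X.simplicial_trace_algebra r.X.simplicial_trace_algebra; fact)+
  note A = l.Y.simplicial_trace_algebra[OF assms(1)]
  note fg = l.simplicial_trace_map[OF assms(1)] r.simplicial_trace_map[OF assms(1)]
  note h = C.simplicial_map_copair[OF A fg] and hl = C.simp_copair_inl[OF A fg]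
    and hr = C.simp_copair_inr[OF A fg]
  interpret hom: simplicial_hom R ?C ?A ?h
    by unfold_locales (rule C.simplicial_algebra_coprod A h)+
  \<comment> \<open>A trace of the union is the image of a trace \<open>Q\<close> of one summand,
    and \<open>h\<close> sends the injected basis element of \<open>Q\<close> to that of
    \<open>P\<close>.\<close>
  have basis: "basis R P \<in> ?h n ` carrier (level ?C n)" if P: "P \<in> traces (n + 1) ?X" for n P
  proof -
    consider Q where "Q \<in> traces (n + 1) X1" "trace_map (n + 1) ?X Inl Q = P"
      | Q where "Q \<in> traces (n + 1) X2" "trace_map (n + 1) ?X Inr Q = P"
      using traces_disjoint_union[OF assms(2,3) P] by blast
    then show ?thesis
    proof cases
      case 1
      have b: "basis R Q \<in> carrier (level ?A1 n)"
        using 1(1) by (simp add: simp_trace_algebra_sel trace_algebra_def R.free_basis_closed)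
      have "basis R P = ?h n (C.inl n (basis R Q))"
        using l.lin_ext_trace_map_basis[OF assms(1) 1(1)] 1(2) hl[OF b] by (simp add: simp_trace_map_def)
      then show ?thesis
        using alg_hom_closed[OF C.inl_hom b] by blast
    next
      case 2
      have b: "basis R Q \<in> carrier (level ?A2 n)"
        using 2(1) by (simp add: simp_trace_algebra_sel trace_algebra_def R.free_basis_closed)
      have "basis R P = ?h n (C.inr n (basis R Q))"
        using r.lin_ext_trace_map_basis[OF assms(1) 2(1)] 2(2) hr[OF b] by (simp add: simp_trace_map_def)
      then show ?thesis
        using alg_hom_closed[OF C.inr_hom b] by blast
    qed
  qed
  \<comment> \<open>The image of \<open>h\<close> is a submodule, so it is everything as soon as it
    contains the basis.\<close>
  have surj: "u \<in> ?h n ` carrier (level ?C n)" if "u \<in> carrier (level ?A n)" for u n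
  proof -
    note I = hom.T.L.submoduleE[OF hom.f.image_submodule[of n]]
    have ops: "level ?A n = free_on R (traces (n + 1) ?X) (composable (n + 1) ?X) (trace_concat (n + 1) ?X)"
      by (simp add: simp_trace_algebra_sel trace_algebra_def)
    have "u \<in> carrier (free_on R (traces (n + 1) ?X) (composable (n + 1) ?X) (trace_concat (n + 1) ?X))"
      using that ops by simp
    then show ?thesis
    proof (induction rule: R.free_induct)
      case zero
      show ?case
      proof (rule image_eqI)
        show "(\<lambda>_. \<zero>\<^bsub>R\<^esub>) = ?h n \<zero>\<^bsub>level ?C n\<^esub>"
          using hom.f.zero[of n] by (simp only: ops R.free_simps)
      qed (rule hom.S.L.M.zero_closed)
    next
      case (add r P u)
      have "r \<odot>\<^bsub>level ?A n\<^esub> basis R P \<oplus>\<^bsub>level ?A n\<^esub> u \<in> ?h n ` carrier (level ?C n)"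
        by (rule I(5)[OF I(4)[OF add(1) basis[OF add(2)]] add(4)])
      then show ?case
        by (simp add: ops)
    qed
  qed
  interpret simplicial_surjection R ?C ?A ?h
    by unfold_locales (use surj in blast)
  show ?thesis
    unfolding Let_def using short_exact_kernel long_exact_sequence by blast
qed

end
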